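(* Let $\theta\in\,]0,1]$, $\lambda>0$, $\mathcal{J}(f)=E(\mathbf{y},\langle f,\boldsymbol{\nu}\rangle)+\lambda\|f\|_\theta$, and $$\mathcal{V}=\underset{f\in\mathcal{M}^+_{\mathrm{D}\otimes\mathrm{D},0}(\mathrm{K})}{\operatorname{argmin}}\mathcal{J}(f),\qquad \mathcal{V}_n=\underset{f\in\mathcal{M}^+_{\mathrm{D}\otimes\mathrm{D},0}(\mathcal{X}_n)}{\operatorname{argmin}}\mathcal{J}(f).$$ For any sequence $(f_n^\star)_{n=1}^\infty$ of discretized solutions with $f_n^\star\in\mathcal{V}_n$, and for any solution $f^\star\in\mathcal{V}$, the following convergences hold: 1. over the loss functional, $\lim_{n\to\infty}\mathcal{J}(f_n^\star)=\mathcal{J}(f^\star)$; 2. over the simulated measurements, $\lim_{n\to\infty}\langle f_n^\star,\boldsymbol{\nu}\rangle=\langle f^\star,\boldsymbol{\nu}\rangle$.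
   Context: $\mathrm{K}=[0,1]^2$ and $\mathrm{K}^c=\mathbb{R}^2\setminus\mathrm{K}$. Derivatives are in the sense of distributions: for $f\in\mathcal{D}'(\mathbb{R}^2)$, $[\mathrm{D}\otimes\mathrm{I}]\{f\}=\partial_{x_1}f$, $[\mathrm{I}\otimes\mathrm{D}]\{f\}=\partial_{x_2}f$, $[\mathrm{D}\otimes\mathrm{D}]\{f\}=\partial_{x_1}\partial_{x_2}f$. $\mathcal{M}(\mathrm{K})$ is the space of bounded (finite signed) Borel measures on $\mathbb{R}^2$ supported in $\mathrm{K}$, with total variation norm $\|\cdot\|_{\mathcal{M}}$. Define $$\mathcal{M}_{\mathrm{D}\otimes\mathrm{D},0}(\mathrm{K})=\{f\in\mathcal{D}'(\mathbb{R}^2):\ [\mathrm{D}\otimes\mathrm{D}]\{f\}\in\mathcal{M}(\mathrm{K})\ \text{and}\ \langle f,\phi\rangle=0\ \ \forall\phi\in\mathcal{C}_c^\infty(\mathrm{K}^c)\},$$ $$\|\nabla\{f\}\|_{\mathcal{M}^2}=\|[\mathrm{I}\otimes\mathrm{D}]\{f\}\|_{\mathcal{M}}+\|[\mathrm{D}\otimes\mathrm{I}]\{f\}\|_{\mathcal{M}},$$ $$\|f\|_\theta=\theta\,\|[\mathrm{D}\otimes\mathrm{D}]\{f\}\|_{\mathcal{M}}+(1-\theta)\,\|\nabla\{f\}\|_{\mathcal{M}^2}.$$ The convex cone of positive functions is $\mathcal{M}^+_{\mathrm{D}\otimes\mathrm{D},0}(\mathrm{K})=\{f\in\mathcal{M}_{\mathrm{D}\otimes\mathrm{D},0}(\mathrm{K}):\forall\phi\in\mathcal{C}_c^\infty(\mathbb{R}^2),\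 \phi\ge0\Rightarrow\langle f,\phi\rangle\ge0\}$. Data: $\mathbf{y}\in\mathbb{R}^M$; $E:\mathbb{R}^M\times\mathbb{R}^M\to\mathbb{R}^+\cup\{\infty\}$ is proper, coercive, continuous, and strictly convex in its second argument; $\langle\cdot,\boldsymbol{\nu}\rangle:\mathcal{M}^+_{\mathrm{D}\otimes\mathrm{D},0}(\mathrm{K})\to\mathbb{R}^M$ is linear and weak$^\star$ continuous, where the weak$^\star$ topology is the coarsest one making all maps $f\mapsto\int\phi\,\mathrm{d}([\mathrm{D}\otimes\mathrm{D}]\{f\})$, $\phi\in\mathcal{C}_0(\mathbb{R}^2)$, continuous. Discretization: $\mathcal{X}_n=2^{-n}\{0,\dots,2^n\}\times2^{-n}\{0,\dots,2^n\}$ (a dyadic grid with $(2^n+1)^2$ knots) and $\mathcal{M}^+_{\mathrm{D}\otimes\mathrm{D},0}(\mathcal{X}_n)=\{f\in\mathcal{M}^+_{\mathrm{D}\otimes\mathrm{D},0}(\mathrm{K}):[\mathrm{D}\otimes\mathrm{D}]\{f\}\in\mathcal{M}(\mathcal{X}_n)\}$, where $\mathcal{M}(\mathcal{X}_n)$ is the set of measures supported on $\mathcal{X}_n$. *)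

theory Defs
  imports "HOL-Analysis.Analysis"
begin

type_synonym plane = "real \<times> real"

definition partial1 :: "(plane \<Rightarrow> real) \<Rightarrow> plane \<Rightarrow> real" where
  "partial1 \<phi> = (\<lambda>(x, y). deriv (\<lambda>t. \<phi> (t, y)) x)"

definition partial2 :: "(plane \<Rightarrow> real) \<Rightarrow> plane \<Rightarrow> real" where
  "partial2 \<phi> = (\<lambda>(x, y). deriv (\<lambda>t. \<phi> (x, t)) y)"

text \<open>
  Continuity of \<open>\<phi>\<close> itself is not listed in the successor case: it follows from the continuity of
  both partial derivatives.
\<close>

primrec C_diff :: "nat \<Rightarrow> (plane \<Rightarrow> real) \<Rightarrow> bool" where
  "C_diff 0 \<phi> \<longleftrightarrow> continuous_on UNIV \<phi>"
| "C_diff (Suc k) \<phi> \<longleftrightarrow>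
     (\<forall>x y. (\<lambda>t. \<phi> (t, y)) differentiable (at x) \<and> (\<lambda>t. \<phi> (x, t)) differentiable (at y)) \<and>
     C_diff k (partial1 \<phi>) \<and> C_diff k (partial2 \<phi>)"

definition smooth :: "(plane \<Rightarrow> real) \<Rightarrow> bool" where
  "smooth \<phi> \<longleftrightarrow> (\<forall>k. C_diff k \<phi>)"

definition tsupport :: "(plane \<Rightarrow> real) \<Rightarrow> plane set" where
  "tsupport \<phi> = closure {p. \<phi> p \<noteq> 0}"

definition test_functions :: "plane set \<Rightarrow> (plane \<Rightarrow> real) set" where
  "test_functions \<Omega> = {\<phi>. smooth \<phi> \<and> compact (tsupport \<phi>) \<and> tsupport \<phi> \<subseteq> \<Omega>}"

text \<open>
  A distribution is a linear functional on the test functions on the plane satisfying, on every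
  compact set, a seminorm estimate. It is set to \<open>0\<close> off the test functions, so that equality of
  distributions is equality of HOL functions.
\<close>

type_synonym functional = "(plane \<Rightarrow> real) \<Rightarrow> real"

definition distributions :: "functional set" where
  "distributions = {u.
     (\<forall>\<phi>. \<phi> \<notin> test_functions UNIV \<longrightarrow> u \<phi> = 0) \<and>
     (\<forall>\<phi>\<in>test_functions UNIV. \<forall>\<psi>\<in>test_functions UNIV. \<forall>a b.
        u (\<lambda>p. a * \<phi> p + b * \<psi> p) = a * u \<phi> + b * u \<psi>) \<and>
     (\<forall>C. compact C \<longrightarrow> (\<exists>c N. \<forall>\<phi>\<in>test_functions C.
        \<bar>u \<phi>\<bar> \<le> c * (\<Sum>(i, j)\<in>{(i, j). i + j \<le> N}.
                      SUP p. \<bar>(partial1 ^^ i) ((partial2 ^^ j) \<phi>) p\<bar>)))}"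

definition D1 :: "functional \<Rightarrow> functional" where
  "D1 u = (\<lambda>\<phi>. if \<phi> \<in> test_functions UNIV then - u (partial1 \<phi>) else 0)"

definition D2 :: "functional \<Rightarrow> functional" where
  "D2 u = (\<lambda>\<phi>. if \<phi> \<in> test_functions UNIV then - u (partial2 \<phi>) else 0)"

definition D12 :: "functional \<Rightarrow> functional" where
  "D12 u = D1 (D2 u)"

text \<open>
  Finite signed Borel measures are real-valued countably additive set functions on the Borel sets,
  set to \<open>0\<close> off the Borel sets. Boundedness is automatic.
\<close>

type_synonym set_function = "plane set \<Rightarrow> real"

definition signed_measures :: "set_function set" where
  "signed_measures = {m.
     (\<forall>A. A \<notin> sets borel \<longrightarrow> m A = 0) \<and> m {} = 0 \<and>
     (\<forall>A :: nat \<Rightarrow> plane set. range A \<subseteq> sets borel \<longrightarrow> disjoint_family A \<longrightarrow>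
        (\<lambda>i. m (A i)) sums m (\<Union>i. A i))}"

text \<open>Only meant for closed \<open>X\<close>: the support of \<open>m\<close> lies in \<open>X\<close>.\<close>

definition signed_measures_on :: "plane set \<Rightarrow> set_function set" where
  "signed_measures_on X = {m \<in> signed_measures. \<forall>A\<in>sets borel. A \<inter> X = {} \<longrightarrow> m A = 0}"

definition total_variation :: "set_function \<Rightarrow> ennreal" where
  "total_variation m =
     (SUP P\<in>{P. finite P \<and> P \<subseteq> sets borel \<and> partition_on UNIV P}. \<Sum>A\<in>P. ennreal \<bar>m A\<bar>)"

text \<open>
  The positive part of the Jordan decomposition; the negative part is the positive part of
  \<open>- m\<close>. Negative values of \<open>m B\<close> are cut off at \<open>0 = m {}\<close> by \<open>ennreal\<close>, which does not change
  the supremum.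
\<close>

definition jordan_pos :: "set_function \<Rightarrow> plane measure" where
  "jordan_pos m =
     measure_of UNIV (sets borel) (\<lambda>A. SUP B\<in>{B \<in> sets borel. B \<subseteq> A}. ennreal (m B))"

definition signed_integral :: "set_function \<Rightarrow> (plane \<Rightarrow> real) \<Rightarrow> real" where
  "signed_integral m \<phi> =
     integral\<^sup>L (jordan_pos m) \<phi> - integral\<^sup>L (jordan_pos (\<lambda>A. - m A)) \<phi>"

definition distr_of_measure :: "set_function \<Rightarrow> functional" where
  "distr_of_measure m = (\<lambda>\<phi>. if \<phi> \<in> test_functions UNIV then signed_integral m \<phi> else 0)"

text \<open>The inverse of \<^const>\<open>distr_of_measure\<close>, which is injective on \<^const>\<open>signed_measures\<close>.\<close>

definition measure_of_distr :: "functional \<Rightarrow> set_function" where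
  "measure_of_distr u = the_inv_into signed_measures distr_of_measure u"

definition norm_M :: "functional \<Rightarrow> ennreal" where
  "norm_M u = (if u \<in> distr_of_measure ` signed_measures
               then total_variation (measure_of_distr u) else \<infinity>)"

definition unit_square :: "plane set" where
  "unit_square = {0..1} \<times> {0..1}"

definition M_DD0 :: "functional set" where
  "M_DD0 = {f \<in> distributions.
     D12 f \<in> distr_of_measure ` signed_measures_on unit_square \<and>
     (\<forall>\<phi>\<in>test_functions (- unit_square). f \<phi> = 0)}"

definition M_DD0_pos :: "functional set" where
  "M_DD0_pos = {f \<in> M_DD0. \<forall>\<phi>\<in>test_functions UNIV. (\<forall>p. 0 \<le> \<phi> p) \<longrightarrow> 0 \<le> f \<phi>}"

definition dyadic_grid :: "nat \<Rightarrow> plane set" where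
  "dyadic_grid n = (let G = (\<lambda>k. real k / 2 ^ n) ` {0..2 ^ n} in G \<times> G)"

definition M_DD0_pos_grid :: "nat \<Rightarrow> functional set" where
  "M_DD0_pos_grid n =
     {f \<in> M_DD0_pos. D12 f \<in> distr_of_measure ` signed_measures_on (dyadic_grid n)}"

definition norm_grad :: "functional \<Rightarrow> ennreal" where
  "norm_grad f = norm_M (D2 f) + norm_M (D1 f)"

definition norm_theta :: "real \<Rightarrow> functional \<Rightarrow> ennreal" where
  "norm_theta \<theta> f = ennreal \<theta> * norm_M (D12 f) + ennreal (1 - \<theta>) * norm_grad f"

definition C0 :: "(plane \<Rightarrow> real) set" where
  "C0 = {\<phi>. continuous_on UNIV \<phi> \<and> (\<phi> \<longlongrightarrow> 0) at_infinity}"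

definition weak_star :: "functional topology" where
  "weak_star = topology_generated_by
     {{f \<in> M_DD0. signed_integral (measure_of_distr (D12 f)) \<phi> \<in> U} | \<phi> U. \<phi> \<in> C0 \<and> open U}"

text \<open>Linearity of a map defined only on the convex cone.\<close>

definition linear_on_cone :: "(functional \<Rightarrow> real ^ 'm) \<Rightarrow> bool" where
  "linear_on_cone \<nu> \<longleftrightarrow> (\<forall>f\<in>M_DD0_pos. \<forall>g\<in>M_DD0_pos. \<forall>a\<ge>0. \<forall>b\<ge>0.
     \<nu> (\<lambda>\<phi>. a * f \<phi> + b * g \<phi>) = a *\<^sub>R \<nu> f + b *\<^sub>R \<nu> g)"

definition proper :: "('a \<Rightarrow> ennreal) \<Rightarrow> bool" where
  "proper g \<longleftrightarrow> (\<exists>z. g z < \<infinity>)"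

definition coercive :: "('a::real_normed_vector \<Rightarrow> ennreal) \<Rightarrow> bool" where
  "coercive g \<longleftrightarrow> (g \<longlongrightarrow> \<infinity>) at_infinity"

text \<open>
  If \<open>g a\<close> or \<open>g b\<close> is infinite, the non-strict convexity inequality holds trivially, so the
  strict one is required exactly on the effective domain.
\<close>

definition strictly_convex :: "('a::real_vector \<Rightarrow> ennreal) \<Rightarrow> bool" where
  "strictly_convex g \<longleftrightarrow> (\<forall>a b t. a \<noteq> b \<and> g a < \<infinity> \<and> g b < \<infinity> \<and> 0 < t \<and> t < 1 \<longrightarrow>
     g (t *\<^sub>R a + (1 - t) *\<^sub>R b) < ennreal t * g a + ennreal (1 - t) * g b)"

text \<open>
  Convention for extended-valued objectives (Rockafellar and Wets, Variational Analysis, 1.E):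
  a problem whose objective is identically \<open>\<infinity>\<close> on the feasible set has no minimiser.
\<close>

definition argmin_set :: "'a set \<Rightarrow> ('a \<Rightarrow> ennreal) \<Rightarrow> 'a set" where
  "argmin_set S g = {x \<in> S. g x < \<infinity> \<and> (\<forall>z\<in>S. g x \<le> g z)}"

definition objective ::
  "(real ^ 'm \<Rightarrow> real ^ 'm \<Rightarrow> ennreal) \<Rightarrow> real ^ 'm \<Rightarrow> (functional \<Rightarrow> real ^ 'm) \<Rightarrow>
   real \<Rightarrow> real \<Rightarrow> functional \<Rightarrow> ennreal" where
  "objective E y \<nu> lam \<theta> f = E y (\<nu> f) + ennreal lam * norm_theta \<theta> f"

end

theory Submission
  imports Defs
begin

text \<open>
  A grid problem has fewer competitors than the continuous one, so its minimum is at least the minimum of the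
  continuous problem. For the converse, the solution \<open>f\<close> of the continuous problem is approximated by elements
  \<open>g n\<close> of the grid cones with \<open>\<nu> (g n)\<close> tending to \<open>\<nu> f\<close> and with norms that exceed the norm of \<open>f\<close> by a null
  sequence at most (lemma \<open>step_approx_consistent\<close>). The objective at \<open>g n\<close> then bounds the grid minimum from
  above and tends to the minimum of the continuous problem, which is the first claim. The second one follows from
  the first: since the objective is convex and its data term is coercive and strictly convex, the measurements
  of a minimising sequence converge (lemma \<open>strictly_convex_minimising_sequence\<close>).

  The approximation is as follows. Because \<open>f\<close> vanishes outside the unit square, its value at a point is the
  mass that its mixed derivative \<open>m\<close> gives to the quadrant beyond the point, and \<open>m\<close> has no mass on horizontal
  and vertical strips across the plane. Moving the mass of each cell of the grid to the upper right corner of the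
  cell turns \<open>m\<close> into a measure on the grid and \<open>f\<close> into a step function whose values are values of \<open>f\<close> at grid
  points. So positivity and support are kept, the total variation of the mixed derivative does not increase, and
  the moved measures converge to \<open>m\<close> against continuous functions, which is weak-star convergence.

  The gradient needs an estimate, since moving mass can increase the norm of a first derivative. The derivative in
  \<open>x\<close> of the step function has the norm \<open>1 / N\<close> times the sum, over the cells, of the absolute masses of the part
  of the column above the lower edge of the cell. The derivative in \<open>x\<close> of \<open>f\<close> gives to a cell the integral of the
  same masses over a variable lower edge. The difference is at most the variation of \<open>m\<close> on the cell, divided by
  \<open>N\<close>, and the sum of these errors is a constant divided by \<open>N\<close> (lemma \<open>strip_sum_le_total_variation\<close>).

  That a derivative is a measure is known only through integrals of smooth functions. The link to the masses of
  boxes is made by products of smooth approximations of indicator functions, and by the Jordan decomposition of signed measures, through which limits of integrals are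
  taken. A primitive of a test function is not compactly supported in general; it is made so by subtracting a
  translate that lies to the right of the unit square or above it, where \<open>f\<close> vanishes.
\<close>

section \<open>Finite signed measures\<close>

definition finite_borel :: "'a::topological_space measure \<Rightarrow> bool" where
  "finite_borel M \<longleftrightarrow> finite_measure M \<and> sets M = sets borel"

definition bounded_borel :: "('a::topological_space \<Rightarrow> real) \<Rightarrow> bool" where
  "bounded_borel \<phi> \<longleftrightarrow> \<phi> \<in> borel_measurable borel \<and> (\<exists>B. \<forall>p. \<bar>\<phi> p\<bar> \<le> B)"

lemma finite_borel_integrable:
  assumes "finite_borel M" "bounded_borel \<phi>"
  shows "integrable M \<phi>"
proof -
  obtain B where B: "\<And>p. \<bar>\<phi> p\<bar> \<le> B" and "\<phi> \<in> borel_measurable borel"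
    using assms(2) unfolding bounded_borel_def by blast
  then have "\<phi> \<in> borel_measurable M"
    using assms(1) by (simp add: finite_borel_def cong: measurable_cong_sets)
  then show ?thesis
    using assms(1) B
    by (intro finite_measure.integrable_const_bound[where B=B]) (auto simp: finite_borel_def)
qed

lemma finite_borel_dominated:
  fixes u :: "nat \<Rightarrow> 'a::topological_space \<Rightarrow> real"
  assumes M: "finite_borel M" and u: "\<And>n. u n \<in> borel_measurable borel"
    and v: "v \<in> borel_measurable borel"
    and lim: "AE p in M. (\<lambda>n. u n p) \<longlonglongrightarrow> v p" and bd: "\<And>n p. \<bar>u n p\<bar> \<le> B"
  shows "(\<lambda>n. integral\<^sup>L M (u n)) \<longlonglongrightarrow> integral\<^sup>L M v"
proof (rule integral_dominated_convergence[where w="\<lambda>_. B"])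
  interpret finite_measure M using M by (simp add: finite_borel_def)
  show "integrable M (\<lambda>_. B)" by simp
qed (use assms in \<open>auto simp: finite_borel_def cong: measurable_cong_sets\<close>)

lemma bounded_borelI:
  "\<phi> \<in> borel_measurable borel \<Longrightarrow> (\<And>p. \<bar>\<phi> p\<bar> \<le> B) \<Longrightarrow> bounded_borel \<phi>"
  unfolding bounded_borel_def by blast

lemma bounded_borel_indicator: "A \<in> sets borel \<Longrightarrow> bounded_borel (indicator A)"
  by (rule bounded_borelI[where B=1]) (auto simp: indicator_def)

lemma bounded_borel_add:
  assumes "bounded_borel f" "bounded_borel g" shows "bounded_borel (\<lambda>x. f x + g x)"
proof -
  obtain A B where "\<And>p. \<bar>f p\<bar> \<le> A" "\<And>p. \<bar>g p\<bar> \<le> B"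
    using assms unfolding bounded_borel_def by blast
  then show ?thesis
    using assms by (intro bounded_borelI[where B="A + B"])
      (auto simp: bounded_borel_def intro: order_trans[OF abs_triangle_ineq] add_mono)
qed

lemma bounded_borel_cmult:
  assumes "bounded_borel f" shows "bounded_borel (\<lambda>x. c * f x)"
proof -
  obtain A where "\<And>p. \<bar>f p\<bar> \<le> A"
    using assms unfolding bounded_borel_def by blast
  then show ?thesis
    using assms by (intro bounded_borelI[where B="\<bar>c\<bar> * A"])
      (auto simp: bounded_borel_def abs_mult intro: mult_left_mono)
qed

text \<open>
  Equality of two signed combinations of measures on sets passes to integrals. It is this form,
  rather than a statement about a single signed measure, that lets integrals be computed from any
  decomposition of a signed measure, not only from the Jordan decomposition.
\<close>

lemma integral_eq_of_measure_eq:
  fixes P Q :: "'a::topological_space measure" and M :: "'i \<Rightarrow> 'a measure"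
  assumes fin: "finite_borel P" "finite_borel Q" "\<And>k. k \<in> I \<Longrightarrow> finite_borel (M k)"
    and eq: "\<And>A. A \<in> sets borel \<Longrightarrow> measure P A - measure Q A = (\<Sum>k\<in>I. c k * measure (M k) A)"
    and \<phi>: "bounded_borel \<phi>"
  shows "integral\<^sup>L P \<phi> - integral\<^sup>L Q \<phi> = (\<Sum>k\<in>I. c k * integral\<^sup>L (M k) \<phi>)"
proof -
  define T where "T u \<longleftrightarrow> integral\<^sup>L P u - integral\<^sup>L Q u = (\<Sum>k\<in>I. c k * integral\<^sup>L (M k) u)" for u
  have pos: "T u" if u: "bounded_borel u" "\<And>x. 0 \<le> u x" for u
  proof -
    have "u \<in> borel_measurable borel" using u by (simp add: bounded_borel_def)
    then have "bounded_borel u \<longrightarrow> T u" using u(2)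
    proof (induct u rule: borel_measurable_induct_real)
      case (set A)
      have "integral\<^sup>L N (indicator A) = measure N A" if "finite_borel N" for N :: "'a measure"
        using set that by (auto simp: finite_borel_def finite_measure.emeasure_finite)
      then show ?case using eq[OF set] fin by (simp add: T_def)
    next
      case (mult u a)
      show ?case
      proof
        assume b: "bounded_borel (\<lambda>x. a * u x)"
        show "T (\<lambda>x. a * u x)"
        proof (cases "a = 0")
          case False
          then have "bounded_borel u" using bounded_borel_cmult[OF b, of "1/a"] by simp
          then have "T u" using mult by simp
          then have "a * (integral\<^sup>L P u - integral\<^sup>L Q u) = a * (\<Sum>k\<in>I. c k * integral\<^sup>L (M k) u)"
            by (simp add: T_def)
          then show ?thesis
            unfolding T_def by (simp add: algebra_simps sum_distrib_left)
        qed (simp add: T_def)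
      qed
    next
      case (add u v)
      show ?case
      proof
        assume b: "bounded_borel (\<lambda>x. v x + u x)"
        then obtain B where B: "\<And>p. \<bar>v p + u p\<bar> \<le> B" unfolding bounded_borel_def by blast
        have "\<bar>u p\<bar> \<le> B" "\<bar>v p\<bar> \<le> B" for p using B[of p] add(2,5)[of p] by auto
        then have uv: "bounded_borel u" "bounded_borel v"
          using add(1,4) by (auto intro: bounded_borelI)
        then have "T u" "T v" using add by auto
        moreover have "integral\<^sup>L N (\<lambda>x. v x + u x) = integral\<^sup>L N v + integral\<^sup>L N u"
          if "finite_borel N" for N
          using that uv by (intro Bochner_Integration.integral_add finite_borel_integrable)
        ultimately show "T (\<lambda>x. v x + u x)"
          unfolding T_def using fin by (simp add: sum.distrib distrib_left)
      qed
    next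
      case (seq U)
      show ?case
      proof
        assume "bounded_borel u"
        then obtain B where B: "\<And>p. \<bar>u p\<bar> \<le> B" and um: "u \<in> borel_measurable borel"
          unfolding bounded_borel_def by blast
        have lim: "(\<lambda>i. U i x) \<longlonglongrightarrow> u x" for x using seq(5) by simp
        have "U i x \<le> u x" for i x
          using \<open>incseq U\<close> by (intro incseq_le[OF _ lim]) (auto simp: incseq_def le_fun_def)
        then have Ub: "\<bar>U i x\<bar> \<le> B" for i x
          using B[of x] seq(2)[of i x] by (smt (verit))
        then have "bounded_borel (U i)" for i using seq(1) by (intro bounded_borelI[where B=B]) auto
        then have TU: "T (U i)" for i using seq(3) by simp
        have conv: "(\<lambda>i. integral\<^sup>L N (U i)) \<longlonglongrightarrow> integral\<^sup>L N u" if "finite_borel N" for N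
          using that seq(1) um lim Ub by (intro finite_borel_dominated[where B=B]) auto
        have "(\<lambda>i. integral\<^sup>L P (U i) - integral\<^sup>L Q (U i)) \<longlonglongrightarrow> integral\<^sup>L P u - integral\<^sup>L Q u"
          using fin by (intro tendsto_diff conv)
        moreover have "(\<lambda>i. \<Sum>k\<in>I. c k * integral\<^sup>L (M k) (U i)) \<longlonglongrightarrow> (\<Sum>k\<in>I. c k * integral\<^sup>L (M k) u)"
          using fin by (intro tendsto_intros conv)
        ultimately show "T u"
          using TU unfolding T_def by (auto intro: LIMSEQ_unique)
      qed
    qed
    then show ?thesis using u by simp
  qed
  obtain B where B: "\<And>p. \<bar>\<phi> p\<bar> \<le> B" using \<phi> unfolding bounded_borel_def by blast
  have one: "bounded_borel (\<lambda>x. B)" by (rule bounded_borelI[where B="\<bar>B\<bar>"]) auto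
  \<comment> \<open>A bounded function is the difference of the nonnegative functions \<open>\<phi> + B\<close> and \<open>B\<close>.\<close>
  have "T (\<lambda>x. \<phi> x + B)"
  proof (intro pos bounded_borel_add \<phi> one)
    show "0 \<le> \<phi> x + B" for x using B[of x] by linarith
  qed
  moreover have "T (\<lambda>x. B)" using B[of undefined] by (intro pos one) auto
  moreover have "integral\<^sup>L N (\<lambda>x. \<phi> x + B) = integral\<^sup>L N \<phi> + integral\<^sup>L N (\<lambda>x. B)"
    if "finite_borel N" for N
    using that \<phi> one by (intro Bochner_Integration.integral_add finite_borel_integrable)
  ultimately show ?thesis
    unfolding T_def using fin by (simp add: sum.distrib distrib_left del: lebesgue_integral_const)
qed

lemma signed_measures_uminus: "m \<in> signed_measures \<Longrightarrow> (\<lambda>A. - m A) \<in> signed_measures"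
  by (auto simp: signed_measures_def intro: sums_minus)

lemma signed_measure_Un:
  assumes m: "m \<in> signed_measures" and A: "A \<in> sets borel" "B \<in> sets borel" "A \<inter> B = {}"
  shows "m (A \<union> B) = m A + m B"
proof -
  have "range (binaryset A B) \<subseteq> sets borel" using A m by (simp add: range_binaryset_eq)
  moreover have "disjoint_family (binaryset A B)"
    using A(3) by (auto simp: disjoint_family_on_def binaryset_def)
  ultimately have "(\<lambda>i. m (binaryset A B i)) sums m (\<Union>i. binaryset A B i)"
    using m unfolding signed_measures_def by blast
  moreover have "(\<lambda>i. m (binaryset A B i)) sums (m A + m B)"
    using m by (intro binaryset_sums) (auto simp: signed_measures_def)
  ultimately show ?thesis by (simp add: UN_binaryset_eq sums_iff)
qed

lemma signed_measure_Diff: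
  assumes "m \<in> signed_measures" "A \<in> sets borel" "B \<in> sets borel" "B \<subseteq> A"
  shows "m (A - B) = m A - m B"
  using signed_measure_Un[OF assms(1), of B "A - B"] assms(2-4) by (auto simp: Un_absorb1)

definition upper_variation :: "set_function \<Rightarrow> plane set \<Rightarrow> ennreal" where
  "upper_variation m A = (SUP B\<in>{B \<in> sets borel. B \<subseteq> A}. ennreal (m B))"

lemma upper_variation_upper: "B \<in> sets borel \<Longrightarrow> B \<subseteq> A \<Longrightarrow> ennreal (m B) \<le> upper_variation m A"
  unfolding upper_variation_def by (rule SUP_upper) simp

lemma upper_variation_superadditive:
  assumes m: "m \<in> signed_measures" and "A \<inter> A' = {}"
  shows "upper_variation m A + upper_variation m A' \<le> upper_variation m (A \<union> A')"
proof -
  have *: "ennreal (m B) + ennreal (m C) \<le> upper_variation m (A \<union> A')"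
    if "B \<in> sets borel" "B \<subseteq> A" "C \<in> sets borel" "C \<subseteq> A'" for B C
  proof (cases "m B \<le> 0 \<or> m C \<le> 0")
    case True
    moreover have "B \<subseteq> A \<union> A'" "C \<subseteq> A \<union> A'" using that by auto
    ultimately show ?thesis
      using upper_variation_upper[of B "A \<union> A'" m] upper_variation_upper[of C "A \<union> A'" m] that
      by (auto simp: ennreal_neg)
  next
    case False
    have "ennreal (m (B \<union> C)) \<le> upper_variation m (A \<union> A')"
      using that by (intro upper_variation_upper) auto
    moreover have "m (B \<union> C) = m B + m C"
      using that \<open>A \<inter> A' = {}\<close> by (intro signed_measure_Un m) auto
    ultimately show ?thesis using False by simp
  qed
  have ne: "{B \<in> sets borel. B \<subseteq> S} \<noteq> {}" for S :: "plane set" by blast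
  show ?thesis
    unfolding upper_variation_def[of m A] upper_variation_def[of m A']
    by (subst ennreal_SUP_add_left[OF ne, symmetric], rule SUP_least,
        subst ennreal_SUP_add_right[OF ne], rule SUP_least) (use * in auto)
qed

lemma upper_variation_UN_le:
  fixes A :: "nat \<Rightarrow> plane set"
  assumes m: "m \<in> signed_measures" and A: "range A \<subseteq> sets borel" "disjoint_family A"
  shows "upper_variation m (\<Union>i. A i) \<le> (\<Sum>i. upper_variation m (A i))"
  unfolding upper_variation_def[of m "\<Union>i. A i"]
proof (rule SUP_least)
  fix B :: "plane set" assume "B \<in> {B \<in> sets borel. B \<subseteq> (\<Union>i. A i)}"
  then have B: "B \<in> sets borel" "B = (\<Union>i. B \<inter> A i)" by auto
  have "(\<lambda>i. m (B \<inter> A i)) sums m (\<Union>i. B \<inter> A i)"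
  proof -
    have "range (\<lambda>i. B \<inter> A i) \<subseteq> sets borel" using A B by auto
    moreover have "disjoint_family (\<lambda>i. B \<inter> A i)"
      using A(2) by (auto simp: disjoint_family_on_def)
    ultimately show ?thesis using m unfolding signed_measures_def by blast
  qed
  then have s: "(\<lambda>i. m (B \<inter> A i)) sums m B" using B(2) by simp
  have "(\<lambda>n. ennreal (\<Sum>i<n. m (B \<inter> A i))) \<longlonglongrightarrow> ennreal (m B)"
    using s unfolding sums_def by (rule tendsto_ennrealI)
  moreover have "ennreal (\<Sum>i<n. m (B \<inter> A i)) \<le> (\<Sum>i. upper_variation m (A i))" for n
  proof -
    have "ennreal (\<Sum>i<n. m (B \<inter> A i)) \<le> ennreal (\<Sum>i<n. max 0 (m (B \<inter> A i)))"
      by (intro ennreal_leI sum_mono) auto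
    also have "\<dots> = (\<Sum>i<n. ennreal (m (B \<inter> A i)))"
    proof -
      have "ennreal (max 0 x) = ennreal x" for x :: real by (simp add: max_def ennreal_neg)
      then show ?thesis by (simp flip: sum_ennreal)
    qed
    also have "\<dots> \<le> (\<Sum>i<n. upper_variation m (A i))"
      using A B by (intro sum_mono upper_variation_upper) auto
    also have "\<dots> \<le> (\<Sum>i. upper_variation m (A i))" by (rule sum_le_suminf) auto
    finally show ?thesis .
  qed
  ultimately show "ennreal (m B) \<le> (\<Sum>i. upper_variation m (A i))"
    by (intro LIMSEQ_le_const2) auto
qed

lemma upper_variation_mono: "A \<subseteq> B \<Longrightarrow> upper_variation m A \<le> upper_variation m B"
  unfolding upper_variation_def by (rule SUP_subset_mono) auto

lemma upper_variation_empty: "m \<in> signed_measures \<Longrightarrow> upper_variation m {} = 0"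
  unfolding upper_variation_def by (auto simp: signed_measures_def intro!: antisym SUP_least)

text \<open>
  Countable additivity is what makes \<^const>\<open>jordan_pos\<close> useful at all: \<^const>\<open>measure_of\<close> turns a set
  function that is not countably additive into the zero measure.
\<close>

lemma upper_variation_countably_additive:
  assumes m: "m \<in> signed_measures"
  shows "countably_additive (sets borel) (upper_variation m)"
  unfolding countably_additive_def
proof (intro allI impI)
  fix A :: "nat \<Rightarrow> plane set"
  assume A: "range A \<subseteq> sets borel" "disjoint_family A" "\<Union> (range A) \<in> sets borel"
  have fin: "(\<Sum>i<n. upper_variation m (A i)) \<le> upper_variation m (\<Union>i<n. A i)" for n
  proof (induction n)
    case (Suc n)
    have "A i \<inter> A n = {}" if "i < n" for i
      using A(2) that by (intro disjoint_family_onD[OF A(2)]) auto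
    then have "(\<Union>i<n. A i) \<inter> A n = {}" by blast
    have "(\<Sum>i<Suc n. upper_variation m (A i))
        \<le> upper_variation m (\<Union>i<n. A i) + upper_variation m (A n)"
      using Suc by (simp add: add_right_mono)
    also have "\<dots> \<le> upper_variation m ((\<Union>i<n. A i) \<union> A n)"
      by (rule upper_variation_superadditive) fact+
    also have "(\<Union>i<n. A i) \<union> A n = (\<Union>i<Suc n. A i)" by (auto simp: less_Suc_eq)
    finally show ?case .
  qed (simp add: upper_variation_empty[OF m])
  have "(\<Sum>i. upper_variation m (A i)) \<le> upper_variation m (\<Union>i. A i)"
    by (rule suminf_le_const[OF summableI], rule order_trans[OF fin], rule upper_variation_mono) blast
  then show "(\<Sum>i. upper_variation m (A i)) = upper_variation m (\<Union>i. A i)"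
    using upper_variation_UN_le[OF m A(1,2)] by (rule antisym)
qed

lemma upper_variation_additive:
  assumes m: "m \<in> signed_measures"
    and "A \<in> sets borel" "B \<in> sets borel" "A \<inter> B = {}"
  shows "upper_variation m (A \<union> B) = upper_variation m A + upper_variation m B"
proof -
  have "additive (sets borel) (upper_variation m)"
    using upper_variation_countably_additive[OF m] upper_variation_empty[OF m]
    by (intro sets.countably_additive_additive) (auto simp: positive_def)
  then show ?thesis using assms unfolding additive_def by blast
qed

text \<open>
  If the upper variation were infinite, one could split off, again and again, a set on which \<open>m\<close> is at
  least \<open>1\<close> in absolute value, while the rest still has infinite upper variation. The values of \<open>m\<close> on
  the split-off sets, which are disjoint, would be the terms of a convergent series.
\<close>

lemma upper_variation_finite:
  assumes m: "m \<in> signed_measures"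
  shows "upper_variation m UNIV < \<infinity>"
proof (rule ccontr)
  assume inf: "\<not> upper_variation m UNIV < \<infinity>"
  define bad where "bad A \<longleftrightarrow> A \<in> sets borel \<and> upper_variation m A = \<infinity>" for A
  have step: "\<exists>A'. bad A' \<and> A' \<subseteq> A \<and> 1 \<le> \<bar>m (A - A')\<bar>" if "bad A" for A
  proof -
    have "ennreal (\<bar>m A\<bar> + 1) < upper_variation m A"
      using that by (simp add: bad_def less_top[symmetric] del: ennreal_plus)
    then obtain B where B: "B \<in> sets borel" "B \<subseteq> A" "ennreal (\<bar>m A\<bar> + 1) < ennreal (m B)"
      unfolding upper_variation_def less_SUP_iff by auto
    then have mB: "\<bar>m A\<bar> + 1 < m B" by (simp add: ennreal_less_iff del: ennreal_plus)
    have A: "A \<in> sets borel" using that by (simp add: bad_def)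
    have mD: "m (A - B) = m A - m B" using B A by (intro signed_measure_Diff[OF m])
    have "upper_variation m (B \<union> (A - B)) = upper_variation m B + upper_variation m (A - B)"
      using A B by (intro upper_variation_additive[OF m]) auto
    then have "bad B \<or> bad (A - B)"
      using A B that by (auto simp: bad_def Un_absorb1 sup.absorb2)
    moreover have "A - (A - B) = B" using B by auto
    ultimately show ?thesis
    proof (elim disjE)
      assume "bad B"
      then show ?thesis using B mB mD by (intro exI[of _ B]) auto
    next
      assume "bad (A - B)"
      then show ?thesis using mB \<open>A - (A - B) = B\<close> by (intro exI[of _ "A - B"]) auto
    qed
  qed
  have "bad UNIV" using inf by (simp add: bad_def less_top[symmetric])
  then obtain A where A: "\<And>n. bad (A n)" "\<And>n. A (Suc n) \<subseteq> A n"
      "\<And>n. 1 \<le> \<bar>m (A n - A (Suc n))\<bar>"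
    using dependent_nat_choice[of "\<lambda>_. bad" "\<lambda>_ S S'. S' \<subseteq> S \<and> 1 \<le> \<bar>m (S - S')\<bar>"] step by blast
  have "disjoint_family (\<lambda>n. (- A (Suc n)) - - A n)"
    by (rule disjoint_family_Suc) (use A(2) in blast)
  also have "(\<lambda>n. (- A (Suc n)) - - A n) = (\<lambda>n. A n - A (Suc n))" by auto
  finally have dj: "disjoint_family (\<lambda>n. A n - A (Suc n))" .
  have "range (\<lambda>n. A n - A (Suc n)) \<subseteq> sets borel" using A(1) by (auto simp: bad_def)
  with dj have "summable (\<lambda>n. m (A n - A (Suc n)))"
    using m unfolding signed_measures_def summable_def by blast
  then have "(\<lambda>n. \<bar>m (A n - A (Suc n))\<bar>) \<longlonglongrightarrow> 0"
    using summable_LIMSEQ_zero tendsto_rabs_zero by blast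
  then have "1 \<le> (0::real)" by (rule LIMSEQ_le_const) (use A(3) in auto)
  then show False by simp
qed

lemma jordan_pos_eq: "jordan_pos m = measure_of UNIV (sets borel) (upper_variation m)"
  unfolding jordan_pos_def upper_variation_def ..

lemma sets_jordan_pos [simp]: "sets (jordan_pos m) = sets borel"
  using sets.sigma_sets_eq[of borel] by (simp add: jordan_pos_eq)

lemma emeasure_jordan_pos:
  assumes "m \<in> signed_measures" "A \<in> sets borel"
  shows "emeasure (jordan_pos m) A = upper_variation m A"
  unfolding jordan_pos_eq
  using assms sets.sigma_algebra_axioms[of borel] upper_variation_countably_additive
  by (intro emeasure_measure_of_sigma) (auto simp: positive_def upper_variation_empty)

lemma finite_borel_jordan_pos:
  assumes "m \<in> signed_measures" shows "finite_borel (jordan_pos m)"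
proof -
  have "space (jordan_pos m) = UNIV" by (simp add: jordan_pos_eq)
  then show ?thesis
    using assms upper_variation_finite[OF assms]
    by (auto simp: finite_borel_def emeasure_jordan_pos intro!: finite_measureI)
qed

text \<open>
  Since \<open>B\<close> and \<open>A - B\<close> exchange the roles of large and small values, the upper variation of
  \<open>m\<close> on \<open>A\<close> exceeds the upper variation of \<open>- m\<close> by exactly \<open>m A\<close>.
\<close>

lemma jordan_decomposition:
  assumes m: "m \<in> signed_measures" and A: "A \<in> sets borel"
  shows "measure (jordan_pos m) A - measure (jordan_pos (\<lambda>A. - m A)) A = m A"
proof -
  have le: "measure (jordan_pos k) A \<le> measure (jordan_pos (\<lambda>A. - k A)) A + k A"
    if k: "k \<in> signed_measures" for k
  proof -
    interpret P: finite_measure "jordan_pos k" using finite_borel_jordan_pos[OF k] by (simp add: finite_borel_def)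
    interpret N: finite_measure "jordan_pos (\<lambda>A. - k A)"
      using finite_borel_jordan_pos[OF signed_measures_uminus[OF k]] by (simp add: finite_borel_def)
    let ?N = "measure (jordan_pos (\<lambda>A. - k A)) A"
    have *: "k B \<le> ?N + k A" if B: "B \<in> sets borel" "B \<subseteq> A" for B
    proof -
      have "ennreal (- k (A - B)) \<le> ennreal ?N"
        using upper_variation_upper[of "A - B" A "\<lambda>A. - k A"] A B
        by (simp add: emeasure_jordan_pos signed_measures_uminus[OF k] N.emeasure_eq_measure[symmetric])
      then have "- k (A - B) \<le> ?N" by (auto simp: ennreal_le_iff2 intro: order_trans[OF _ measure_nonneg])
      then show ?thesis using signed_measure_Diff[OF k A B] by simp
    qed
    have "0 \<le> ?N + k A" using *[of "{}"] k by (simp add: signed_measures_def)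
    have "ennreal (measure (jordan_pos k) A) = upper_variation k A"
      using A k by (simp add: emeasure_jordan_pos P.emeasure_eq_measure[symmetric])
    also have "\<dots> \<le> ennreal (?N + k A)"
      unfolding upper_variation_def using * by (intro SUP_least ennreal_leI) auto
    finally show ?thesis using \<open>0 \<le> ?N + k A\<close> by (simp add: ennreal_le_iff del: ennreal_plus)
  qed
  from le[OF m] le[OF signed_measures_uminus[OF m]] show ?thesis by simp
qed

lemma signed_measure_notin_sets: "m \<in> signed_measures \<Longrightarrow> A \<notin> sets borel \<Longrightarrow> m A = 0"
  by (simp add: signed_measures_def)

lemma weighted_sum_signed_measure:
  assumes "finite I" and "\<And>k. k \<in> I \<Longrightarrow> finite_borel (M k)"
  shows "(\<lambda>A. \<Sum>k\<in>I. c k * measure (M k) A) \<in> signed_measures"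
proof -
  have 1: "measure (M k) A = 0" if "k \<in> I" "A \<notin> sets borel" for k A
    using assms(2)[OF that(1)] that(2) by (simp add: finite_borel_def measure_notin_sets)
  have 2: "(\<lambda>i. measure (M k) (A i)) sums measure (M k) (\<Union>i. A i)"
    if "k \<in> I" "range A \<subseteq> sets borel" "disjoint_family A" for k and A :: "nat \<Rightarrow> plane set"
    using assms(2)[OF that(1)] that(2,3)
    by (intro finite_measure.finite_measure_UNION) (auto simp: finite_borel_def)
  show ?thesis
    unfolding signed_measures_def using 1 2 by (auto intro!: sums_sum sums_mult)
qed

lemma signed_integral_weighted_sum:
  assumes m: "m \<in> signed_measures" and "\<And>k. k \<in> I \<Longrightarrow> finite_borel (M k)"
    and "\<And>A. A \<in> sets borel \<Longrightarrow> m A = (\<Sum>k\<in>I. c k * measure (M k) A)"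
    and "bounded_borel \<phi>"
  shows "signed_integral m \<phi> = (\<Sum>k\<in>I. c k * integral\<^sup>L (M k) \<phi>)"
  unfolding signed_integral_def
  using assms finite_borel_jordan_pos[OF m] finite_borel_jordan_pos[OF signed_measures_uminus[OF m]]
  by (intro integral_eq_of_measure_eq) (auto simp: jordan_decomposition)

lemma signed_measure_empty: "m \<in> signed_measures \<Longrightarrow> m {} = 0"
  by (simp add: signed_measures_def)

lemma signed_measures_on_uminus:
  "m \<in> signed_measures_on X \<Longrightarrow> (\<lambda>A. - m A) \<in> signed_measures_on X"
  using signed_measures_uminus by (auto simp: signed_measures_on_def)

lemma AE_jordan_pos:
  assumes "m \<in> signed_measures_on X" "X \<in> sets borel"
  shows "AE p in jordan_pos m. p \<in> X"
proof -
  from assms have m: "m \<in> signed_measures" by (simp add: signed_measures_on_def)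
  have "m B = 0" if "B \<in> sets borel" "B \<subseteq> - X" for B
    using assms(1) that by (auto simp: signed_measures_on_def disjoint_eq_subset_Compl)
  then have "upper_variation m (- X) = 0"
    unfolding upper_variation_def by (intro antisym SUP_least) auto
  then have "emeasure (jordan_pos m) (- X) = 0"
    using assms m by (simp add: emeasure_jordan_pos)
  then show ?thesis using assms(2) by (intro AE_I[where N="- X"]) auto
qed

text \<open>
  Dominated convergence. Pointwise convergence on \<open>X\<close> is enough because both Jordan parts of a signed
  measure on \<open>X\<close> live on \<open>X\<close>.
\<close>

lemma signed_integral_tendsto:
  fixes u :: "nat \<Rightarrow> plane \<Rightarrow> real"
  assumes m: "m \<in> signed_measures_on X" and X: "X \<in> sets borel"
    and u: "\<And>n. u n \<in> borel_measurable borel" and v: "v \<in> borel_measurable borel"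
    and lim: "\<And>p. p \<in> X \<Longrightarrow> (\<lambda>n. u n p) \<longlonglongrightarrow> v p" and bd: "\<And>n p. \<bar>u n p\<bar> \<le> B"
  shows "(\<lambda>n. signed_integral m (u n)) \<longlonglongrightarrow> signed_integral m v"
proof -
  have "(\<lambda>n. integral\<^sup>L (jordan_pos k) (u n)) \<longlonglongrightarrow> integral\<^sup>L (jordan_pos k) v"
    if k: "k \<in> signed_measures_on X" for k
  proof (rule finite_borel_dominated[OF _ u v _ bd])
    show "finite_borel (jordan_pos k)"
      using k by (intro finite_borel_jordan_pos) (simp add: signed_measures_on_def)
    show "AE p in jordan_pos k. (\<lambda>n. u n p) \<longlonglongrightarrow> v p"
      using AE_jordan_pos[OF k X] by eventually_elim (rule lim)
  qed
  then show ?thesis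
    unfolding signed_integral_def using m signed_measures_on_uminus[OF m] by (intro tendsto_diff)
qed

lemma signed_integral_indicator:
  assumes "m \<in> signed_measures" "A \<in> sets borel"
  shows "signed_integral m (indicator A) = m A"
  using assms finite_borel_jordan_pos[OF assms(1)]
    finite_borel_jordan_pos[OF signed_measures_uminus[OF assms(1)]]
  by (simp add: signed_integral_def finite_borel_def finite_measure.emeasure_finite
      jordan_decomposition[symmetric])

lemma signed_integral_lincomb:
  assumes m: "m \<in> signed_measures" and f: "bounded_borel f" and g: "bounded_borel g"
  shows "signed_integral m (\<lambda>x. a * f x + b * g x) = a * signed_integral m f + b * signed_integral m g"
proof -
  have "integral\<^sup>L (jordan_pos k) (\<lambda>x. a * f x + b * g x)
      = a * integral\<^sup>L (jordan_pos k) f + b * integral\<^sup>L (jordan_pos k) g"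
    if "k \<in> signed_measures" for k
    using finite_borel_integrable[OF finite_borel_jordan_pos[OF that]] f g by simp
  then show ?thesis
    using m signed_measures_uminus[OF m] unfolding signed_integral_def by (simp add: algebra_simps)
qed

lemma signed_measure_Times_split:
  assumes m: "m \<in> signed_measures" and ab: "a \<le> b" "b \<le> (c::real)" and B: "B \<in> sets (borel :: real measure)"
  shows "m ({a<..c} \<times> B) = m ({a<..b} \<times> B) + m ({b<..c} \<times> B)"
    and "m (B \<times> {a<..c}) = m (B \<times> {a<..b}) + m (B \<times> {b<..c})"
proof -
  have e: "{a<..c} \<times> B = {a<..b} \<times> B \<union> {b<..c} \<times> B" "B \<times> {a<..c} = B \<times> {a<..b} \<union> B \<times> {b<..c}"
    using ab by auto
  show "m ({a<..c} \<times> B) = m ({a<..b} \<times> B) + m ({b<..c} \<times> B)"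
    unfolding e(1) by (rule signed_measure_Un[OF m]) (use B in \<open>auto intro!: borel_Times\<close>)
  show "m (B \<times> {a<..c}) = m (B \<times> {a<..b}) + m (B \<times> {b<..c})"
    unfolding e(2) by (rule signed_measure_Un[OF m]) (use B in \<open>auto intro!: borel_Times\<close>)
qed

lemma signed_measures_lincomb:
  assumes "m1 \<in> signed_measures" "m2 \<in> signed_measures"
  shows "(\<lambda>A. a * m1 A + b * m2 A) \<in> signed_measures"
  using assms unfolding signed_measures_def by (auto intro!: sums_add sums_mult)

lemma signed_integral_measure_lincomb:
  assumes m: "m1 \<in> signed_measures" "m2 \<in> signed_measures" and \<phi>: "bounded_borel \<phi>"
  shows "signed_integral (\<lambda>A. a * m1 A + b * m2 A) \<phi> = a * signed_integral m1 \<phi> + b * signed_integral m2 \<phi>"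
proof -
  define k where "k s = (if s then m1 else m2)" for s :: bool
  define M where "M z = jordan_pos (if snd z then k (fst z) else (\<lambda>A. - k (fst z) A))" for z :: "bool \<times> bool"
  define c where "c z = (if fst z then a else b) * (if snd z then 1 else - 1)" for z :: "bool \<times> bool"
  have U: "(\<Sum>z\<in>UNIV. h z) = h (True, True) + h (True, False) + h (False, True) + h (False, False)"
    for h :: "bool \<times> bool \<Rightarrow> real"
    by (simp add: UNIV_bool UNIV_Times_UNIV[symmetric] sum.cartesian_product[symmetric] del: UNIV_Times_UNIV)
  have "finite_borel (M z)" for z
    using m signed_measures_uminus by (auto simp: M_def k_def intro!: finite_borel_jordan_pos)
  moreover have "a * m1 A + b * m2 A = (\<Sum>z\<in>UNIV. c z * measure (M z) A)" if "A \<in> sets borel" for A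
    using jordan_decomposition[OF m(1) that] jordan_decomposition[OF m(2) that]
    by (simp add: U c_def M_def k_def flip: right_diff_distrib)
  ultimately have "signed_integral (\<lambda>A. a * m1 A + b * m2 A) \<phi> = (\<Sum>z\<in>UNIV. c z * integral\<^sup>L (M z) \<phi>)"
    using \<phi> by (intro signed_integral_weighted_sum signed_measures_lincomb m)
  also have "\<dots> = a * signed_integral m1 \<phi> + b * signed_integral m2 \<phi>"
    by (simp add: U c_def M_def k_def signed_integral_def right_diff_distrib)
  finally show ?thesis .
qed

text \<open>
  Boxes that are open below and closed above, because their indicator functions are the pointwise limits
  of products of differences of smooth steps.
\<close>

lemma signed_measures_eqI:
  assumes m: "m \<in> signed_measures" and m': "m' \<in> signed_measures"
    and box: "\<And>a b c d. a \<le> b \<Longrightarrow> c \<le> d \<Longrightarrow> m ({a<..b} \<times> {c<..d}) = m' ({a<..b} \<times> {c<..d})"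
  shows "m = m'"
proof
  fix A :: "plane set"
  define G where "G = {{a<..b} \<times> {c<..d} | a b c d. (a::real) \<le> b \<and> (c::real) \<le> d}"
  have G_eq: "m B = m' B" if "B \<in> G" for B using that box by (auto simp: G_def)
  have GI: "{a<..b} \<times> {c<..d} \<in> sigma_sets UNIV G" for a b c d :: real
  proof (cases "a \<le> b \<and> c \<le> d")
    case False
    then have empty: "{a<..b} \<times> {c<..d} = {}" by auto
    show ?thesis unfolding empty by (rule sigma_sets.Empty)
  qed (unfold G_def, blast)
  have G_borel: "G \<subseteq> sets borel"
    by (auto simp: G_def intro!: borel_Times)
  have Int: "Int_stable G"
  proof (rule Int_stableI)
    fix B C assume "B \<in> G" "C \<in> G"
    then obtain a b c d a' b' c' d' where
      *: "B = {a<..b} \<times> {c<..d}" "C = {a'<..b'} \<times> {c'<..d'}" "a \<le> b" "c \<le> d" "a' \<le> b'" "c' \<le> d'"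
      unfolding G_def by blast
    show "B \<inter> C \<in> G"
    proof (cases "max a a' \<le> min b b' \<and> max c c' \<le> min d d'")
      case True
      have "B \<inter> C = {max a a'<..min b b'} \<times> {max c c'<..min d d'}" unfolding * by auto
      with True show ?thesis unfolding G_def by blast
    next
      case False
      then have "B \<inter> C = {0<..0::real} \<times> {0<..0::real}" unfolding * by auto
      then show ?thesis unfolding G_def by blast
    qed
  qed
  have open_box: "box p q \<in> sigma_sets UNIV G" for p q :: plane
  proof -
    obtain a c b d where pq: "p = (a, c)" "q = (b, d)" by fastforce
    have "box p q = (\<Union>n. {a<..b - 1 / real (Suc n)} \<times> {c<..d - 1 / real (Suc n)})" (is "_ = ?U")
    proof (intro antisym subsetI)
      fix z assume "z \<in> box p q"
      then obtain x y where z: "z = (x, y)" "a < x" "x < b" "c < y" "y < d"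
        by (cases z) (auto simp: pq box_def Basis_prod_def)
      then obtain n where "inverse (real (Suc n)) < min (b - x) (d - y)"
        using reals_Archimedean[of "min (b - x) (d - y)"] by auto
      then have "x \<le> b - 1 / real (Suc n)" "y \<le> d - 1 / real (Suc n)"
        by (auto simp: inverse_eq_divide)
      with z have "z \<in> {a<..b - 1 / real (Suc n)} \<times> {c<..d - 1 / real (Suc n)}" by simp
      then show "z \<in> ?U" by (rule UN_I[OF UNIV_I])
    next
      fix z assume "z \<in> ?U"
      then obtain n where n: "z \<in> {a<..b - 1 / real (Suc n)} \<times> {c<..d - 1 / real (Suc n)}" by blast
      define e where "e = 1 / real (Suc n)"
      have "0 < e" by (simp add: e_def)
      then show "z \<in> box p q"
        using n unfolding e_def[symmetric] by (cases z) (auto simp: pq box_def Basis_prod_def)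
    qed
    also have "\<dots> \<in> sigma_sets UNIV G" by (rule sigma_sets.Union) (rule GI)
    finally show ?thesis .
  qed
  have sets: "sets (borel :: plane measure) \<subseteq> sigma_sets UNIV G"
    unfolding borel_eq_box by (subst sets_measure_of) (auto intro!: sigma_sets_mono open_box)
  have UNIV_eq: "m UNIV = m' UNIV"
  proof -
    have U: "(\<Union>n. {- real n<..real n} \<times> {- real n<..real n}) = (UNIV :: plane set)"
    proof -
      have "\<exists>n. (x, y) \<in> {- real n<..real n} \<times> {- real n<..real n}" for x y
      proof -
        obtain n where "max \<bar>x\<bar> \<bar>y\<bar> < real n" using reals_Archimedean2 by blast
        then show ?thesis by (intro exI[of _ n]) auto
      qed
      then show ?thesis by auto
    qed
    have lim: "(\<lambda>n. k ({- real n<..real n} \<times> {- real n<..real n})) \<longlonglongrightarrow> k UNIV"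
      if k: "k \<in> signed_measures" for k
    proof -
      let ?B = "\<lambda>n. {- real n<..real n} \<times> {- real n<..real n}"
      have b: "?B n \<in> sets borel" for n by (intro borel_Times) auto
      have "(\<lambda>n. measure M (?B n)) \<longlonglongrightarrow> measure M UNIV" if M: "finite_borel M" for M
      proof -
        have "range ?B \<subseteq> sets M" using M b unfolding finite_borel_def by blast
        moreover have "incseq ?B" by (auto simp: incseq_def)
        ultimately show ?thesis
          using finite_measure.finite_Lim_measure_incseq[of M ?B] M U by (auto simp: finite_borel_def)
      qed
      then have "(\<lambda>n. measure (jordan_pos k) (?B n) - measure (jordan_pos (\<lambda>A. - k A)) (?B n))
          \<longlonglongrightarrow> measure (jordan_pos k) UNIV - measure (jordan_pos (\<lambda>A. - k A)) UNIV"
        using k signed_measures_uminus by (intro tendsto_diff) (auto simp: finite_borel_jordan_pos)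
      then show ?thesis using k b by (simp add: jordan_decomposition)
    qed
    have "k ({- real n<..real n} \<times> {- real n<..real n}) = m' ({- real n<..real n} \<times> {- real n<..real n})"
      if "k = m" for k n using box[of "- real n" "real n" "- real n" "real n"] that by simp
    with lim[OF m] lim[OF m'] show ?thesis by (auto intro: LIMSEQ_unique)
  qed
  show "m A = m' A"
  proof (cases "A \<in> sets borel")
    case True
    have A: "A \<in> sigma_sets UNIV G" using True sets by blast
    have sigma: "sigma_sets UNIV G = sets borel"
      using sets sets.sigma_sets_subset[OF G_borel] by auto
    have "G \<subseteq> Pow UNIV" by simp
    from this A show ?thesis
    proof (induct A rule: sigma_sets_induct_disjoint[OF Int, consumes 2, case_names basic empty compl union])
      case empty
      show ?case using m m' by (simp add: signed_measures_def)
    next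
      case (compl A)
      then show ?case
        using signed_measure_Diff[OF m, of UNIV A] signed_measure_Diff[OF m', of UNIV A] UNIV_eq sigma by auto
    next
      case (union A)
      then have "range A \<subseteq> sets borel" using sigma by blast
      then have "(\<lambda>i. m (A i)) sums m (\<Union>i. A i)" "(\<lambda>i. m' (A i)) sums m' (\<Union>i. A i)"
        using m m' union(1) unfolding signed_measures_def by blast+
      then show ?case using union by (simp add: sums_iff)
    qed (auto simp: G_eq)
  next
    case False
    then show ?thesis using m m' by (simp add: signed_measure_notin_sets)
  qed
qed

section \<open>Total variation\<close>

text \<open>
  The sum of the two Jordan parts: it dominates absolute values of integrals and is additive over disjoint
  sets.
\<close>

definition variation_measure :: "set_function \<Rightarrow> plane set \<Rightarrow> real" where
  "variation_measure m A = measure (jordan_pos m) A + measure (jordan_pos (\<lambda>A. - m A)) A"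

lemma signed_integral_abs_le:
  assumes m: "m \<in> signed_measures_on X" and X: "X \<in> sets borel"
    and u: "bounded_borel u" and A: "A \<in> sets borel"
    and le: "\<And>p. p \<in> X \<Longrightarrow> \<bar>u p\<bar> \<le> h * indicator A p"
  shows "\<bar>signed_integral m u\<bar> \<le> h * variation_measure m A"
proof -
  have *: "\<bar>integral\<^sup>L (jordan_pos k) u\<bar> \<le> h * measure (jordan_pos k) A"
    if k: "k \<in> signed_measures_on X" for k
  proof -
    have fb: "finite_borel (jordan_pos k)"
      using k by (auto simp: signed_measures_on_def intro: finite_borel_jordan_pos)
    have "\<bar>integral\<^sup>L (jordan_pos k) u\<bar> \<le> integral\<^sup>L (jordan_pos k) (\<lambda>p. \<bar>u p\<bar>)"
      by (rule integral_abs_bound)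
    also have "\<dots> \<le> integral\<^sup>L (jordan_pos k) (\<lambda>p. h * indicator A p)"
    proof (rule integral_mono_AE)
      show "AE p in jordan_pos k. \<bar>u p\<bar> \<le> h * indicator A p"
        using AE_jordan_pos[OF k X] by eventually_elim (rule le)
      show "integrable (jordan_pos k) (\<lambda>p. h * indicator A p)"
        by (rule finite_borel_integrable[OF fb bounded_borel_cmult[OF bounded_borel_indicator[OF A]]])
      show "integrable (jordan_pos k) (\<lambda>p. \<bar>u p\<bar>)"
        by (rule integrable_abs[OF finite_borel_integrable[OF fb u]])
    qed
    also have "\<dots> = h * measure (jordan_pos k) A"
      using fb A by (simp add: finite_borel_def finite_measure.emeasure_finite)
    finally show ?thesis .
  qed
  from *[OF m] *[OF signed_measures_on_uminus[OF m]] show ?thesis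
    unfolding signed_integral_def variation_measure_def by (simp add: distrib_left)
qed

lemma variation_measure_disjoint_le:
  assumes m: "m \<in> signed_measures" and I: "finite I" "\<And>i. i \<in> I \<Longrightarrow> A i \<in> sets borel"
    "disjoint_family_on A I"
  shows "(\<Sum>i\<in>I. variation_measure m (A i)) \<le> variation_measure m UNIV"
proof -
  have *: "(\<Sum>i\<in>I. measure M (A i)) \<le> measure M UNIV" if M: "finite_borel M" for M
  proof -
    interpret finite_measure M using M by (simp add: finite_borel_def)
    have sp: "space M = UNIV" using M sets_eq_imp_space_eq[of M borel] by (simp add: finite_borel_def)
    have "(\<Sum>i\<in>I. measure M (A i)) = measure M (\<Union>i\<in>I. A i)"
      using I M by (intro finite_measure_finite_Union[symmetric]) (auto simp: finite_borel_def)
    also have "\<dots> \<le> measure M UNIV" using bounded_measure[of "\<Union>i\<in>I. A i"] sp by simp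
    finally show ?thesis .
  qed
  show ?thesis
    unfolding variation_measure_def sum.distrib
    using m signed_measures_uminus[OF m] by (intro add_mono * finite_borel_jordan_pos)
qed

lemma total_variation_ge_sum:
  assumes m: "m \<in> signed_measures" and I: "finite I" "\<And>i. i \<in> I \<Longrightarrow> B i \<in> sets borel"
    "disjoint_family_on B I"
  shows "ennreal (\<Sum>i\<in>I. \<bar>m (B i)\<bar>) \<le> total_variation m"
proof -
  \<comment> \<open>A partition has no empty members, so empty sets are dropped and the rest \<open>R\<close> is added if nonempty.\<close>
  define J where "J = {i\<in>I. B i \<noteq> {}}"
  define R where "R = UNIV - (\<Union>i\<in>J. B i)"
  have J: "finite J" "J \<subseteq> I" using I by (auto simp: J_def)
  have R: "R \<in> sets borel" using I J unfolding R_def by (intro sets.Diff sets.finite_UN) auto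
  have inj: "inj_on B J"
    using I(3) by (auto simp: inj_on_def J_def disjoint_family_on_def)
  define P where "P = B ` J \<union> ({R} - {{}})"
  have "partition_on UNIV P"
  proof (rule partition_onI)
    show "\<Union> P = UNIV" by (auto simp: P_def R_def)
    fix p q assume "p \<in> P" "q \<in> P" "p \<noteq> q"
    then consider i j where "i \<in> J" "j \<in> J" "p = B i" "q = B j"
      | i where "i \<in> J" "p = B i" "q = R" | i where "i \<in> J" "p = R" "q = B i"
      unfolding P_def by blast
    then show "disjnt p q"
    proof cases
      case 1
      with \<open>p \<noteq> q\<close> J show ?thesis
        using disjoint_family_onD[OF I(3), of i j] by (auto simp: disjnt_def)
    qed (auto simp: R_def disjnt_def)
  qed (auto simp: P_def J_def)
  moreover have "finite P" "P \<subseteq> sets borel" using I J R by (auto simp: P_def)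
  ultimately have le: "(\<Sum>A\<in>P. ennreal \<bar>m A\<bar>) \<le> total_variation m"
    unfolding total_variation_def by (intro SUP_upper) auto
  have "(\<Sum>i\<in>I. \<bar>m (B i)\<bar>) = (\<Sum>i\<in>J. \<bar>m (B i)\<bar>)"
    using I m by (intro sum.mono_neutral_right) (auto simp: J_def signed_measures_def)
  then have "ennreal (\<Sum>i\<in>I. \<bar>m (B i)\<bar>) = (\<Sum>i\<in>J. ennreal \<bar>m (B i)\<bar>)" by simp
  also have "\<dots> = (\<Sum>A\<in>B ` J. ennreal \<bar>m A\<bar>)" using inj by (simp add: sum.reindex)
  also have "\<dots> \<le> (\<Sum>A\<in>P. ennreal \<bar>m A\<bar>)"
    using \<open>finite P\<close> by (intro sum_mono2) (auto simp: P_def)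
  finally show ?thesis using le by (rule order_trans)
qed

lemma total_variation_weighted_sum_le:
  assumes I: "finite I" "\<And>k. k \<in> I \<Longrightarrow> finite_borel (M k)"
  shows "total_variation (\<lambda>A. \<Sum>k\<in>I. c k * measure (M k) A) \<le> ennreal (\<Sum>k\<in>I. \<bar>c k\<bar> * measure (M k) UNIV)"
  unfolding total_variation_def
proof (rule SUP_least)
  fix P assume "P \<in> {P. finite P \<and> P \<subseteq> sets borel \<and> partition_on (UNIV::plane set) P}"
  then have P: "finite P" "P \<subseteq> sets borel" "partition_on (UNIV::plane set) P" by auto
  have add: "(\<Sum>A\<in>P. measure (M k) A) = measure (M k) UNIV" if "k \<in> I" for k
  proof -
    interpret finite_measure "M k" using I(2)[OF that] by (simp add: finite_borel_def)
    have "measure (M k) (\<Union>A\<in>P. A) = (\<Sum>A\<in>P. measure (M k) A)"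
      using P I(2)[OF that]
      by (intro finite_measure_finite_Union)
        (auto simp: finite_borel_def disjoint_family_on_def partition_on_def disjoint_def)
    then show ?thesis using P by (simp add: partition_on_def)
  qed
  have "(\<Sum>A\<in>P. ennreal \<bar>\<Sum>k\<in>I. c k * measure (M k) A\<bar>) = ennreal (\<Sum>A\<in>P. \<bar>\<Sum>k\<in>I. c k * measure (M k) A\<bar>)"
    by simp
  also have "\<dots> \<le> ennreal (\<Sum>A\<in>P. \<Sum>k\<in>I. \<bar>c k\<bar> * measure (M k) A)"
    by (intro ennreal_leI sum_mono order_trans[OF sum_abs]) (simp add: abs_mult)
  also have "(\<Sum>A\<in>P. \<Sum>k\<in>I. \<bar>c k\<bar> * measure (M k) A) = (\<Sum>k\<in>I. \<bar>c k\<bar> * measure (M k) UNIV)"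
    by (subst sum.swap) (simp add: sum_distrib_left[symmetric] add)
  finally show "(\<Sum>A\<in>P. ennreal \<bar>\<Sum>k\<in>I. c k * measure (M k) A\<bar>) \<le> \<dots>" .
qed

lemma total_variation_lincomb_le:
  "total_variation (\<lambda>A. a * m A + b * m' A) \<le> ennreal \<bar>a\<bar> * total_variation m + ennreal \<bar>b\<bar> * total_variation m'"
  unfolding total_variation_def[of "\<lambda>A. a * m A + b * m' A"]
proof (rule SUP_least)
  fix P assume P: "P \<in> {P. finite P \<and> P \<subseteq> sets borel \<and> partition_on (UNIV::plane set) P}"
  have "(\<Sum>A\<in>P. ennreal \<bar>a * m A + b * m' A\<bar>) \<le> (\<Sum>A\<in>P. ennreal \<bar>a\<bar> * ennreal \<bar>m A\<bar> + ennreal \<bar>b\<bar> * ennreal \<bar>m' A\<bar>)"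
  proof (rule sum_mono)
    fix A
    have "ennreal \<bar>a * m A + b * m' A\<bar> \<le> ennreal (\<bar>a\<bar> * \<bar>m A\<bar> + \<bar>b\<bar> * \<bar>m' A\<bar>)"
      by (intro ennreal_leI order_trans[OF abs_triangle_ineq]) (simp add: abs_mult)
    then show "ennreal \<bar>a * m A + b * m' A\<bar> \<le> ennreal \<bar>a\<bar> * ennreal \<bar>m A\<bar> + ennreal \<bar>b\<bar> * ennreal \<bar>m' A\<bar>"
      by (simp add: ennreal_mult)
  qed
  also have "\<dots> = ennreal \<bar>a\<bar> * (\<Sum>A\<in>P. ennreal \<bar>m A\<bar>) + ennreal \<bar>b\<bar> * (\<Sum>A\<in>P. ennreal \<bar>m' A\<bar>)"
    by (simp add: sum.distrib sum_distrib_left del: sum_ennreal)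
  also have "\<dots> \<le> ennreal \<bar>a\<bar> * total_variation m + ennreal \<bar>b\<bar> * total_variation m'"
    unfolding total_variation_def using P by (intro add_mono mult_left_mono SUP_upper) auto
  finally show "(\<Sum>A\<in>P. ennreal \<bar>a * m A + b * m' A\<bar>) \<le> \<dots>" .
qed

section \<open>Smooth functions of one variable\<close>

text \<open>
  The derivative is a bound variable, not \<^term>\<open>deriv g\<close>: in the inductions below it is then given by
  the rules for derivatives.
\<close>

primrec times_differentiable :: "nat \<Rightarrow> (real \<Rightarrow> real) \<Rightarrow> bool" where
  "times_differentiable 0 g \<longleftrightarrow> True"
| "times_differentiable (Suc k) g \<longleftrightarrow>
     (\<exists>g'. (\<forall>x. (g has_real_derivative g' x) (at x)) \<and> times_differentiable k g')"

definition smooth_real :: "(real \<Rightarrow> real) \<Rightarrow> bool" where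
  "smooth_real g \<longleftrightarrow> (\<forall>k. times_differentiable k g)"

lemma times_differentiable_Suc_imp: "times_differentiable (Suc k) g \<Longrightarrow> times_differentiable k g"
  by (induction k arbitrary: g) (simp, metis times_differentiable.simps(2))

lemma times_differentiable_const: "times_differentiable k (\<lambda>x. c)"
proof (induction k arbitrary: c)
  case (Suc k)
  have "\<forall>x. ((\<lambda>x. c) has_real_derivative (\<lambda>x. 0) x) (at x)" by simp
  with Suc[of 0] show ?case unfolding times_differentiable.simps by (intro exI conjI)
qed simp

lemma times_differentiable_add:
  "times_differentiable k f \<Longrightarrow> times_differentiable k g \<Longrightarrow> times_differentiable k (\<lambda>x. f x + g x)"
proof (induction k arbitrary: f g)
  case (Suc k)
  then obtain f' g' where "\<forall>x. (f has_real_derivative f' x) (at x)" "times_differentiable k f'"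
    "\<forall>x. (g has_real_derivative g' x) (at x)" "times_differentiable k g'" by auto
  with Suc.IH[of f' g'] show ?case
    by (auto intro!: exI[of _ "\<lambda>x. f' x + g' x"] DERIV_add)
qed simp

lemma times_differentiable_mult:
  "times_differentiable k f \<Longrightarrow> times_differentiable k g \<Longrightarrow> times_differentiable k (\<lambda>x. f x * g x)"
proof (induction k arbitrary: f g)
  case (Suc k)
  then obtain f' g' where *: "\<forall>x. (f has_real_derivative f' x) (at x)" "times_differentiable k f'"
    "\<forall>x. (g has_real_derivative g' x) (at x)" "times_differentiable k g'" by auto
  have "times_differentiable k f" "times_differentiable k g"
    using Suc.prems times_differentiable_Suc_imp by blast+
  with * have "times_differentiable k (\<lambda>x. f' x * g x + g' x * f x)"
    by (intro times_differentiable_add Suc.IH)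
  with * show ?case by (auto intro!: exI[of _ "\<lambda>x. f' x * g x + g' x * f x"] DERIV_mult)
qed simp

lemma times_differentiable_affine:
  "times_differentiable k g \<Longrightarrow> times_differentiable k (\<lambda>x. g (a * x + b))"
proof (induction k arbitrary: g)
  case (Suc k)
  then obtain g' where *: "\<And>x. (g has_real_derivative g' x) (at x)" "times_differentiable k g'"
    by auto
  have "((\<lambda>x. g (a * x + b)) has_real_derivative g' (a * x + b) * a) (at x)" for x
    by (rule DERIV_chain2[of g, OF *(1)]) (auto intro!: derivative_eq_intros)
  moreover have "times_differentiable k (\<lambda>x. g' (a * x + b) * a)"
    by (rule times_differentiable_mult[OF Suc.IH[OF *(2)] times_differentiable_const])
  ultimately show ?case
    by (auto intro!: exI[of _ "\<lambda>x. g' (a * x + b) * a"])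
qed simp

lemma smooth_real_const: "smooth_real (\<lambda>x. c)"
  by (simp add: smooth_real_def times_differentiable_const)

lemma smooth_real_add: "smooth_real f \<Longrightarrow> smooth_real g \<Longrightarrow> smooth_real (\<lambda>x. f x + g x)"
  by (simp add: smooth_real_def times_differentiable_add)

lemma smooth_real_mult: "smooth_real f \<Longrightarrow> smooth_real g \<Longrightarrow> smooth_real (\<lambda>x. f x * g x)"
  by (simp add: smooth_real_def times_differentiable_mult)

lemma smooth_real_diff:
  assumes "smooth_real f" "smooth_real g" shows "smooth_real (\<lambda>x. f x - g x)"
  using smooth_real_add[OF assms(1) smooth_real_mult[OF smooth_real_const[of "-1"] assms(2)]] by simp

lemma smooth_real_affine: "smooth_real g \<Longrightarrow> smooth_real (\<lambda>x. g (a * x + b))"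
  by (simp add: smooth_real_def times_differentiable_affine)

lemma smooth_realI:
  assumes "\<And>x. (g has_real_derivative g' x) (at x)" "smooth_real g'"
  shows "smooth_real g"
  unfolding smooth_real_def
proof
  fix k show "times_differentiable k g"
    using assms by (cases k) (auto simp: smooth_real_def)
qed

lemma smooth_real_deriv:
  assumes "smooth_real g"
  shows "(g has_real_derivative deriv g x) (at x)" and "smooth_real (deriv g)"
proof -
  have *: "(\<forall>x. (g has_real_derivative deriv g x) (at x)) \<and> times_differentiable k (deriv g)" for k
  proof -
    have "times_differentiable (Suc k) g" using assms by (simp only: smooth_real_def)
    then obtain g' where g': "\<And>x. (g has_real_derivative g' x) (at x)" "times_differentiable k g'"
      by auto
    then have "deriv g = g'" by (auto simp: fun_eq_iff intro: DERIV_imp_deriv)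
    with g' show ?thesis by simp
  qed
  then show "(g has_real_derivative deriv g x) (at x)" "smooth_real (deriv g)"
    by (auto simp: smooth_real_def)
qed

text \<open>
  The functions \<open>x powr (- k) * exp (- 1 / x)\<close>, continued by \<open>0\<close>: all derivatives vanish at \<open>0\<close>.
\<close>

definition flat :: "nat \<Rightarrow> real \<Rightarrow> real" where
  "flat k x = (if 0 < x then (1 / x) ^ k * exp (- 1 / x) else 0)"

lemma flat_nonneg: "0 \<le> flat k x" by (simp add: flat_def)

lemma flat_le:
  assumes "0 < x" shows "flat k x \<le> fact (Suc k) * x"
proof -
  define z where "z = 1 / x"
  have "0 < z" using assms by (simp add: z_def)
  then have "z ^ Suc k /\<^sub>R fact (Suc k) \<le> exp z"
    unfolding exp_def using sum_le_suminf[OF summable_exp_generic[of z], of "{Suc k}"] by simp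
  then have "z ^ Suc k \<le> exp z * fact (Suc k)"
    by (simp add: divide_le_eq divide_inverse[symmetric] mult.commute[of "inverse _"] del: fact_Suc power_Suc)
  then have "z ^ Suc k * exp (- z) \<le> exp z * fact (Suc k) * exp (- z)"
    by (intro mult_right_mono) auto
  then have "(1 / x) ^ Suc k * exp (- (1 / x)) \<le> fact (Suc k)"
    using exp_minus_inverse[of z] unfolding z_def[symmetric]
    by (simp only: mult.commute[of "exp z"] mult.assoc)
  then have "x * ((1 / x) ^ Suc k * exp (- (1 / x))) \<le> x * fact (Suc k)"
    using assms by (intro mult_left_mono) auto
  then show ?thesis using assms by (simp add: flat_def field_simps del: fact_Suc)
qed

lemma flat_tendsto_0: "(flat k \<longlongrightarrow> 0) (at 0)"
proof (rule Lim_null_comparison)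
  show "\<forall>\<^sub>F x in at 0. norm (flat k x) \<le> fact (Suc k) * \<bar>x\<bar>"
  proof (intro always_eventually allI)
    fix x show "norm (flat k x) \<le> fact (Suc k) * \<bar>x\<bar>"
      using flat_le[of x k] flat_nonneg[of k x]
      by (cases "0 < x") (auto simp: flat_def[of k x] mult_nonneg_nonpos simp del: fact_Suc)
  qed
  show "((\<lambda>x. fact (Suc k) * \<bar>x\<bar>) \<longlongrightarrow> 0) (at (0::real))"
    by (auto intro!: tendsto_eq_intros)
qed

text \<open>The functions \<^const>\<open>flat\<close> span a space closed under differentiation; this makes them smooth.\<close>

lemma flat_has_derivative:
  "(flat k has_real_derivative flat (k + 2) x - real k * flat (k + 1) x) (at x)"
proof -
  consider "x < 0" | "x = 0" | "0 < x" by linarith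
  then show ?thesis
  proof cases
    case 1
    have "((\<lambda>x. 0) has_real_derivative 0) (at x)" by simp
    then have "(flat k has_real_derivative 0) (at x)"
      by (rule has_field_derivative_transform_within_open[where S="{..<0}"]) (use 1 in \<open>auto simp: flat_def\<close>)
    with 1 show ?thesis by (simp add: flat_def)
  next
    case 2
    have "flat k h / h = flat (k + 1) h" for h by (simp add: flat_def)
    then have "((\<lambda>h. (flat k (0 + h) - flat k 0) / h) \<longlongrightarrow> 0) (at 0)"
      using flat_tendsto_0[of "k + 1"] by (simp add: flat_def[of k 0])
    then have "(flat k has_real_derivative 0) (at 0)" by (simp add: DERIV_def)
    with 2 show ?thesis by (simp add: flat_def)
  next
    case 3
    have "((\<lambda>x. (1 / x) ^ k * exp (- 1 / x)) has_real_derivative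
        flat (k + 2) x - real k * flat (k + 1) x) (at x)"
      using 3 by (cases k) (auto simp: flat_def field_simps power2_eq_square intro!: derivative_eq_intros,
        metis Suc_pred neq0_conv power_Suc)
    then show ?thesis
      by (rule has_field_derivative_transform_within_open[where S="{0<..}"]) (use 3 in \<open>auto simp: flat_def\<close>)
  qed
qed

lemma smooth_flat: "smooth_real (flat k)"
proof -
  have "times_differentiable n (flat k)" for n
  proof (induction n arbitrary: k)
    case (Suc n)
    have "times_differentiable n (\<lambda>x. flat (k + 2) x + (- real k) * flat (k + 1) x)"
      by (intro times_differentiable_add times_differentiable_mult times_differentiable_const Suc)
    then show ?case using flat_has_derivative[of k]
      by (auto intro!: exI[of _ "\<lambda>x. flat (k + 2) x - real k * flat (k + 1) x"])
  qed simp
  then show ?thesis by (simp add: smooth_real_def)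
qed

lemma smooth_real_antiderivative:
  assumes "smooth_real f"
  obtains F where "smooth_real F" "\<And>x. (F has_real_derivative f x) (at x)"
proof -
  have "isCont f x" for x using smooth_real_deriv(1)[OF assms, of x] by (rule DERIV_isCont)
  then obtain F where "\<And>x. (F has_vector_derivative f x) (at x)"
    using einterval_antiderivative[of "-\<infinity>" "\<infinity>" f] by auto
  then have "\<And>x. (F has_real_derivative f x) (at x)"
    by (simp add: has_real_derivative_iff_has_vector_derivative)
  then show thesis using that smooth_realI[of F f] assms by blast
qed

text \<open>
  The product of \<^term>\<open>flat 0 x\<close> with its reflection \<^term>\<open>flat 0 (1 - x)\<close> is a bump on the unit interval;
  normalise its integral to \<open>1\<close> and integrate twice.
\<close>

lemma smooth_ramp_exists:
  "\<exists>T. smooth_real T \<and> (\<forall>x\<le>0. T x = 0) \<and> (\<forall>x\<le>0. deriv T x = 0) \<and> (\<forall>x\<ge>1. deriv T x = 1) \<and>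
     (\<forall>x. 0 \<le> deriv (deriv T) x) \<and> (\<forall>x. x \<notin> {0..1} \<longrightarrow> deriv (deriv T) x = 0)"
proof -
  define b where "b x = flat 0 x * flat 0 ((-1) * x + 1)" for x
  have b: "smooth_real b" unfolding b_def by (rule smooth_real_mult[OF smooth_flat smooth_real_affine[OF smooth_flat]])
  have b0: "0 \<le> b x" "x \<le> 0 \<or> 1 \<le> x \<Longrightarrow> b x = 0" "0 < x \<Longrightarrow> x < 1 \<Longrightarrow> 0 < b x" for x
    by (auto simp: b_def flat_def)
  obtain F where F: "smooth_real F" "\<And>x. (F has_real_derivative b x) (at x)"
    using smooth_real_antiderivative[OF b] by blast
  have Fl: "F x = F 0" if x: "x \<le> 0" for x
  proof (cases "x = 0")
    case False
    then obtain z where "z < 0" "F 0 - F x = (0 - x) * b z" using MVT2[of x 0 F b] F x by auto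
    then show ?thesis using b0(2)[of z] by auto
  qed simp
  have Fr: "F x = F 1" if x: "1 \<le> x" for x
  proof (cases "x = 1")
    case False
    then obtain z where "1 < z" "F x - F 1 = (x - 1) * b z" using MVT2[of 1 x F b] F x by auto
    then show ?thesis using b0(2)[of z] by auto
  qed simp
  obtain z where "0 < z" "z < 1" "F 1 - F 0 = (1 - 0) * b z" using MVT2[of 0 1 F b] F by auto
  with b0(3)[of z] have c: "0 < F 1 - F 0" by simp
  define s where "s x = b x / (F 1 - F 0)" for x
  define S where "S x = (F x - F 0) / (F 1 - F 0)" for x
  have SD: "(S has_real_derivative s x) (at x)" for x
    unfolding S_def s_def using F(2)[of x] c by (auto intro!: derivative_eq_intros)
  have "smooth_real (\<lambda>x. (F x - F 0) * (1 / (F 1 - F 0)))"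
    by (rule smooth_real_mult[OF smooth_real_diff[OF F(1) smooth_real_const] smooth_real_const])
  then have S: "smooth_real S" by (simp add: S_def[abs_def])
  obtain U where U: "smooth_real U" "\<And>x. (U has_real_derivative S x) (at x)"
    using smooth_real_antiderivative[OF S] by blast
  have Ul: "U x = U 0" if x: "x \<le> 0" for x
  proof (cases "x = 0")
    case False
    then obtain z where "z < 0" "U 0 - U x = (0 - x) * S z" using MVT2[of x 0 U S] U x by auto
    then show ?thesis using Fl[of z] by (auto simp: S_def)
  qed simp
  let ?T = "\<lambda>x. U x - U 0"
  have TD: "(?T has_real_derivative S x) (at x)" for x using U(2)[of x] by (auto intro!: derivative_eq_intros)
  have dT: "deriv ?T = S" using TD by (auto simp: fun_eq_iff intro: DERIV_imp_deriv)
  have dS: "deriv S = s" using SD by (auto simp: fun_eq_iff intro: DERIV_imp_deriv)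
  have "smooth_real ?T" by (rule smooth_real_diff[OF U(1) smooth_real_const])
  moreover have "?T x = 0" "S x = 0" if "x \<le> 0" for x
    using Ul[OF that] Fl[OF that] by (simp_all add: S_def)
  moreover have "S x = 1" if "1 \<le> x" for x using Fr[OF that] c by (simp add: S_def)
  moreover have "0 \<le> s x" "x \<notin> {0..1} \<Longrightarrow> s x = 0" for x
    using b0(1,2)[of x] c by (auto simp: s_def)
  ultimately show ?thesis by (intro exI[of _ ?T], unfold dT dS) blast
qed

text \<open>
  One function and its first two derivatives serve as smooth versions of the positive part, of the
  Heaviside function and of the Dirac mass.
\<close>

definition smooth_ramp :: "real \<Rightarrow> real" where
  "smooth_ramp = (SOME T. smooth_real T \<and> (\<forall>x\<le>0. T x = 0) \<and>
     (\<forall>x\<le>0. deriv T x = 0) \<and> (\<forall>x\<ge>1. deriv T x = 1) \<and>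
     (\<forall>x. 0 \<le> deriv (deriv T) x) \<and> (\<forall>x. x \<notin> {0..1} \<longrightarrow> deriv (deriv T) x = 0))"

definition smooth_step :: "real \<Rightarrow> real" where "smooth_step = deriv smooth_ramp"

definition smooth_bump :: "real \<Rightarrow> real" where "smooth_bump = deriv smooth_step"

lemma smooth_ramp: "smooth_real smooth_ramp" "x \<le> 0 \<Longrightarrow> smooth_ramp x = 0"
    "(smooth_ramp has_real_derivative smooth_step x) (at x)"
  and smooth_step: "smooth_real smooth_step" "x \<le> 0 \<Longrightarrow> smooth_step x = 0" "1 \<le> x \<Longrightarrow> smooth_step x = 1"
    "(smooth_step has_real_derivative smooth_bump x) (at x)"
  and smooth_bump: "smooth_real smooth_bump" "0 \<le> smooth_bump x" "x \<notin> {0..1} \<Longrightarrow> smooth_bump x = 0"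
  using someI_ex[OF smooth_ramp_exists, folded smooth_ramp_def]
  by (auto simp: smooth_step_def smooth_bump_def intro!: smooth_real_deriv)

lemma smooth_step_bounds: "0 \<le> smooth_step x" "smooth_step x \<le> 1"
proof -
  have mono: "smooth_step a \<le> smooth_step b" if "a \<le> b" for a b
    using smooth_step(4) smooth_bump(2) that by (intro DERIV_nonneg_imp_nondecreasing[OF that]) blast
  show "0 \<le> smooth_step x" using mono[of "min x 0" x] by (simp add: smooth_step(2))
  show "smooth_step x \<le> 1" using mono[of x "max x 1"] by (simp add: smooth_step(3))
qed

lemma smooth_ramp_affine:
  assumes "1 \<le> x" shows "smooth_ramp x = smooth_ramp 1 + (x - 1)"
proof (cases "x = 1")
  case False
  then obtain z where "1 < z" "smooth_ramp x - smooth_ramp 1 = (x - 1) * smooth_step z"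
    using MVT2[of 1 x smooth_ramp smooth_step] smooth_ramp(3) assms by auto
  then show ?thesis using smooth_step(3)[of z] by simp
qed simp

lemma smooth_ramp_approx: "\<bar>smooth_ramp x - max 0 x\<bar> \<le> 1"
proof -
  have *: "0 \<le> smooth_ramp y \<and> smooth_ramp y \<le> y" if "0 \<le> y" for y
  proof (cases "y = 0")
    case False
    with that have "0 < y" by simp
    from MVT2[OF this smooth_ramp(3)]
    obtain z where "smooth_ramp y - smooth_ramp 0 = (y - 0) * smooth_step z" by blast
    then show ?thesis
      using smooth_step_bounds[of z] that mult_left_mono[of "smooth_step z" 1 y] by (simp add: smooth_ramp(2))
  qed (simp add: smooth_ramp(2))
  consider "x \<le> 0" | "0 \<le> x" "x \<le> 1" | "1 \<le> x" by linarith
  then show ?thesis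
  proof cases
    case 2 then show ?thesis using *[of x] by (simp add: abs_le_iff)
  next
    case 3 then show ?thesis using *[of 1] smooth_ramp_affine[OF 3] by (simp add: abs_le_iff)
  qed (simp add: smooth_ramp(2))
qed

section \<open>Test functions and distributions\<close>

lemma smooth_partial1: "smooth \<phi> \<Longrightarrow> smooth (partial1 \<phi>)"
  and smooth_partial2: "smooth \<phi> \<Longrightarrow> smooth (partial2 \<phi>)"
  unfolding smooth_def by (metis C_diff.simps(2))+

lemma smooth_continuous: "smooth \<phi> \<Longrightarrow> continuous_on UNIV \<phi>"
  unfolding smooth_def by (metis C_diff.simps(1))

lemma smooth_partial1_deriv:
  "smooth \<phi> \<Longrightarrow> ((\<lambda>t. \<phi> (t, y)) has_real_derivative partial1 \<phi> (x, y)) (at x)"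
  and smooth_partial2_deriv:
  "smooth \<phi> \<Longrightarrow> ((\<lambda>t. \<phi> (x, t)) has_real_derivative partial2 \<phi> (x, y)) (at y)"
proof -
  assume "smooth \<phi>"
  then have "C_diff (Suc 0) \<phi>" unfolding smooth_def by blast
  then show "((\<lambda>t. \<phi> (t, y)) has_real_derivative partial1 \<phi> (x, y)) (at x)"
      "((\<lambda>t. \<phi> (x, t)) has_real_derivative partial2 \<phi> (x, y)) (at y)"
    by (auto simp: partial1_def partial2_def DERIV_deriv_iff_real_differentiable)
qed

lemma eq_0_outside_tsupport: "p \<notin> tsupport \<phi> \<Longrightarrow> \<phi> p = 0"
  unfolding tsupport_def using closure_subset[of "{p. \<phi> p \<noteq> 0}"] by auto

lemma tsupport_subset:
  assumes "closed S" "\<And>p. p \<notin> S \<Longrightarrow> \<phi> p = 0"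
  shows "tsupport \<phi> \<subseteq> S"
  unfolding tsupport_def using assms by (intro closure_minimal) auto

lemma compact_tsupport:
  assumes "compact K" "\<And>p. p \<notin> K \<Longrightarrow> \<phi> p = 0"
  shows "compact (tsupport \<phi>)" "tsupport \<phi> \<subseteq> K"
proof -
  show "tsupport \<phi> \<subseteq> K" by (intro tsupport_subset compact_imp_closed assms)
  then show "compact (tsupport \<phi>)"
    using compact_Int_closed[OF assms(1), of "tsupport \<phi>"] by (simp add: tsupport_def Int_absorb1)
qed

lemma tsupport_partial:
  shows "tsupport (partial1 \<phi>) \<subseteq> tsupport \<phi>" and "tsupport (partial2 \<phi>) \<subseteq> tsupport \<phi>"
proof -
  have op: "open (- tsupport \<phi>)" by (simp add: tsupport_def open_Compl)
  have "partial1 \<phi> p = 0 \<and> partial2 \<phi> p = 0" if p: "p \<notin> tsupport \<phi>" for p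
  proof -
    obtain x y where [simp]: "p = (x, y)" by (cases p)
    have o1: "open ((\<lambda>t. (t, y)) -` (- tsupport \<phi>))" and o2: "open ((\<lambda>t. (x, t)) -` (- tsupport \<phi>))"
      by (intro open_vimage op continuous_intros)+
    have "((\<lambda>t. \<phi> (t, y)) has_real_derivative 0) (at x)"
      by (rule has_field_derivative_transform_within_open[of "\<lambda>_. 0" _ _ _, OF _ o1])
         (use p in \<open>auto simp: eq_0_outside_tsupport\<close>)
    moreover have "((\<lambda>t. \<phi> (x, t)) has_real_derivative 0) (at y)"
      by (rule has_field_derivative_transform_within_open[of "\<lambda>_. 0" _ _ _, OF _ o2])
         (use p in \<open>auto simp: eq_0_outside_tsupport\<close>)
    ultimately show ?thesis by (auto simp: partial1_def partial2_def dest: DERIV_imp_deriv)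
  qed
  then show "tsupport (partial1 \<phi>) \<subseteq> tsupport \<phi>" "tsupport (partial2 \<phi>) \<subseteq> tsupport \<phi>"
    using op by (simp_all add: tsupport_subset closed_def)
qed

lemma test_functions_partial:
  assumes "\<phi> \<in> test_functions \<Omega>"
  shows "partial1 \<phi> \<in> test_functions \<Omega>" and "partial2 \<phi> \<in> test_functions \<Omega>"
proof -
  have K: "compact (tsupport \<phi>)" using assms by (simp add: test_functions_def)
  have "compact (tsupport \<psi>)" if "tsupport \<psi> \<subseteq> tsupport \<phi>" for \<psi>
    by (rule compact_tsupport(1)[OF K]) (use that eq_0_outside_tsupport in blast)
  then show "partial1 \<phi> \<in> test_functions \<Omega>" "partial2 \<phi> \<in> test_functions \<Omega>"
    using assms tsupport_partial[of \<phi>] unfolding test_functions_def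
    by (auto simp: smooth_partial1 smooth_partial2)
qed

lemma test_functions_mono: "\<Omega> \<subseteq> \<Omega>' \<Longrightarrow> test_functions \<Omega> \<subseteq> test_functions \<Omega>'"
  unfolding test_functions_def by blast

lemma test_function_bounded:
  assumes "\<phi> \<in> test_functions \<Omega>"
  shows "\<exists>B. \<forall>p. \<bar>\<phi> p\<bar> \<le> B"
proof -
  have "compact (tsupport \<phi>)" "continuous_on (tsupport \<phi>) \<phi>"
    using assms smooth_continuous continuous_on_subset by (auto simp: test_functions_def) blast
  then have "bounded (\<phi> ` tsupport \<phi>)"
    by (intro compact_imp_bounded compact_continuous_image)
  then obtain B where "\<And>p. p \<in> tsupport \<phi> \<Longrightarrow> \<bar>\<phi> p\<bar> \<le> B" by (auto simp: bounded_iff)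
  then have "\<bar>\<phi> p\<bar> \<le> max B 0" for p
    using eq_0_outside_tsupport[of p \<phi>] by (cases "p \<in> tsupport \<phi>") (auto simp: le_max_iff_disj)
  then show ?thesis by blast
qed

lemma bounded_borel_test:
  assumes "\<phi> \<in> test_functions \<Omega>" shows "bounded_borel \<phi>"
proof -
  have "continuous_on UNIV \<phi>" using assms by (simp add: test_functions_def smooth_continuous)
  then show ?thesis
    using test_function_bounded[OF assms]
    by (auto simp: bounded_borel_def intro: borel_measurable_continuous_onI)
qed

lemma test_smooth: "\<phi> \<in> test_functions \<Omega> \<Longrightarrow> smooth \<phi>" by (simp add: test_functions_def)

lemma test_continuous: "\<phi> \<in> test_functions \<Omega> \<Longrightarrow> continuous_on UNIV \<phi>"
  by (simp add: test_functions_def smooth_continuous)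

definition sup_norm :: "(plane \<Rightarrow> real) \<Rightarrow> real" where
  "sup_norm \<phi> = (SUP p. \<bar>\<phi> p\<bar>)"

lemma sup_norm_upper:
  assumes "\<phi> \<in> test_functions \<Omega>" shows "\<bar>\<phi> p\<bar> \<le> sup_norm \<phi>"
  unfolding sup_norm_def using test_function_bounded[OF assms]
  by (intro cSUP_upper) (auto simp: bdd_above_def)

lemma test_functions_iterated:
  assumes "\<phi> \<in> test_functions \<Omega>"
  shows "(partial1 ^^ i) ((partial2 ^^ j) \<phi>) \<in> test_functions \<Omega>"
proof -
  have "(partial2 ^^ j) \<phi> \<in> test_functions \<Omega>"
    by (induction j) (simp_all add: assms test_functions_partial)
  then show ?thesis by (induction i) (simp_all add: test_functions_partial)
qed

lemma partial_lincomb: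
  assumes "C_diff (Suc k) \<phi>" "C_diff (Suc k) \<psi>"
  shows "partial1 (\<lambda>p. a * \<phi> p + b * \<psi> p) = (\<lambda>p. a * partial1 \<phi> p + b * partial1 \<psi> p)"
    and "partial2 (\<lambda>p. a * \<phi> p + b * \<psi> p) = (\<lambda>p. a * partial2 \<phi> p + b * partial2 \<psi> p)"
    and "(\<lambda>t. a * \<phi> (t, y) + b * \<psi> (t, y)) differentiable at x"
    and "(\<lambda>t. a * \<phi> (x, t) + b * \<psi> (x, t)) differentiable at y"
proof -
  have d: "((\<lambda>t. \<omega> (t, y)) has_real_derivative partial1 \<omega> (x, y)) (at x)"
      "((\<lambda>t. \<omega> (x, t)) has_real_derivative partial2 \<omega> (x, y)) (at y)"
    if "C_diff (Suc k) \<omega>" for \<omega> x y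
    using that by (auto simp: partial1_def partial2_def DERIV_deriv_iff_real_differentiable)
  have e: "((\<lambda>t. a * \<phi> (t, y) + b * \<psi> (t, y)) has_real_derivative
        a * partial1 \<phi> (x, y) + b * partial1 \<psi> (x, y)) (at x)"
      "((\<lambda>t. a * \<phi> (x, t) + b * \<psi> (x, t)) has_real_derivative
        a * partial2 \<phi> (x, y) + b * partial2 \<psi> (x, y)) (at y)" for x y
    by (intro DERIV_add DERIV_cmult d assms)+
  show "partial1 (\<lambda>p. a * \<phi> p + b * \<psi> p) = (\<lambda>p. a * partial1 \<phi> p + b * partial1 \<psi> p)"
      "partial2 (\<lambda>p. a * \<phi> p + b * \<psi> p) = (\<lambda>p. a * partial2 \<phi> p + b * partial2 \<psi> p)"
    unfolding partial1_def[of "\<lambda>p. a * \<phi> p + b * \<psi> p"] partial2_def[of "\<lambda>p. a * \<phi> p + b * \<psi> p"]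
    using e by (auto simp: fun_eq_iff intro!: DERIV_imp_deriv)
  show "(\<lambda>t. a * \<phi> (t, y) + b * \<psi> (t, y)) differentiable at x"
       "(\<lambda>t. a * \<phi> (x, t) + b * \<psi> (x, t)) differentiable at y"
    unfolding real_differentiable_def using e by blast+
qed

lemma C_diff_lincomb:
  "C_diff k \<phi> \<Longrightarrow> C_diff k \<psi> \<Longrightarrow> C_diff k (\<lambda>p. a * \<phi> p + b * \<psi> p)"
proof (induction k arbitrary: \<phi> \<psi>)
  case 0 then show ?case by (auto intro!: continuous_intros)
next
  case (Suc k)
  note p = partial_lincomb[OF Suc.prems, of a b]
  show ?case
    unfolding C_diff.simps p(1,2) using p(3,4) Suc by simp
qed

lemma test_functions_lincomb:
  assumes "\<phi> \<in> test_functions \<Omega>" "\<psi> \<in> test_functions \<Omega>"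
  shows "(\<lambda>p. a * \<phi> p + b * \<psi> p) \<in> test_functions \<Omega>"
proof -
  let ?S = "tsupport \<phi> \<union> tsupport \<psi>"
  have S: "compact ?S" "?S \<subseteq> \<Omega>" using assms by (auto simp: test_functions_def)
  have "a * \<phi> p + b * \<psi> p = 0" if "p \<notin> ?S" for p
    using that by (simp add: eq_0_outside_tsupport)
  from compact_tsupport[of ?S "\<lambda>p. a * \<phi> p + b * \<psi> p", OF S(1) this] show ?thesis
    using assms S by (auto simp: test_functions_def smooth_def C_diff_lincomb)
qed

lemma finite_multi_index: "finite {(i::nat, j). i + j \<le> N}"
  by (rule finite_subset[of _ "{..N} \<times> {..N}"]) auto

definition test_seminorm :: "nat \<Rightarrow> (plane \<Rightarrow> real) \<Rightarrow> real" where
  "test_seminorm N \<phi> = (\<Sum>(i, j)\<in>{(i, j). i + j \<le> N}. SUP p. \<bar>(partial1 ^^ i) ((partial2 ^^ j) \<phi>) p\<bar>)"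

text \<open>
  Monotonicity needs the suprema to be nonnegative, hence to be suprema of bounded sets; therefore the
  restriction to test functions.
\<close>

lemma test_seminorm_mono:
  assumes "\<phi> \<in> test_functions \<Omega>" "N \<le> N'"
  shows "0 \<le> test_seminorm N \<phi>" "test_seminorm N \<phi> \<le> test_seminorm N' \<phi>"
proof -
  have *: "0 \<le> (SUP p. \<bar>(partial1 ^^ i) ((partial2 ^^ j) \<phi>) p\<bar>)" for i j
    using sup_norm_upper[OF test_functions_iterated[OF assms(1)], of i j undefined]
    unfolding sup_norm_def by linarith
  show "0 \<le> test_seminorm N \<phi>" unfolding test_seminorm_def by (intro sum_nonneg) (auto simp: *)
  show "test_seminorm N \<phi> \<le> test_seminorm N' \<phi>" unfolding test_seminorm_def
    by (rule sum_mono2[OF finite_multi_index]) (use assms(2) * in auto)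
qed

lemma distributions_bound:
  assumes "u \<in> distributions" "compact C"
  shows "\<exists>c N. \<forall>\<phi>\<in>test_functions C. \<bar>u \<phi>\<bar> \<le> c * test_seminorm N \<phi>"
  using assms by (simp add: distributions_def test_seminorm_def)

lemma distributions_lincomb:
  assumes u: "u \<in> distributions" and v: "v \<in> distributions"
  shows "(\<lambda>\<phi>. a * u \<phi> + b * v \<phi>) \<in> distributions"
  unfolding distributions_def test_seminorm_def[symmetric]
proof (intro CollectI conjI allI impI ballI)
  fix \<phi> \<psi> and c d :: real
  assume "\<phi> \<in> test_functions UNIV" "\<psi> \<in> test_functions UNIV"
  then show "a * u (\<lambda>p. c * \<phi> p + d * \<psi> p) + b * v (\<lambda>p. c * \<phi> p + d * \<psi> p) =
      c * (a * u \<phi> + b * v \<phi>) + d * (a * u \<psi> + b * v \<psi>)"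
    using u v by (simp add: distributions_def algebra_simps)
next
  fix C :: "plane set" assume C: "compact C"
  obtain c N where 1: "\<And>\<phi>. \<phi> \<in> test_functions C \<Longrightarrow> \<bar>u \<phi>\<bar> \<le> c * test_seminorm N \<phi>"
    using distributions_bound[OF u C] by blast
  obtain d N' where 2: "\<And>\<phi>. \<phi> \<in> test_functions C \<Longrightarrow> \<bar>v \<phi>\<bar> \<le> d * test_seminorm N' \<phi>"
    using distributions_bound[OF v C] by blast
  have "\<bar>a * u \<phi> + b * v \<phi>\<bar> \<le> (\<bar>a\<bar> * \<bar>c\<bar> + \<bar>b\<bar> * \<bar>d\<bar>) * test_seminorm (max N N') \<phi>"
    if \<phi>: "\<phi> \<in> test_functions C" for \<phi>
  proof -
    have "\<bar>e * w\<bar> \<le> \<bar>e\<bar> * \<bar>k\<bar> * test_seminorm (max N N') \<phi>"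
      if "\<bar>w\<bar> \<le> k * test_seminorm M \<phi>" "M \<le> max N N'" for e w k M
    proof -
      have "k * test_seminorm M \<phi> \<le> \<bar>k\<bar> * test_seminorm (max N N') \<phi>"
        using test_seminorm_mono[OF \<phi> that(2)] by (intro mult_mono) auto
      with that(1) have "\<bar>w\<bar> \<le> \<bar>k\<bar> * test_seminorm (max N N') \<phi>" by linarith
      then show ?thesis unfolding abs_mult mult.assoc by (intro mult_left_mono) auto
    qed
    from this[OF 1[OF \<phi>], of a] this[OF 2[OF \<phi>], of b] show ?thesis
      by (simp add: distrib_right order_trans[OF abs_triangle_ineq add_mono])
  qed
  then show "\<exists>c N. \<forall>\<phi>\<in>test_functions C. \<bar>a * u \<phi> + b * v \<phi>\<bar> \<le> c * test_seminorm N \<phi>"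
    by blast
qed (use u v in \<open>auto simp: distributions_def\<close>)

lemma distr_of_measure_lincomb:
  assumes m: "m1 \<in> signed_measures" "m2 \<in> signed_measures"
  shows "distr_of_measure (\<lambda>A. a * m1 A + b * m2 A) = (\<lambda>\<phi>. a * distr_of_measure m1 \<phi> + b * distr_of_measure m2 \<phi>)"
  using signed_integral_measure_lincomb[OF m bounded_borel_test] by (auto simp: distr_of_measure_def fun_eq_iff)

lemma derivative_lincomb:
  "D1 (\<lambda>\<phi>. a * f \<phi> + b * g \<phi>) = (\<lambda>\<phi>. a * D1 f \<phi> + b * D1 g \<phi>)"
  "D2 (\<lambda>\<phi>. a * f \<phi> + b * g \<phi>) = (\<lambda>\<phi>. a * D2 f \<phi> + b * D2 g \<phi>)"
  "D12 (\<lambda>\<phi>. a * f \<phi> + b * g \<phi>) = (\<lambda>\<phi>. a * D12 f \<phi> + b * D12 g \<phi>)"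
  by (auto simp: D12_def D1_def D2_def fun_eq_iff)

section \<open>Product test functions\<close>

definition tensor :: "(real \<Rightarrow> real) \<Rightarrow> (real \<Rightarrow> real) \<Rightarrow> plane \<Rightarrow> real" where
  "tensor p q = (\<lambda>(x, y). p x * q y)"

lemma partial_tensor:
  assumes "\<And>x. (p has_real_derivative p' x) (at x)"
  shows "partial1 (tensor p q) = tensor p' q" and "partial2 (tensor q p) = tensor q p'"
proof -
  have "((\<lambda>t. p t * q y) has_real_derivative p' x * q y) (at x)"
       "((\<lambda>t. q y * p t) has_real_derivative q y * p' x) (at x)" for x y
    using assms[of x] by (auto intro!: derivative_eq_intros)
  then show "partial1 (tensor p q) = tensor p' q" "partial2 (tensor q p) = tensor q p'"
    by (auto simp: partial1_def partial2_def tensor_def fun_eq_iff dest!: DERIV_imp_deriv)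
qed

lemma smooth_tensor:
  assumes "smooth_real p" "smooth_real q"
  shows "smooth (tensor p q)"
  unfolding smooth_def
proof
  fix k show "C_diff k (tensor p q)"
    using assms
  proof (induction k arbitrary: p q)
    case 0
    have "continuous_on UNIV p" "continuous_on UNIV q"
      using smooth_real_deriv(1) 0 DERIV_isCont by (auto intro!: continuous_at_imp_continuous_on) blast+
    then show ?case
      by (auto simp: tensor_def case_prod_unfold intro!: continuous_intros continuous_on_compose2[of UNIV p] continuous_on_compose2[of UNIV q])
  next
    case (Suc k)
    note d = smooth_real_deriv[OF Suc.prems(1)] smooth_real_deriv[OF Suc.prems(2)]
    have "(\<lambda>t. p t * q y) differentiable at x" "(\<lambda>t. p x * q t) differentiable at y" for x y
      using d(1)[of x] d(3)[of y]
      by (auto intro!: derivative_intros simp: real_differentiable_def)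
    then show ?case
      using Suc.IH[of "deriv p" q] Suc.IH[of p "deriv q"] Suc.prems d
        partial_tensor(1)[of p "deriv p" q] partial_tensor(2)[of q "deriv q" p]
      by (simp add: tensor_def)
  qed
qed

definition smooth_supported :: "real \<Rightarrow> real \<Rightarrow> (real \<Rightarrow> real) \<Rightarrow> bool" where
  "smooth_supported a b p \<longleftrightarrow> smooth_real p \<and> (\<forall>x. x \<notin> {a..b} \<longrightarrow> p x = 0)"

lemma tensor_test:
  assumes "smooth_supported a b p" "smooth_supported c d q" "{a..b} \<times> {c..d} \<subseteq> \<Omega>"
  shows "tensor p q \<in> test_functions \<Omega>"
proof -
  have K: "compact ({a..b} \<times> {c..d})" by (intro compact_Times) auto
  have "tensor p q z = 0" if "z \<notin> {a..b} \<times> {c..d}" for z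
    using assms that by (cases z) (auto simp: smooth_supported_def tensor_def)
  from compact_tsupport[of _ "tensor p q", OF K this]
  show ?thesis
    using assms by (auto simp: test_functions_def smooth_supported_def smooth_tensor)
qed

text \<open>
  Smooth approximations, as \<open>n\<close> tends to infinity, of \<open>max 0 (x - c)\<close> and of its first two derivatives.
  The scale is \<^term>\<open>Suc n\<close>, to avoid a division by zero.
\<close>

definition ramp :: "nat \<Rightarrow> real \<Rightarrow> real \<Rightarrow> real" where
  "ramp n c x = smooth_ramp (real (Suc n) * x + - (real (Suc n) * c)) * (1 / real (Suc n))"

definition step :: "nat \<Rightarrow> real \<Rightarrow> real \<Rightarrow> real" where
  "step n c x = smooth_step (real (Suc n) * x + - (real (Suc n) * c))"

definition bump :: "nat \<Rightarrow> real \<Rightarrow> real \<Rightarrow> real" where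
  "bump n c x = smooth_bump (real (Suc n) * x + - (real (Suc n) * c)) * real (Suc n)"

lemma ramp_deriv: "(ramp n c has_real_derivative step n c x) (at x)"
  and step_deriv: "(step n c has_real_derivative bump n c x) (at x)"
proof -
  have a: "((\<lambda>x. real (Suc n) * x + - (real (Suc n) * c)) has_real_derivative real (Suc n)) (at x)"
    by (auto intro!: derivative_eq_intros)
  show "(step n c has_real_derivative bump n c x) (at x)"
    unfolding step_def bump_def by (rule DERIV_chain2[of smooth_step, OF smooth_step(4) a])
  have "((\<lambda>x. smooth_ramp (real (Suc n) * x + - (real (Suc n) * c)) * (1 / real (Suc n))) has_real_derivative
      smooth_step (real (Suc n) * x + - (real (Suc n) * c)) * real (Suc n) * (1 / real (Suc n))) (at x)"
    by (rule DERIV_cmult_right, rule DERIV_chain2[of smooth_ramp, OF smooth_ramp(3) a])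
  then show "(ramp n c has_real_derivative step n c x) (at x)"
    unfolding step_def ramp_def by simp
qed

lemma smooth_ramp_step_bump: "smooth_real (ramp n c)" "smooth_real (step n c)" "smooth_real (bump n c)"
  unfolding ramp_def step_def bump_def
  by (rule smooth_real_mult[OF smooth_real_affine[OF smooth_ramp(1)] smooth_real_const]
      smooth_real_affine[OF smooth_step(1)]
      smooth_real_mult[OF smooth_real_affine[OF smooth_bump(1)] smooth_real_const])+

lemma Suc_mult_diff: "real (Suc n) * x + - (real (Suc n) * c) = real (Suc n) * (x - c)" for x c :: real
  by (simp add: algebra_simps)

lemma scaled_ge_1: "c + 1 / real (Suc n) \<le> x \<Longrightarrow> 1 \<le> real (Suc n) * (x - c)" for x c :: real
  by (simp add: field_simps del: of_nat_Suc)

lemma step_left: "x \<le> c \<Longrightarrow> step n c x = 0"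
  and step_right: "c + 1 / real (Suc n) \<le> x \<Longrightarrow> step n c x = 1"
  and step_bounds: "0 \<le> step n c x" "step n c x \<le> 1"
  unfolding step_def Suc_mult_diff using scaled_ge_1[of c n x]
  by (auto simp: smooth_step_bounds mult_nonneg_nonpos simp del: of_nat_Suc intro!: smooth_step(2,3))

lemma bump_nonneg: "0 \<le> bump n c x" by (simp add: bump_def smooth_bump(2))

lemma bump_outside: "x \<notin> {c..c + 1 / real (Suc n)} \<Longrightarrow> bump n c x = 0"
proof -
  assume "x \<notin> {c..c + 1 / real (Suc n)}"
  then have "real (Suc n) * (x - c) \<notin> {0..1}"
    by (auto simp: field_simps zero_le_mult_iff simp del: of_nat_Suc)
  then show ?thesis unfolding bump_def Suc_mult_diff by (simp add: smooth_bump(3))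
qed

lemma step_tendsto: "(\<lambda>n. step n c x) \<longlonglongrightarrow> indicator {c<..} x"
proof (cases "c < x")
  case True
  have "(\<lambda>n. 1 / real (Suc n)) \<longlonglongrightarrow> (0::real)" by (rule LIMSEQ_Suc[OF lim_1_over_n])
  then have "\<forall>\<^sub>F n in sequentially. 1 / real (Suc n) < x - c" by (rule order_tendstoD) (use True in auto)
  then have "\<forall>\<^sub>F n in sequentially. step n c x = 1"
    by eventually_elim (intro step_right, linarith)
  then show ?thesis using True by (auto simp: tendsto_eventually)
qed (simp add: step_left)

lemma ramp_approx: "\<bar>ramp n c x - max 0 (x - c)\<bar> \<le> 1 / real (Suc n)"
proof -
  have "max 0 (real (Suc n) * (x - c)) = real (Suc n) * max 0 (x - c)"
    by (auto simp: max_def mult_le_0_iff zero_le_mult_iff simp del: of_nat_Suc)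
  then have "ramp n c x - max 0 (x - c) = (smooth_ramp (real (Suc n) * (x - c)) - max 0 (real (Suc n) * (x - c))) / real (Suc n)"
    unfolding ramp_def Suc_mult_diff by (simp add: field_simps del: of_nat_Suc)
  then show ?thesis
    using smooth_ramp_approx[of "real (Suc n) * (x - c)"] by (simp add: abs_divide divide_right_mono del: of_nat_Suc)
qed

lemma ramp_left: "x \<le> c \<Longrightarrow> ramp n c x = 0"
  unfolding ramp_def Suc_mult_diff
  by (simp add: smooth_ramp(2) mult_nonneg_nonpos del: of_nat_Suc)

lemma ramp_right: "c + 1 / real (Suc n) \<le> x \<Longrightarrow> ramp n c x = (smooth_ramp 1 - 1) / real (Suc n) + (x - c)"
  unfolding ramp_def Suc_mult_diff
  using smooth_ramp_affine[OF scaled_ge_1[of c n x]] by (simp add: field_simps del: of_nat_Suc)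

text \<open>
  Steps have no compact support, plateaus do. In the limit a plateau becomes the indicator function of
  \<^term>\<open>{a<..b}\<close>.
\<close>

definition plateau :: "nat \<Rightarrow> real \<Rightarrow> real \<Rightarrow> real \<Rightarrow> real" where
  "plateau n a b x = step n a x - step n b x"

lemma inverse_Suc_le_1: "1 / real (Suc n) \<le> 1" by simp

lemma smooth_supported_bump: "smooth_supported c (c + 1 / real (Suc n)) (bump n c)"
  using bump_outside by (simp add: smooth_supported_def smooth_ramp_step_bump)

lemma smooth_supported_plateau:
  assumes "a \<le> b" shows "smooth_supported a (b + 1) (plateau n a b)"
  unfolding smooth_supported_def
proof (intro conjI allI impI)
  show "smooth_real (plateau n a b)"
    unfolding plateau_def[abs_def] by (rule smooth_real_diff[OF smooth_ramp_step_bump(2,2)])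
  fix x assume "x \<notin> {a..b + 1}"
  then consider "x \<le> a" "x \<le> b" | "a + 1 / real (Suc n) \<le> x" "b + 1 / real (Suc n) \<le> x"
    using inverse_Suc_le_1[of n] assms by (fastforce simp del: of_nat_Suc)
  then show "plateau n a b x = 0"
    by cases (simp_all add: plateau_def step_left step_right)
qed

lemma plateau_deriv: "(plateau n a b has_real_derivative bump n a x - bump n b x) (at x)"
  unfolding plateau_def[abs_def] by (intro DERIV_diff step_deriv)

lemma plateau_bounded: "\<bar>plateau n a b x\<bar> \<le> 1"
  using step_bounds[of n a x] step_bounds[of n b x] by (simp add: plateau_def abs_le_iff)

lemma plateau_tendsto:
  assumes "a \<le> b" shows "(\<lambda>n. plateau n a b x) \<longlonglongrightarrow> indicator {a<..b} x"
proof -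
  have "(\<lambda>n. plateau n a b x) \<longlonglongrightarrow> indicator {a<..} x - indicator {b<..} x"
    unfolding plateau_def by (intro tendsto_diff step_tendsto)
  also have "indicator {a<..} x - indicator {b<..} x = (indicator {a<..b} x :: real)"
    using assms by (auto simp: indicator_def)
  finally show ?thesis .
qed

lemma borel_measurable_smooth: "smooth_real p \<Longrightarrow> p \<in> borel_measurable borel"
  by (intro borel_measurable_continuous_onI continuous_at_imp_continuous_on ballI DERIV_isCont)
     (rule smooth_real_deriv)

lemma borel_measurable_tensor:
  assumes "p \<in> borel_measurable borel" "q \<in> borel_measurable borel"
  shows "tensor p q \<in> borel_measurable borel"
  unfolding tensor_def borel_prod[symmetric] case_prod_unfold using assms by measurable

lemma plateau_measurable: "a \<le> b \<Longrightarrow> plateau n a b \<in> borel_measurable borel"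
  using smooth_supported_plateau borel_measurable_smooth by (simp add: smooth_supported_def)

lemma tensor_indicator: "tensor (indicator A) (indicator B) = indicator (A \<times> B)"
  by (auto simp: tensor_def fun_eq_iff indicator_def)

lemma tensor_plateau_tendsto:
  assumes m: "m \<in> signed_measures" and ab: "a \<le> b" "c \<le> d"
  shows "(\<lambda>n. signed_integral m (tensor (plateau n a b) (plateau n c d))) \<longlonglongrightarrow> m ({a<..b} \<times> {c<..d})"
proof -
  have "(\<lambda>n. signed_integral m (tensor (plateau n a b) (plateau n c d)))
      \<longlonglongrightarrow> signed_integral m (tensor (indicator {a<..b}) (indicator {c<..d}))"
  proof (rule signed_integral_tendsto[where X=UNIV and B="1 * 1"])
    show "\<bar>tensor (plateau n a b) (plateau n c d) p\<bar> \<le> 1 * 1" for n p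
      unfolding tensor_def case_prod_unfold abs_mult by (intro mult_mono plateau_bounded) auto
    show "(\<lambda>n. tensor (plateau n a b) (plateau n c d) p) \<longlonglongrightarrow> tensor (indicator {a<..b}) (indicator {c<..d}) p" for p
      unfolding tensor_def case_prod_unfold using ab by (intro tendsto_mult plateau_tendsto)
  qed (use m ab in \<open>auto simp: signed_measures_on_def signed_measure_empty intro!: borel_measurable_tensor plateau_measurable\<close>)
  then show ?thesis
    using m by (simp add: tensor_indicator signed_integral_indicator borel_Times)
qed

text \<open>
  Products of plateaus read off the values of a signed measure on boxes. Consequently \<^const>\<open>norm_M\<close> can be
  computed from the signed measure that represents the distribution.
\<close>

lemma distr_of_measure_inj: "inj_on distr_of_measure signed_measures"
proof (rule inj_onI)
  fix m m' assume m: "m \<in> signed_measures" "m' \<in> signed_measures"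
    and eq: "distr_of_measure m = distr_of_measure m'"
  show "m = m'"
  proof (rule signed_measures_eqI[OF m])
    fix a b c d :: real assume ab: "a \<le> b" "c \<le> d"
    have "signed_integral m \<phi> = signed_integral m' \<phi>" if "\<phi> \<in> test_functions UNIV" for \<phi>
      using fun_cong[OF eq, of \<phi>] that by (simp add: distr_of_measure_def)
    moreover have "tensor (plateau n a b) (plateau n c d) \<in> test_functions UNIV" for n
      by (rule tensor_test[OF smooth_supported_plateau[OF ab(1)] smooth_supported_plateau[OF ab(2)]]) simp
    ultimately have "(\<lambda>n. signed_integral m (tensor (plateau n a b) (plateau n c d))) \<longlonglongrightarrow> m' ({a<..b} \<times> {c<..d})"
      using tensor_plateau_tendsto[OF m(2) ab] by simp
    then show "m ({a<..b} \<times> {c<..d}) = m' ({a<..b} \<times> {c<..d})"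
      using tensor_plateau_tendsto[OF m(1) ab] LIMSEQ_unique by blast
  qed
qed

lemma measure_of_distr_of_measure:
  "m \<in> signed_measures \<Longrightarrow> measure_of_distr (distr_of_measure m) = m"
  unfolding measure_of_distr_def by (rule the_inv_into_f_f[OF distr_of_measure_inj])

lemma norm_M_distr_of_measure:
  "m \<in> signed_measures \<Longrightarrow> norm_M (distr_of_measure m) = total_variation m"
  by (simp add: norm_M_def measure_of_distr_of_measure)

section \<open>Distributions whose mixed derivative is a measure on the unit square\<close>

lemma distribution_lincomb:
  assumes "f \<in> distributions" "\<phi> \<in> test_functions UNIV" "\<psi> \<in> test_functions UNIV"
  shows "f (\<lambda>p. a * \<phi> p + b * \<psi> p) = a * f \<phi> + b * f \<psi>"
  using assms by (simp add: distributions_def)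

lemma distribution_tensor_diff:
  assumes f: "f \<in> distributions"
    and p: "smooth_supported a b p" "smooth_supported a' b' p'" and q: "smooth_supported c d q"
  shows "f (tensor (\<lambda>x. p x - p' x) q) = f (tensor p q) - f (tensor p' q)"
    and "f (tensor q (\<lambda>x. p x - p' x)) = f (tensor q p) - f (tensor q p')"
proof -
  have t: "tensor (\<lambda>x. p x - p' x) q = (\<lambda>z. 1 * tensor p q z + (-1) * tensor p' q z)"
    "tensor q (\<lambda>x. p x - p' x) = (\<lambda>z. 1 * tensor q p z + (-1) * tensor q p' z)"
    by (auto simp: tensor_def fun_eq_iff algebra_simps)
  show "f (tensor (\<lambda>x. p x - p' x) q) = f (tensor p q) - f (tensor p' q)"
    unfolding t by (subst distribution_lincomb[OF f tensor_test[OF p(1) q] tensor_test[OF p(2) q]]) auto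
  show "f (tensor q (\<lambda>x. p x - p' x)) = f (tensor q p) - f (tensor q p')"
    unfolding t by (subst distribution_lincomb[OF f tensor_test[OF q p(1)] tensor_test[OF q p(2)]]) auto
qed

text \<open>
  Used throughout to complete a primitive to a compactly supported function: the correction is placed
  outside the unit square, where \<open>f\<close> does not see it.
\<close>

lemma M_DD0_vanishes:
  assumes f: "f \<in> M_DD0" and pq: "smooth_supported a b p" "smooth_supported c d q"
    and out: "b < 0 \<or> 1 < a \<or> d < 0 \<or> 1 < c"
  shows "f (tensor p q) = 0"
proof -
  have "{a..b} \<times> {c..d} \<subseteq> - unit_square" using out by (auto simp: unit_square_def)
  then show ?thesis using f tensor_test[OF pq] by (auto simp: M_DD0_def)
qed

lemma smooth_supported_deriv:
  assumes "smooth_supported a b p" "\<And>x. (p has_real_derivative p' x) (at x)"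
  shows "smooth_supported a b p'"
proof -
  have "p' = deriv p" using assms(2) by (auto simp: fun_eq_iff intro: DERIV_imp_deriv[symmetric])
  moreover have "deriv p x = 0" if "x \<notin> {a..b}" for x
  proof -
    have "(p has_real_derivative 0) (at x)"
      by (rule has_field_derivative_transform_within_open[of "\<lambda>_. 0" _ _ "- {a..b}"])
         (use assms that in \<open>auto simp: smooth_supported_def open_Compl\<close>)
    then show ?thesis by (rule DERIV_imp_deriv)
  qed
  ultimately show ?thesis
    using assms(1) smooth_real_deriv(2) by (simp add: smooth_supported_def)
qed

lemma D12_tensor:
  assumes "D12 f = distr_of_measure m"
    and p: "smooth_supported a b p" "\<And>x. (p has_real_derivative p' x) (at x)"
    and q: "smooth_supported c d q" "\<And>x. (q has_real_derivative q' x) (at x)"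
  shows "f (tensor p' q') = signed_integral m (tensor p q)"
proof -
  have "tensor p q \<in> test_functions UNIV" "tensor p' q \<in> test_functions UNIV"
    using tensor_test[OF p(1) q(1)] tensor_test[OF smooth_supported_deriv[OF p] q(1)] by auto
  then have "D12 f (tensor p q) = f (tensor p' q')"
    using partial_tensor(1)[of p p' q, OF p(2)] partial_tensor(2)[of q q' p', OF q(2)]
    by (simp add: D12_def D1_def D2_def)
  moreover have "D12 f (tensor p q) = signed_integral m (tensor p q)"
    using \<open>tensor p q \<in> _\<close> assms(1) by (simp add: distr_of_measure_def)
  ultimately show ?thesis by simp
qed

lemma M_DD0_distribution: "f \<in> M_DD0 \<Longrightarrow> f \<in> distributions" by (simp add: M_DD0_def)

text \<open>
  Testing \<open>f\<close> against a product of narrow bumps reads off its value at a point. A primitive of a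
  bump is not compactly supported; it is made so by a second bump placed at \<open>3\<close>, which \<open>f\<close> does
  not see. Hence the value is the mass of the quadrant beyond the point.
\<close>

lemma bump_tensor_eq:
  assumes f: "f \<in> M_DD0" and D12: "D12 f = distr_of_measure m" and ab: "a \<le> 3" "b \<le> 3"
  shows "f (tensor (bump n a) (bump n b)) = signed_integral m (tensor (plateau n a 3) (plateau n b 3))"
proof -
  note d = M_DD0_distribution[OF f]
  note B = smooth_supported_bump[of _ n]
  note P = smooth_supported_deriv[OF smooth_supported_plateau plateau_deriv]
  have "signed_integral m (tensor (plateau n a 3) (plateau n b 3))
      = f (tensor (\<lambda>x. bump n a x - bump n 3 x) (\<lambda>x. bump n b x - bump n 3 x))"
    using D12_tensor[OF D12 smooth_supported_plateau[OF ab(1)] plateau_deriv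
        smooth_supported_plateau[OF ab(2)] plateau_deriv] by simp
  also have "\<dots> = f (tensor (bump n a) (\<lambda>x. bump n b x - bump n 3 x))
      - f (tensor (bump n 3) (\<lambda>x. bump n b x - bump n 3 x))"
    by (rule distribution_tensor_diff(1)[OF d B B P[OF ab(2)]])
  also have "f (tensor (bump n 3) (\<lambda>x. bump n b x - bump n 3 x)) = 0"
    by (rule M_DD0_vanishes[OF f B P[OF ab(2)]]) simp
  also have "f (tensor (bump n a) (\<lambda>x. bump n b x - bump n 3 x))
      = f (tensor (bump n a) (bump n b)) - f (tensor (bump n a) (bump n 3))"
    by (rule distribution_tensor_diff(2)[OF d B B B])
  also have "f (tensor (bump n a) (bump n 3)) = 0"
    by (rule M_DD0_vanishes[OF f B B]) simp
  finally show ?thesis by simp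
qed

lemma bump_tensor_tendsto:
  assumes "f \<in> M_DD0" "m \<in> signed_measures" "D12 f = distr_of_measure m" "a \<le> 3" "b \<le> 3"
  shows "(\<lambda>n. f (tensor (bump n a) (bump n b))) \<longlonglongrightarrow> m ({a<..3} \<times> {b<..3})"
  unfolding bump_tensor_eq[OF assms(1,3-5)] using assms by (intro tensor_plateau_tendsto)

lemma quadrant_nonneg:
  assumes f: "f \<in> M_DD0_pos" and m: "m \<in> signed_measures" "D12 f = distr_of_measure m"
    and ab: "a \<le> 3" "b \<le> 3"
  shows "0 \<le> m ({a<..3} \<times> {b<..3})"
proof (rule LIMSEQ_le_const)
  show "(\<lambda>n. f (tensor (bump n a) (bump n b))) \<longlonglongrightarrow> m ({a<..3} \<times> {b<..3})"
    using f m ab by (intro bump_tensor_tendsto) (auto simp: M_DD0_pos_def)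
  have "0 \<le> f (tensor (bump n a) (bump n b))" for n
  proof -
    have "tensor (bump n a) (bump n b) \<in> test_functions UNIV"
      by (rule tensor_test[OF smooth_supported_bump smooth_supported_bump]) simp
    moreover have "0 \<le> tensor (bump n a) (bump n b) p" for p
      by (simp add: tensor_def case_prod_unfold bump_nonneg)
    ultimately show ?thesis using f by (auto simp: M_DD0_pos_def)
  qed
  then show "\<exists>N. \<forall>n\<ge>N. 0 \<le> f (tensor (bump n a) (bump n b))" by blast
qed

text \<open>
  Here the bumps lie outside the square, where \<open>f\<close> vanishes. In this way the condition on the support of
  \<open>f\<close> becomes a condition on the marginals of \<open>m\<close>.
\<close>

lemma quadrant_zero:
  assumes f: "f \<in> M_DD0" and m: "m \<in> signed_measures" "D12 f = distr_of_measure m"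
    and ab: "a \<le> 3" "b \<le> 3" "a < 0 \<or> b < 0"
  shows "m ({a<..3} \<times> {b<..3}) = 0"
proof (rule LIMSEQ_unique)
  show "(\<lambda>n. f (tensor (bump n a) (bump n b))) \<longlonglongrightarrow> m ({a<..3} \<times> {b<..3})"
    by (rule bump_tensor_tendsto[OF f m ab(1,2)])
  have lim: "(\<lambda>n. 1 / real (Suc n)) \<longlonglongrightarrow> 0" by (rule LIMSEQ_Suc[OF lim_1_over_n])
  have "\<forall>\<^sub>F n in sequentially. 1 / real (Suc n) < max (- a) (- b)"
    by (rule order_tendstoD[OF lim]) (use ab in auto)
  then have "\<forall>\<^sub>F n in sequentially. f (tensor (bump n a) (bump n b)) = 0"
  proof eventually_elim
    case (elim n)
    then have "a + 1 / real (Suc n) < 0 \<or> b + 1 / real (Suc n) < 0" by linarith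
    then show ?case by (intro M_DD0_vanishes[OF f smooth_supported_bump smooth_supported_bump]) auto
  qed
  then show "(\<lambda>n. f (tensor (bump n a) (bump n b))) \<longlonglongrightarrow> 0" by (rule tendsto_eventually)
qed

section \<open>Lower bounds for the norms of the first derivatives\<close>

text \<open>
  A primitive of a plateau, made compactly supported by subtracting its translate by \<open>3\<close>. For
  \<open>c > - 2\<close> the translated plateau vanishes on the unit interval.
\<close>

definition antiplateau :: "nat \<Rightarrow> real \<Rightarrow> real \<Rightarrow> real \<Rightarrow> real" where
  "antiplateau n c d y = (ramp n c y - ramp n d y) - (ramp n (c + 3) y - ramp n (d + 3) y)"

text \<open>The limit of \<^const>\<open>antiplateau\<close>. If \<open>c > - 2\<close>, only the first difference is seen on the unit interval.\<close>

definition trapezoid :: "real \<Rightarrow> real \<Rightarrow> real \<Rightarrow> real" where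
  "trapezoid c d y = (max 0 (y - c) - max 0 (y - d)) - (max 0 (y - (c + 3)) - max 0 (y - (d + 3)))"

lemma antiplateau_deriv:
  "(antiplateau n c d has_real_derivative plateau n c d y - plateau n (c + 3) (d + 3) y) (at y)"
  unfolding antiplateau_def[abs_def] plateau_def by (intro DERIV_diff ramp_deriv)

lemma smooth_supported_antiplateau:
  assumes "c \<le> d" shows "smooth_supported c (d + 4) (antiplateau n c d)"
  unfolding smooth_supported_def
proof (intro conjI allI impI)
  show "smooth_real (antiplateau n c d)"
    unfolding antiplateau_def[abs_def]
    by (rule smooth_real_diff[OF smooth_real_diff smooth_real_diff,
          OF smooth_ramp_step_bump(1,1) smooth_ramp_step_bump(1,1)])
  fix x assume "x \<notin> {c..d + 4}"
  then consider "x \<le> c" | "d + 4 \<le> x" by fastforce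
  then show "antiplateau n c d x = 0"
  proof cases
    case 1 then show ?thesis using assms by (simp add: antiplateau_def ramp_left)
  next
    case 2
    then have "ramp n e x = (smooth_ramp 1 - 1) / real (Suc n) + (x - e)" if "e \<le> d + 3" for e
      using that inverse_Suc_le_1[of n] by (intro ramp_right) linarith
    then show ?thesis using assms by (simp add: antiplateau_def)
  qed
qed

lemma antiplateau_approx: "\<bar>antiplateau n c d y - trapezoid c d y\<bar> \<le> 4 / real (Suc n)"
  using ramp_approx[of n c y] ramp_approx[of n d y] ramp_approx[of n "c + 3" y] ramp_approx[of n "d + 3" y]
  unfolding antiplateau_def trapezoid_def by (simp add: abs_le_iff del: of_nat_Suc)

lemma antiplateau_tendsto: "(\<lambda>n. antiplateau n c d y) \<longlonglongrightarrow> trapezoid c d y"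
proof (rule LIM_zero_cancel, rule Lim_null_comparison)
  show "\<forall>\<^sub>F n in sequentially. norm (antiplateau n c d y - trapezoid c d y) \<le> 4 * (1 / real (Suc n))"
    using antiplateau_approx by simp
  show "(\<lambda>n. 4 * (1 / real (Suc n))) \<longlonglongrightarrow> 0"
    by (rule tendsto_mult_right_zero[OF LIMSEQ_Suc[OF lim_1_over_n]])
qed

lemma trapezoid_bounded: "c \<le> d \<Longrightarrow> \<bar>trapezoid c d y\<bar> \<le> 2 * (d - c)"
  by (auto simp: trapezoid_def max_def abs_le_iff)

lemma antiplateau_bounded:
  assumes "c \<le> d" shows "\<bar>antiplateau n c d y\<bar> \<le> 2 * (d - c) + 4"
proof -
  have "4 / real (Suc n) \<le> 4" by (simp add: field_simps)
  then show ?thesis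
    using antiplateau_approx[of n c d y] trapezoid_bounded[OF assms, of y] by linarith
qed

text \<open>
  Differentiating the first plateau passes from \<open>\<mu>\<close> to \<open>f\<close>. The second plateau is the derivative of the
  antiplateau up to a part that \<open>f\<close> does not see, and so the mixed derivative \<open>m\<close> appears.
\<close>

lemma plateau_tensor_D1:
  assumes f: "f \<in> M_DD0" and m: "D12 f = distr_of_measure m" and \<mu>: "D1 f = distr_of_measure \<mu>"
    and ab: "a \<le> b" "c \<le> d" "- 2 < c"
  shows "signed_integral \<mu> (tensor (plateau n a b) (plateau n c d))
       = - signed_integral m (tensor (plateau n a b) (antiplateau n c d))"
proof -
  note P = smooth_supported_plateau[of _ _ n]
  note dP = smooth_supported_deriv[OF P plateau_deriv]
  have cd: "c + 3 \<le> d + 3" using ab by simp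
  have "tensor (plateau n a b) (plateau n c d) \<in> test_functions UNIV"
    by (rule tensor_test[OF P[OF ab(1)] P[OF ab(2)]]) simp
  then have "signed_integral \<mu> (tensor (plateau n a b) (plateau n c d))
      = - f (tensor (\<lambda>x. bump n a x - bump n b x) (plateau n c d))"
    using fun_cong[OF \<mu>, of "tensor (plateau n a b) (plateau n c d)"]
      partial_tensor(1)[OF plateau_deriv, of n a b "plateau n c d"]
    by (simp add: D1_def distr_of_measure_def)
  also have "f (tensor (\<lambda>x. bump n a x - bump n b x) (plateau n c d))
      = f (tensor (\<lambda>x. bump n a x - bump n b x) (\<lambda>y. plateau n c d y - plateau n (c + 3) (d + 3) y))"
    using distribution_tensor_diff(2)[OF M_DD0_distribution[OF f] P[OF ab(2)] P[OF cd] dP[OF ab(1)]]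
      M_DD0_vanishes[OF f dP[OF ab(1)] P[OF cd]] ab(3) by simp
  also have "\<dots> = signed_integral m (tensor (plateau n a b) (antiplateau n c d))"
    by (rule D12_tensor[OF m P[OF ab(1)] plateau_deriv smooth_supported_antiplateau[OF ab(2)] antiplateau_deriv])
  finally show ?thesis .
qed

lemma plateau_tensor_D2:
  assumes f: "f \<in> M_DD0" and m: "D12 f = distr_of_measure m" and \<mu>: "D2 f = distr_of_measure \<mu>"
    and ab: "a \<le> b" "c \<le> d" "- 2 < c"
  shows "signed_integral \<mu> (tensor (plateau n c d) (plateau n a b))
       = - signed_integral m (tensor (antiplateau n c d) (plateau n a b))"
proof -
  note P = smooth_supported_plateau[of _ _ n]
  note dP = smooth_supported_deriv[OF P plateau_deriv]
  have cd: "c + 3 \<le> d + 3" using ab by simp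
  have "tensor (plateau n c d) (plateau n a b) \<in> test_functions UNIV"
    by (rule tensor_test[OF P[OF ab(2)] P[OF ab(1)]]) simp
  then have "signed_integral \<mu> (tensor (plateau n c d) (plateau n a b))
      = - f (tensor (plateau n c d) (\<lambda>x. bump n a x - bump n b x))"
    using fun_cong[OF \<mu>, of "tensor (plateau n c d) (plateau n a b)"]
      partial_tensor(2)[OF plateau_deriv, of "plateau n c d" n a b]
    by (simp add: D2_def distr_of_measure_def)
  also have "f (tensor (plateau n c d) (\<lambda>x. bump n a x - bump n b x))
      = f (tensor (\<lambda>y. plateau n c d y - plateau n (c + 3) (d + 3) y) (\<lambda>x. bump n a x - bump n b x))"
    using distribution_tensor_diff(1)[OF M_DD0_distribution[OF f] P[OF ab(2)] P[OF cd] dP[OF ab(1)]]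
      M_DD0_vanishes[OF f P[OF cd] dP[OF ab(1)]] ab(3) by simp
  also have "\<dots> = signed_integral m (tensor (antiplateau n c d) (plateau n a b))"
    by (rule D12_tensor[OF m smooth_supported_antiplateau[OF ab(2)] antiplateau_deriv P[OF ab(1)] plateau_deriv])
  finally show ?thesis .
qed

text \<open>
  Node \<open>0\<close> lies one mesh width to the left of the unit interval, so that the mass on the left and lower edges
  of the square also lies in a cell and so that quadrant masses vanish at both ends of the range of indices.
\<close>

definition node :: "nat \<Rightarrow> nat \<Rightarrow> real" where
  "node N i = (real i - 1) / real N"

definition cell :: "nat \<Rightarrow> nat \<Rightarrow> nat \<Rightarrow> plane set" where
  "cell N i j = {node N i<..node N (Suc i)} \<times> {node N j<..node N (Suc j)}"

lemma node_mono: "i \<le> j \<Longrightarrow> node N i \<le> node N j"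
  by (simp add: node_def divide_right_mono)

lemma node_Suc: "node N (Suc i) = node N i + 1 / real N"
  by (simp add: node_def add_divide_distrib[symmetric])

lemma node_disjoint:
  assumes "x \<in> {node N i<..node N (Suc i)}" "x \<in> {node N j<..node N (Suc j)}"
  shows "i = j"
proof (rule ccontr)
  assume "i \<noteq> j"
  then have "Suc i \<le> j \<or> Suc j \<le> i" by auto
  then show False using assms node_mono[of "Suc i" j N] node_mono[of "Suc j" i N] by auto
qed

lemma cell_borel: "cell N i j \<in> sets borel"
  unfolding cell_def by (intro borel_Times) auto

lemma cell_disjoint: "disjoint_family_on (\<lambda>(i, j). cell N i j) I"
  unfolding disjoint_family_on_def cell_def using node_disjoint by fastforce

lemma node_bounds:
  assumes "0 < N" "i \<le> Suc N" shows "- 1 \<le> node N i" "node N i \<le> 1"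
  using assms by (auto simp: node_def field_simps)

text \<open>
  If \<open>\<mu>\<close> is the derivative in \<open>x\<close> of a distribution with mixed derivative \<open>m\<close>, then \<open>\<mu>\<close> of a cell is, up to
  sign, the integral over the heights \<open>y\<close> in the cell of the mass that \<open>m\<close> gives to the part of the column
  above \<open>y\<close>. Replacing that mass by the mass above the lower edge of the cell costs at most the variation of
  \<open>m\<close> on the cell, times the height \<open>1 / N\<close>. Summed over all cells, the error is a constant over \<open>N\<close>.
\<close>

lemma strip_sum_le_total_variation:
  assumes m: "m \<in> signed_measures_on unit_square" and \<mu>: "\<mu> \<in> signed_measures"
    and eq: "\<And>n a b c d. a \<le> b \<Longrightarrow> c \<le> d \<Longrightarrow> - 2 < c \<Longrightarrow>
        signed_integral \<mu> (tensor (plateau n a b) (plateau n c d))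
      = - signed_integral m (tensor (plateau n a b) (antiplateau n c d))"
    and N: "0 < N"
  shows "ennreal (\<Sum>(i, j)\<in>{..N} \<times> {..N}. \<bar>m ({node N i<..node N (Suc i)} \<times> {node N j<..3})\<bar> / N)
       \<le> total_variation \<mu> + ennreal (variation_measure m UNIV / N)"
proof -
  have ms: "m \<in> signed_measures" using m by (simp add: signed_measures_on_def)
  have sq: "unit_square \<in> sets borel" unfolding unit_square_def by (intro borel_Times) auto
  define h where "h = 1 / real N"
  have h: "0 < h" using N by (simp add: h_def)
  have \<mu>_eq: "\<mu> ({a<..b} \<times> {c<..d}) = - signed_integral m (tensor (indicator {a<..b}) (trapezoid c d))"
    if ab: "a \<le> b" "c \<le> d" "- 2 < c" for a b c d
  proof (rule LIMSEQ_unique)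
    show "(\<lambda>n. signed_integral \<mu> (tensor (plateau n a b) (plateau n c d))) \<longlonglongrightarrow> \<mu> ({a<..b} \<times> {c<..d})"
      by (rule tensor_plateau_tendsto[OF \<mu> ab(1,2)])
    have meas: "trapezoid c d \<in> borel_measurable borel"
      unfolding trapezoid_def[abs_def] by measurable
    have "antiplateau n c d \<in> borel_measurable borel" for n
      using smooth_supported_antiplateau[OF ab(2)] borel_measurable_smooth by (simp add: smooth_supported_def)
    moreover have "\<bar>tensor (plateau n a b) (antiplateau n c d) p\<bar> \<le> 1 * (2 * (d - c) + 4)" for n p
      unfolding tensor_def case_prod_unfold abs_mult
      by (intro mult_mono plateau_bounded antiplateau_bounded ab) auto
    ultimately show "(\<lambda>n. signed_integral \<mu> (tensor (plateau n a b) (plateau n c d)))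
        \<longlonglongrightarrow> - signed_integral m (tensor (indicator {a<..b}) (trapezoid c d))"
      unfolding eq[OF ab]
      by (intro tendsto_minus signed_integral_tendsto[OF m sq, where B="1 * (2 * (d - c) + 4)"]
          borel_measurable_tensor plateau_measurable ab meas)
         (auto simp: tensor_def intro!: tendsto_mult plateau_tendsto antiplateau_tendsto ab)
  qed
  have cell_le: "\<bar>m ({node N i<..node N (Suc i)} \<times> {node N j<..3})\<bar> / N
      \<le> \<bar>\<mu> (cell N i j)\<bar> + h * variation_measure m (cell N i j)"
    if ij: "i \<le> N" "j \<le> N" for i j
  proof -
    let ?a = "node N i" and ?b = "node N (Suc i)" and ?c = "node N j" and ?d = "node N (Suc j)"
    have bds: "?a \<le> ?b" "?c \<le> ?d" "-2 < ?c" "?d \<le> 1" "?d = ?c + h"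
      using node_mono[of i "Suc i" N] node_mono[of j "Suc j" N] node_bounds[OF N, of j]
        node_bounds[OF N, of "Suc j"] ij by (auto simp: node_Suc h_def)
    let ?S = "{?a<..?b} \<times> {?c<..3::real}"
    let ?T = "tensor (indicator {?a<..?b}) (trapezoid ?c ?d)"
    have S: "?S \<in> sets borel" by (intro borel_Times) auto
    have "trapezoid ?c ?d \<in> borel_measurable borel" unfolding trapezoid_def[abs_def] by measurable
    then have T: "bounded_borel ?T"
    proof (intro bounded_borelI[where B="1 * (2 * (?d - ?c))"] borel_measurable_tensor)
      show "\<bar>?T p\<bar> \<le> 1 * (2 * (?d - ?c))" for p
        unfolding tensor_def case_prod_unfold abs_mult
        by (intro mult_mono trapezoid_bounded bds) (auto simp: indicator_def)
    qed auto
    \<comment> \<open>On the unit square, \<open>?T\<close> agrees with \<open>h\<close> times the indicator of \<open>?S\<close> except on the cell.\<close>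
    have "\<bar>signed_integral m (\<lambda>p. h * indicator ?S p + (-1) * ?T p)\<bar> \<le> h * variation_measure m (cell N i j)"
    proof (rule signed_integral_abs_le[OF m sq _ cell_borel])
      show "bounded_borel (\<lambda>p. h * indicator ?S p + (-1) * ?T p)"
        by (intro bounded_borel_add bounded_borel_cmult bounded_borel_indicator S T)
      fix p assume "p \<in> unit_square"
      then obtain x y where p: "p = (x, y)" "y \<le> 1" by (auto simp: unit_square_def)
      show "\<bar>h * indicator ?S p + (-1) * ?T p\<bar> \<le> h * indicator (cell N i j) p"
        using p bds h by (auto simp: tensor_def cell_def indicator_def trapezoid_def max_def)
    qed
    moreover have "signed_integral m (\<lambda>p. h * indicator ?S p + (-1) * ?T p) = h * m ?S + \<mu> (cell N i j)"
      using signed_integral_lincomb[OF ms bounded_borel_indicator[OF S] T, of h "-1"]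
        signed_integral_indicator[OF ms S] \<mu>_eq[OF bds(1-3)] by (simp add: cell_def)
    ultimately have "\<bar>h * m ?S + \<mu> (cell N i j)\<bar> \<le> h * variation_measure m (cell N i j)" by simp
    moreover have "h * \<bar>m ?S\<bar> = \<bar>h * m ?S\<bar>" using h by (simp add: abs_mult)
    ultimately have "h * \<bar>m ?S\<bar> \<le> \<bar>\<mu> (cell N i j)\<bar> + h * variation_measure m (cell N i j)" by linarith
    then show ?thesis by (simp add: h_def)
  qed
  let ?I = "{..N} \<times> {..N}"
  have "(\<Sum>(i, j)\<in>?I. \<bar>m ({node N i<..node N (Suc i)} \<times> {node N j<..3})\<bar> / N)
      \<le> (\<Sum>(i, j)\<in>?I. \<bar>\<mu> (cell N i j)\<bar> + h * variation_measure m (cell N i j))"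
    by (rule sum_mono) (use cell_le in auto)
  also have "\<dots> = (\<Sum>(i, j)\<in>?I. \<bar>\<mu> (cell N i j)\<bar>) + h * (\<Sum>(i, j)\<in>?I. variation_measure m (cell N i j))"
    by (simp add: case_prod_unfold sum.distrib sum_distrib_left)
  also have "\<dots> \<le> (\<Sum>(i, j)\<in>?I. \<bar>\<mu> (cell N i j)\<bar>) + h * variation_measure m UNIV"
    using variation_measure_disjoint_le[OF ms _ _ cell_disjoint, of ?I N] h cell_borel
    by (auto simp: case_prod_unfold intro!: add_left_mono mult_left_mono)
  finally have "ennreal (\<Sum>(i, j)\<in>?I. \<bar>m ({node N i<..node N (Suc i)} \<times> {node N j<..3})\<bar> / N)
      \<le> ennreal ((\<Sum>(i, j)\<in>?I. \<bar>\<mu> (cell N i j)\<bar>) + h * variation_measure m UNIV)" by (rule ennreal_leI)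
  also have "\<dots> = ennreal (\<Sum>(i, j)\<in>?I. \<bar>\<mu> (cell N i j)\<bar>) + ennreal (h * variation_measure m UNIV)"
    using h by (intro ennreal_plus) (auto intro!: sum_nonneg simp: variation_measure_def)
  also have "\<dots> \<le> total_variation \<mu> + ennreal (h * variation_measure m UNIV)"
    using total_variation_ge_sum[OF \<mu> _ _ cell_disjoint, of ?I N] cell_borel
    by (auto simp: case_prod_unfold intro!: add_right_mono)
  finally show ?thesis by (simp add: h_def)
qed

text \<open>Exchanging the coordinates reduces the derivative in \<open>y\<close> to the derivative in \<open>x\<close>.\<close>

definition swapped :: "set_function \<Rightarrow> set_function" where
  "swapped m A = m (prod.swap -` A)"

lemma swap_vimage_borel: "prod.swap -` A \<in> sets borel \<longleftrightarrow> A \<in> sets (borel :: plane measure)"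
proof -
  have sw: "prod.swap \<in> measurable (borel :: plane measure) borel"
    by (intro borel_measurable_continuous_onI continuous_on_swap)
  have *: "prod.swap -` A \<in> sets borel" if "A \<in> sets (borel :: plane measure)" for A
    using measurable_sets[OF sw that] by simp
  have "prod.swap -` (prod.swap -` A) = A" by auto
  then show ?thesis using * by metis
qed

lemma swapped_signed_measure:
  assumes "m \<in> signed_measures" shows "swapped m \<in> signed_measures"
  unfolding signed_measures_def
proof (intro CollectI conjI allI impI)
  fix A :: "nat \<Rightarrow> plane set" assume A: "range A \<subseteq> sets borel" "disjoint_family A"
  have "range (\<lambda>i. prod.swap -` A i) \<subseteq> sets borel" using A(1) by (auto simp: swap_vimage_borel)
  moreover have "disjoint_family (\<lambda>i. prod.swap -` A i)" using A(2) by (rule disjoint_family_on_vimageI)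
  ultimately have "(\<lambda>i. m (prod.swap -` A i)) sums m (\<Union>i. prod.swap -` A i)"
    using assms unfolding signed_measures_def by blast
  then show "(\<lambda>i. swapped m (A i)) sums swapped m (\<Union>i. A i)" by (simp add: swapped_def vimage_UN)
qed (use assms in \<open>auto simp: swapped_def signed_measures_def swap_vimage_borel\<close>)

lemma swapped_on_unit_square:
  assumes m: "m \<in> signed_measures_on unit_square" shows "swapped m \<in> signed_measures_on unit_square"
proof -
  have "swapped m A = 0" if "A \<in> sets borel" "A \<inter> unit_square = {}" for A
  proof -
    have "prod.swap -` A \<inter> unit_square = {}" using that(2) by (auto simp: unit_square_def)
    then show ?thesis
      using m that(1) by (simp add: swapped_def signed_measures_on_def swap_vimage_borel)
  qed
  then show ?thesis using m swapped_signed_measure by (auto simp: signed_measures_on_def)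
qed

lemma signed_integral_swapped:
  assumes m: "m \<in> signed_measures" and \<phi>: "bounded_borel \<phi>"
  shows "signed_integral (swapped m) \<phi> = signed_integral m (\<lambda>p. \<phi> (prod.swap p))"
proof -
  have sw: "prod.swap \<in> measurable (borel :: plane measure) borel"
    by (intro borel_measurable_continuous_onI continuous_on_swap)
  define M where "M b = distr (jordan_pos (if b then m else (\<lambda>A. - m A))) borel prod.swap" for b
  define c where "c b = (if b then 1 else - 1 :: real)" for b
  have fb: "finite_borel (jordan_pos m)" "finite_borel (jordan_pos (\<lambda>A. - m A))"
    using m signed_measures_uminus by (auto intro: finite_borel_jordan_pos)
  have sw': "prod.swap \<in> measurable (jordan_pos k) borel" for k
    using sw by (simp cong: measurable_cong_sets)
  have Mfb: "finite_borel (M b)" for b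
    using fb sw' unfolding M_def finite_borel_def by (auto intro!: finite_measure.finite_measure_distr)
  have sp: "space (jordan_pos k) = UNIV" for k by (simp add: jordan_pos_eq)
  have "swapped m A = (\<Sum>b\<in>UNIV. c b * measure (M b) A)" if "A \<in> sets borel" for A
    using that jordan_decomposition[OF m, of "prod.swap -` A"] sw'
    by (simp add: UNIV_bool M_def c_def measure_distr sp swapped_def swap_vimage_borel)
  then have "signed_integral (swapped m) \<phi> = (\<Sum>b\<in>UNIV. c b * integral\<^sup>L (M b) \<phi>)"
    using Mfb \<phi> by (intro signed_integral_weighted_sum swapped_signed_measure m) auto
  also have "\<dots> = signed_integral m (\<lambda>p. \<phi> (prod.swap p))"
    using \<phi> sw' by (simp add: UNIV_bool M_def c_def integral_distr bounded_borel_def signed_integral_def)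
  finally show ?thesis .
qed

lemma total_variation_swapped_le: "total_variation (swapped m) \<le> total_variation m"
  unfolding total_variation_def[of "swapped m"]
proof (rule SUP_least)
  fix P assume "P \<in> {P. finite P \<and> P \<subseteq> sets borel \<and> partition_on (UNIV::plane set) P}"
  then have P: "finite P" "P \<subseteq> sets borel" "partition_on (UNIV::plane set) P" by auto
  let ?v = "\<lambda>A :: plane set. prod.swap -` A"
  have vv: "?v (?v A) = A" for A by auto
  then have inj: "inj_on ?v P" by (metis inj_onI)
  have "partition_on UNIV (?v ` P)"
  proof (rule partition_onI)
    show "\<Union> (?v ` P) = UNIV" using P(3) by (fastforce simp: partition_on_def)
    fix p q assume "p \<in> ?v ` P" "q \<in> ?v ` P" "p \<noteq> q"
    then obtain A B where "A \<in> P" "B \<in> P" "A \<noteq> B" "p = ?v A" "q = ?v B" by auto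
    moreover from this have "A \<inter> B = {}" using P(3) by (auto simp: partition_on_def disjoint_def)
    ultimately show "disjnt p q" by (auto simp: disjnt_def)
  next
    have "A = {}" if "?v A = {}" for A using vv[of A] that by simp
    moreover have "{} \<notin> P" using P(3) by (simp add: partition_on_def)
    ultimately show "{} \<notin> ?v ` P" by (metis imageE)
  qed
  moreover have "?v ` P \<subseteq> sets borel" using P(2) by (auto simp: swap_vimage_borel)
  ultimately have "(\<Sum>A\<in>?v ` P. ennreal \<bar>m A\<bar>) \<le> total_variation m"
    unfolding total_variation_def using P(1) by (intro SUP_upper) auto
  then show "(\<Sum>A\<in>P. ennreal \<bar>swapped m A\<bar>) \<le> total_variation m"
    using inj by (simp add: sum.reindex swapped_def del: sum_ennreal)
qed

lemma tensor_swap: "tensor p q (prod.swap z) = tensor q p z"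
  by (simp add: tensor_def case_prod_unfold)

lemma bounded_borel_tensor_supported:
  assumes "smooth_supported a b p" "smooth_supported c d q"
  shows "bounded_borel (tensor p q)"
  using tensor_test[OF assms subset_UNIV] by (rule bounded_borel_test)

lemma strip_sum_le_D1:
  assumes f: "f \<in> M_DD0" and m: "m \<in> signed_measures_on unit_square" "D12 f = distr_of_measure m" and N: "0 < N"
  shows "ennreal (\<Sum>(i, j)\<in>{..N} \<times> {..N}. \<bar>m ({node N i<..node N (Suc i)} \<times> {node N j<..3})\<bar> / N)
       \<le> norm_M (D1 f) + ennreal (variation_measure m UNIV / N)"
proof (cases "D1 f \<in> distr_of_measure ` signed_measures")
  case True
  then obtain \<mu> where \<mu>: "\<mu> \<in> signed_measures" "D1 f = distr_of_measure \<mu>" by blast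
  show ?thesis
    unfolding \<mu>(2) norm_M_distr_of_measure[OF \<mu>(1)]
    by (rule strip_sum_le_total_variation[OF m(1) \<mu>(1) plateau_tensor_D1[OF f m(2) \<mu>(2)] N])
qed (simp add: norm_M_def)

lemma strip_sum_le_D2:
  assumes f: "f \<in> M_DD0" and m: "m \<in> signed_measures_on unit_square" "D12 f = distr_of_measure m" and N: "0 < N"
  shows "ennreal (\<Sum>(i, j)\<in>{..N} \<times> {..N}. \<bar>m ({node N j<..3} \<times> {node N i<..node N (Suc i)})\<bar> / N)
       \<le> norm_M (D2 f) + ennreal (variation_measure (swapped m) UNIV / N)"
proof (cases "D2 f \<in> distr_of_measure ` signed_measures")
  case True
  then obtain \<mu> where \<mu>: "\<mu> \<in> signed_measures" "D2 f = distr_of_measure \<mu>" by blast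
  have ms: "m \<in> signed_measures" using m by (simp add: signed_measures_on_def)
  have "signed_integral (swapped \<mu>) (tensor (plateau n a b) (plateau n c d))
      = - signed_integral (swapped m) (tensor (plateau n a b) (antiplateau n c d))"
    if ab: "a \<le> b" "c \<le> d" "- 2 < c" for n a b c d
    using plateau_tensor_D2[OF f m(2) \<mu>(2) ab, of n]
    by (simp add: signed_integral_swapped[OF \<mu>(1) bounded_borel_tensor_supported[OF
            smooth_supported_plateau[OF ab(1)] smooth_supported_plateau[OF ab(2)]]]
          signed_integral_swapped[OF ms bounded_borel_tensor_supported[OF
            smooth_supported_plateau[OF ab(1)] smooth_supported_antiplateau[OF ab(2)]]] tensor_swap)
  then have "ennreal (\<Sum>(i, j)\<in>{..N} \<times> {..N}. \<bar>swapped m ({node N i<..node N (Suc i)} \<times> {node N j<..3})\<bar> / N)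
      \<le> total_variation (swapped \<mu>) + ennreal (variation_measure (swapped m) UNIV / N)"
    by (rule strip_sum_le_total_variation[OF swapped_on_unit_square[OF m(1)] swapped_signed_measure[OF \<mu>(1)] _ N])
  then have "ennreal (\<Sum>(i, j)\<in>{..N} \<times> {..N}. \<bar>swapped m ({node N i<..node N (Suc i)} \<times> {node N j<..3})\<bar> / N)
      \<le> total_variation \<mu> + ennreal (variation_measure (swapped m) UNIV / N)"
    by (rule order_trans) (intro add_right_mono total_variation_swapped_le)
  moreover have "prod.swap -` (A \<times> B) = B \<times> A" for A B :: "real set" by auto
  ultimately show ?thesis
    unfolding \<mu>(2) norm_M_distr_of_measure[OF \<mu>(1)] by (simp add: swapped_def)
qed (simp add: norm_M_def)

section \<open>Step functions on a grid\<close>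

text \<open>
  Length measure transported along a continuous curve \<open>\<gamma>\<close>. Straight curves give the derivatives of a
  step function, constant curves over \<open>{0..1}\<close> give Dirac masses.
\<close>

definition curve_measure :: "(real \<Rightarrow> plane) \<Rightarrow> real \<Rightarrow> real \<Rightarrow> plane measure" where
  "curve_measure \<gamma> a b = distr (restrict_space lborel {a..b}) borel \<gamma>"

lemma curve_measurable:
  assumes "continuous_on UNIV \<gamma>"
  shows "\<gamma> \<in> measurable (restrict_space lborel {a..b}) borel"
  using borel_measurable_continuous_onI[OF assms] by (intro measurable_restrict_space1) simp

lemma finite_borel_curve_measure:
  assumes "continuous_on UNIV \<gamma>"
  shows "finite_borel (curve_measure \<gamma> a b)"
proof -
  have "emeasure (restrict_space lborel {a..b}) {a..b} < \<infinity>"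
    by (subst emeasure_restrict_space) (auto simp: emeasure_lborel_Icc_eq)
  then have "finite_measure (restrict_space lborel {a..b})"
    by (intro finite_measureI) (auto simp: space_restrict_space)
  then show ?thesis
    unfolding finite_borel_def curve_measure_def
    by (auto intro!: finite_measure.finite_measure_distr curve_measurable assms)
qed

lemma measure_curve_measure_UNIV:
  assumes "continuous_on UNIV \<gamma>" "a \<le> b"
  shows "measure (curve_measure \<gamma> a b) UNIV = b - a"
proof -
  have "measure (curve_measure \<gamma> a b) UNIV = measure (restrict_space lborel {a..b}) {a..b}"
    unfolding curve_measure_def
    using curve_measurable[OF assms(1)] by (subst measure_distr) (auto simp: space_restrict_space)
  also have "\<dots> = b - a" using assms(2) by (subst measure_restrict_space) auto
  finally show ?thesis .
qed

lemma measure_curve_measure_eq_0: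
  assumes "continuous_on UNIV \<gamma>" "A \<in> sets borel" "\<And>t. \<gamma> t \<notin> A"
  shows "measure (curve_measure \<gamma> a b) A = 0"
proof -
  have "\<gamma> -` A = {}" using assms(3) by blast
  then show ?thesis
    unfolding curve_measure_def
    using curve_measurable[OF assms(1)] assms(2) by (subst measure_distr) auto
qed

lemma integral_curve_measure:
  fixes \<phi> :: "plane \<Rightarrow> real"
  assumes \<gamma>: "continuous_on UNIV \<gamma>" and \<phi>: "continuous_on UNIV \<phi>"
  shows "integral\<^sup>L (curve_measure \<gamma> a b) \<phi> = integral {a..b} (\<lambda>t. \<phi> (\<gamma> t))"
proof -
  have "continuous_on {a..b} (\<lambda>t. \<phi> (\<gamma> t))"
    using continuous_on_compose2[OF \<phi> \<gamma>] continuous_on_subset by blast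
  then have si: "set_integrable lborel {a..b} (\<lambda>t. \<phi> (\<gamma> t))" 
    unfolding set_integrable_def by (intro borel_integrable_compact compact_Icc)
  have "integral\<^sup>L (curve_measure \<gamma> a b) \<phi> = integral\<^sup>L (restrict_space lborel {a..b}) (\<lambda>t. \<phi> (\<gamma> t))"
    unfolding curve_measure_def
    using curve_measurable[OF \<gamma>] borel_measurable_continuous_onI[OF \<phi>] by (rule integral_distr)
  also have "\<dots> = (LINT t:{a..b}|lborel. \<phi> (\<gamma> t))"
    unfolding set_lebesgue_integral_def by (rule integral_restrict_space) simp
  finally show ?thesis using set_borel_integral_eq_integral(2)[OF si] by simp
qed

text \<open>
  Iterated integrals rather than integrals over a box, since the fundamental theorem of calculus is applied
  in one variable at a time.
\<close>

definition box_integral :: "real \<Rightarrow> real \<Rightarrow> real \<Rightarrow> real \<Rightarrow> (plane \<Rightarrow> real) \<Rightarrow> real" where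
  "box_integral a b c d \<phi> = integral {a..b} (\<lambda>x. integral {c..d} (\<lambda>y. \<phi> (x, y)))"

lemma continuous_sections:
  assumes "continuous_on UNIV (\<phi> :: plane \<Rightarrow> real)"
  shows "continuous_on S (\<lambda>y. \<phi> (x, y))" and "continuous_on S (\<lambda>x. \<phi> (x, y))"
    and "continuous_on S (\<lambda>x. integral {c..d} (\<lambda>y. \<phi> (x, y)))"
proof -
  show "continuous_on S (\<lambda>y. \<phi> (x, y))" "continuous_on S (\<lambda>x. \<phi> (x, y))"
    by (intro continuous_on_compose2[OF assms] continuous_intros; simp)+
  have "continuous_on (S \<times> cbox c d) (\<lambda>(x, y). \<phi> (x, y))"
    using continuous_on_subset[OF assms] by simp
  from integral_continuous_on_param[OF this]
  show "continuous_on S (\<lambda>x. integral {c..d} (\<lambda>y. \<phi> (x, y)))" by simp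
qed

lemma box_integral_lincomb:
  assumes "continuous_on UNIV \<phi>" "continuous_on UNIV \<psi>"
  shows "box_integral a b c d (\<lambda>p. s * \<phi> p + t * \<psi> p) = s * box_integral a b c d \<phi> + t * box_integral a b c d \<psi>"
  using assms unfolding box_integral_def
  by (simp add: integral_add integral_mult_right integrable_continuous_interval continuous_sections continuous_intros)

lemma box_integral_abs_le:
  assumes \<phi>: "continuous_on UNIV \<phi>" and ab: "a \<le> b" "c \<le> d" and B: "\<And>p. \<bar>\<phi> p\<bar> \<le> B"
  shows "\<bar>box_integral a b c d \<phi>\<bar> \<le> B * (d - c) * (b - a)"
proof -
  have "norm (integral {c..d} (\<lambda>y. \<phi> (x, y))) \<le> B * (d - c)" for x
    by (rule integral_bound[OF ab(2) continuous_sections(1)[OF \<phi>]]) (use B in simp)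
  then have "norm (box_integral a b c d \<phi>) \<le> B * (d - c) * (b - a)"
    unfolding box_integral_def by (intro integral_bound[OF ab(1) continuous_sections(3)[OF \<phi>]])
  then show ?thesis by simp
qed

lemma box_integral_nonneg:
  assumes \<phi>: "continuous_on UNIV \<phi>" and "\<And>p. 0 \<le> \<phi> p"
  shows "0 \<le> box_integral a b c d \<phi>"
  unfolding box_integral_def using assms
  by (intro Henstock_Kurzweil_Integration.integral_nonneg integrable_continuous_interval continuous_sections) auto

lemma box_integral_eq_0:
  assumes "\<And>x y. x \<in> {a..b} \<Longrightarrow> y \<in> {c..d} \<Longrightarrow> \<phi> (x, y) = 0"
  shows "box_integral a b c d \<phi> = 0"
proof -
  have "integral {c..d} (\<lambda>y. \<phi> (x, y)) = 0" if "x \<in> {a..b}" for x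
    by (rule integral_unique, rule has_integral_is_0) (rule assms[OF that])
  then show ?thesis
    unfolding box_integral_def by (rule integral_unique[OF has_integral_is_0])
qed

lemma box_integral_partial1:
  assumes "smooth \<phi>" "a \<le> b"
  shows "box_integral a b c d (partial1 \<phi>) = integral {c..d} (\<lambda>y. \<phi> (b, y)) - integral {c..d} (\<lambda>y. \<phi> (a, y))"
proof -
  have cont: "continuous_on UNIV \<phi>" "continuous_on UNIV (partial1 \<phi>)"
    using assms smooth_partial1 smooth_continuous by blast+
  have "continuous_on (cbox (a, c) (b, d)) (\<lambda>(x, y). partial1 \<phi> (x, y))"
    using continuous_on_subset[OF cont(2)] by simp
  from integral_swap_continuous[OF this]
  have "box_integral a b c d (partial1 \<phi>) = integral {c..d} (\<lambda>y. integral {a..b} (\<lambda>x. partial1 \<phi> (x, y)))"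
    by (simp add: box_integral_def)
  also have "(\<lambda>y. integral {a..b} (\<lambda>x. partial1 \<phi> (x, y))) = (\<lambda>y. \<phi> (b, y) - \<phi> (a, y))"
    using smooth_partial1_deriv[OF assms(1)] assms(2)
    by (intro ext integral_unique fundamental_theorem_of_calculus)
       (auto simp: has_real_derivative_iff_has_vector_derivative[symmetric] intro: has_field_derivative_at_within)
  also have "integral {c..d} \<dots> = integral {c..d} (\<lambda>y. \<phi> (b, y)) - integral {c..d} (\<lambda>y. \<phi> (a, y))"
    by (intro integral_diff integrable_continuous_interval continuous_sections cont)
  finally show ?thesis .
qed

lemma box_integral_partial2:
  assumes "smooth \<phi>" "c \<le> d"
  shows "box_integral a b c d (partial2 \<phi>) = integral {a..b} (\<lambda>x. \<phi> (x, d)) - integral {a..b} (\<lambda>x. \<phi> (x, c))"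
proof -
  have cont: "continuous_on UNIV \<phi>" using assms smooth_continuous by blast
  have "(\<lambda>x. integral {c..d} (\<lambda>y. partial2 \<phi> (x, y))) = (\<lambda>x. \<phi> (x, d) - \<phi> (x, c))"
    using smooth_partial2_deriv[OF assms(1)] assms(2)
    by (intro ext integral_unique fundamental_theorem_of_calculus)
       (auto simp: has_real_derivative_iff_has_vector_derivative[symmetric] intro: has_field_derivative_at_within)
  then have "box_integral a b c d (partial2 \<phi>) = integral {a..b} (\<lambda>x. \<phi> (x, d) - \<phi> (x, c))"
    by (simp add: box_integral_def)
  also have "\<dots> = integral {a..b} (\<lambda>x. \<phi> (x, d)) - integral {a..b} (\<lambda>x. \<phi> (x, c))"
    by (intro integral_diff integrable_continuous_interval continuous_sections cont)
  finally show ?thesis .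
qed

lemma box_integral_partial12:
  assumes "smooth \<phi>" "a \<le> b" "c \<le> d"
  shows "box_integral a b c d (partial2 (partial1 \<phi>)) = (\<phi> (b, d) - \<phi> (a, d)) - (\<phi> (b, c) - \<phi> (a, c))"
proof -
  have "integral {a..b} (\<lambda>x. partial1 \<phi> (x, y)) = \<phi> (b, y) - \<phi> (a, y)" for y
    using smooth_partial1_deriv[OF assms(1)] assms(2)
    by (intro integral_unique fundamental_theorem_of_calculus)
       (auto simp: has_real_derivative_iff_has_vector_derivative[symmetric] intro: has_field_derivative_at_within)
  then show ?thesis using box_integral_partial2[OF smooth_partial1[OF assms(1)] assms(3)] by simp
qed

text \<open>
  The value at \<open>(a, b)\<close> of the function with mixed derivative \<open>m\<close>, if there is one that vanishes outside the
  unit square. The quadrant is cut off at \<open>3\<close>, where the plateaus end.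
\<close>

definition quadrant_mass :: "set_function \<Rightarrow> real \<Rightarrow> real \<Rightarrow> real" where
  "quadrant_mass m a b = m ({a<..3} \<times> {b<..3})"

text \<open>
  On each cell the constant value is the quadrant mass at the lower left corner. For points inside the cell
  this is the quadrant mass after all mass of \<open>m\<close> has been moved to the upper right corners of the cells.
\<close>

definition step_approx :: "set_function \<Rightarrow> nat \<Rightarrow> functional" where
  "step_approx m N \<phi> = (if \<phi> \<in> test_functions UNIV then
     \<Sum>i\<le>N. \<Sum>j\<le>N. quadrant_mass m (node N i) (node N j) *
       box_integral (node N i) (node N (Suc i)) (node N j) (node N (Suc j)) \<phi> else 0)"

lemma step_approx_distribution: "step_approx m N \<in> distributions"
  unfolding distributions_def test_seminorm_def[symmetric]
proof (intro CollectI conjI allI impI ballI)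
  fix \<phi> \<psi> and a b :: real
  assume \<phi>: "\<phi> \<in> test_functions UNIV" and \<psi>: "\<psi> \<in> test_functions UNIV"
  have "continuous_on UNIV \<phi>" "continuous_on UNIV \<psi>"
    using \<phi> \<psi> by (auto simp: test_functions_def smooth_continuous)
  moreover have "(\<lambda>p. a * \<phi> p + b * \<psi> p) \<in> test_functions UNIV"
    by (rule test_functions_lincomb[OF \<phi> \<psi>])
  ultimately show "step_approx m N (\<lambda>p. a * \<phi> p + b * \<psi> p) = a * step_approx m N \<phi> + b * step_approx m N \<psi>"
    using \<phi> \<psi> by (simp add: step_approx_def box_integral_lincomb sum.distrib sum_distrib_left algebra_simps)
next
  fix C :: "plane set"
  let ?c = "\<Sum>i\<le>N. \<Sum>j\<le>N. \<bar>quadrant_mass m (node N i) (node N j)\<bar> * ((1 / N) * (1 / N))"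
  have "\<bar>step_approx m N \<phi>\<bar> \<le> ?c * test_seminorm 0 \<phi>" if \<phi>: "\<phi> \<in> test_functions C" for \<phi>
  proof -
    have 0: "{(i, j). i + j = (0::nat)} = {(0, 0)}" by auto
    have s: "test_seminorm 0 \<phi> = sup_norm \<phi>" by (simp add: test_seminorm_def sup_norm_def 0)
    have cont: "continuous_on UNIV \<phi>" using \<phi> by (simp add: test_functions_def smooth_continuous)
    have b: "\<bar>box_integral (node N i) (node N (Suc i)) (node N j) (node N (Suc j)) \<phi>\<bar>
        \<le> sup_norm \<phi> * (1 / N) * (1 / N)" for i j
      using box_integral_abs_le[OF cont node_mono node_mono sup_norm_upper[OF \<phi>], of i "Suc i" j "Suc j" N N]
      by (simp add: node_Suc)
    have "\<bar>step_approx m N \<phi>\<bar> \<le> (\<Sum>i\<le>N. \<Sum>j\<le>N. \<bar>quadrant_mass m (node N i) (node N j)\<bar> *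
        (sup_norm \<phi> * (1 / N) * (1 / N)))"
    proof -
      have eq: "step_approx m N \<phi> = (\<Sum>i\<le>N. \<Sum>j\<le>N. quadrant_mass m (node N i) (node N j) *
          box_integral (node N i) (node N (Suc i)) (node N j) (node N (Suc j)) \<phi>)"
        using test_functions_mono[of C UNIV] \<phi> by (auto simp: step_approx_def)
      show ?thesis
        unfolding eq
        by (rule order_trans[OF sum_abs], rule sum_mono, rule order_trans[OF sum_abs], rule sum_mono,
            subst abs_mult, rule mult_left_mono[OF b abs_ge_zero])
    qed
    also have "\<dots> = ?c * test_seminorm 0 \<phi>"
      unfolding s by (simp add: sum_distrib_left sum_distrib_right mult_ac)
    finally show ?thesis .
  qed
  then show "\<exists>c M. \<forall>\<phi>\<in>test_functions C. \<bar>step_approx m N \<phi>\<bar> \<le> c * test_seminorm M \<phi>" by blast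
qed (auto simp: step_approx_def)

lemma summation_by_parts:
  fixes g h :: "nat \<Rightarrow> real"
  assumes "g 0 = 0" "g (Suc N) = 0"
  shows "(\<Sum>i\<le>N. g i * (h (Suc i) - h i)) = - (\<Sum>i\<le>N. (g (Suc i) - g i) * h (Suc i))"
proof -
  have "(\<Sum>i\<le>M. g i * (h (Suc i) - h i)) + (\<Sum>i\<le>M. (g (Suc i) - g i) * h (Suc i))
      = g (Suc M) * h (Suc M) - g 0 * h 0" for M
    by (induction M) (simp_all add: algebra_simps)
  from this[of N] show ?thesis using assms by simp
qed

text \<open>The constant curves stand for Dirac masses at the upper right corners, which receive the masses of the cells.\<close>

definition grid_measure :: "set_function \<Rightarrow> nat \<Rightarrow> set_function" where
  "grid_measure m N A = (\<Sum>(i, j)\<in>{..N} \<times> {..N}. m (cell N i j) *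
     measure (curve_measure (\<lambda>_. (node N (Suc i), node N (Suc j))) 0 1) A)"

lemma grid_measure_signed: "grid_measure m N \<in> signed_measures"
  unfolding grid_measure_def[abs_def] case_prod_unfold
  by (rule weighted_sum_signed_measure) (auto intro!: finite_borel_curve_measure)

lemma signed_integral_curves:
  assumes "finite I" "\<And>k. k \<in> I \<Longrightarrow> continuous_on UNIV (\<gamma> k)"
    and \<phi>: "continuous_on UNIV \<phi>" "bounded_borel \<phi>"
  shows "signed_integral (\<lambda>A. \<Sum>k\<in>I. c k * measure (curve_measure (\<gamma> k) (a k) (b k)) A) \<phi>
       = (\<Sum>k\<in>I. c k * integral {a k..b k} (\<lambda>t. \<phi> (\<gamma> k t)))"
  using signed_integral_weighted_sum[OF weighted_sum_signed_measure[OF assms(1)] _ refl \<phi>(2),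
      of "\<lambda>k. curve_measure (\<gamma> k) (a k) (b k)" c]
  using assms by (simp add: finite_borel_curve_measure integral_curve_measure)

lemma signed_integral_grid_measure:
  assumes "continuous_on UNIV \<phi>" "bounded_borel \<phi>"
  shows "signed_integral (grid_measure m N) \<phi>
       = (\<Sum>(i, j)\<in>{..N} \<times> {..N}. m (cell N i j) * \<phi> (node N (Suc i), node N (Suc j)))"
  unfolding grid_measure_def[abs_def] case_prod_unfold
  by (subst signed_integral_curves) (auto intro: assms)

lemma total_variation_grid_measure_le:
  assumes "m \<in> signed_measures"
  shows "total_variation (grid_measure m N) \<le> total_variation m"
proof -
  have "total_variation (grid_measure m N)
      \<le> ennreal (\<Sum>k\<in>{..N} \<times> {..N}. \<bar>m (cell N (fst k) (snd k))\<bar> *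
          measure (curve_measure (\<lambda>_. (node N (Suc (fst k)), node N (Suc (snd k)))) 0 1) UNIV)"
    unfolding grid_measure_def[abs_def] case_prod_unfold
    by (rule total_variation_weighted_sum_le) (auto intro!: finite_borel_curve_measure)
  also have "\<dots> = ennreal (\<Sum>k\<in>{..N} \<times> {..N}. \<bar>m (case k of (i, j) \<Rightarrow> cell N i j)\<bar>)"
    by (simp add: measure_curve_measure_UNIV case_prod_unfold)
  also have "\<dots> \<le> total_variation m"
    by (rule total_variation_ge_sum[OF assms _ _ cell_disjoint]) (auto simp: cell_borel)
  finally show ?thesis .
qed

lemma dyadic_node: "i \<le> 2 ^ n \<Longrightarrow> j \<le> 2 ^ n \<Longrightarrow> (node (2 ^ n) (Suc i), node (2 ^ n) (Suc j)) \<in> dyadic_grid n"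
  by (auto simp: dyadic_grid_def Let_def node_def)

lemma dyadic_grid_subset: "dyadic_grid n \<subseteq> unit_square"
proof -
  have "real k / 2 ^ n \<in> {0..1}" if "k \<le> 2 ^ n" for k :: nat
  proof -
    have "real k \<le> 2 ^ n" using that by (metis of_nat_le_iff of_nat_numeral of_nat_power)
    then show ?thesis by simp
  qed
  then show ?thesis by (auto simp: dyadic_grid_def Let_def unit_square_def)
qed

lemma grid_measure_on_grid: "grid_measure m (2 ^ n) \<in> signed_measures_on (dyadic_grid n)"
proof -
  have "grid_measure m (2 ^ n) A = 0" if A: "A \<in> sets borel" "A \<inter> dyadic_grid n = {}" for A
    unfolding grid_measure_def
  proof (rule sum.neutral, rule ballI)
    fix k assume "k \<in> {..2 ^ n :: nat} \<times> {..2 ^ n :: nat}"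
    then obtain i j where k: "k = (i, j)" "i \<le> 2 ^ n" "j \<le> 2 ^ n" by auto
    then have "(node (2 ^ n) (Suc i), node (2 ^ n) (Suc j)) \<notin> A" using A(2) dyadic_node by blast
    then show "(case k of (i, j) \<Rightarrow> m (cell (2 ^ n) i j) *
        measure (curve_measure (\<lambda>_. (node (2 ^ n) (Suc i), node (2 ^ n) (Suc j))) 0 1) A) = 0"
      using A(1) k(1) by (simp add: measure_curve_measure_eq_0)
  qed
  then show ?thesis using grid_measure_signed by (auto simp: signed_measures_on_def)
qed

lemma quadrant_mass_difference:
  assumes m: "m \<in> signed_measures" and N: "0 < N" and i: "i \<le> N"
  shows "quadrant_mass m (node N (Suc i)) b - quadrant_mass m (node N i) b
      = - m ({node N i<..node N (Suc i)} \<times> {b<..3})"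
    and "quadrant_mass m a (node N (Suc i)) - quadrant_mass m a (node N i)
      = - m ({a<..3} \<times> {node N i<..node N (Suc i)})"
proof -
  have "node N i \<le> node N (Suc i)" "node N (Suc i) \<le> 3"
    using node_mono[of i "Suc i" N] node_bounds[OF N, of "Suc i"] i by auto
  from signed_measure_Times_split[OF m this]
  show "quadrant_mass m (node N (Suc i)) b - quadrant_mass m (node N i) b
      = - m ({node N i<..node N (Suc i)} \<times> {b<..3})"
    "quadrant_mass m a (node N (Suc i)) - quadrant_mass m a (node N i)
      = - m ({a<..3} \<times> {node N i<..node N (Suc i)})"
    by (simp_all add: quadrant_mass_def)
qed

lemma quadrant_mass_cell:
  assumes m: "m \<in> signed_measures" and N: "0 < N" and ij: "i \<le> N" "j \<le> N"
  shows "(quadrant_mass m (node N (Suc i)) (node N (Suc j)) - quadrant_mass m (node N (Suc i)) (node N j))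
       - (quadrant_mass m (node N i) (node N (Suc j)) - quadrant_mass m (node N i) (node N j))
       = m (cell N i j)"
proof -
  have le: "node N i \<le> node N (Suc i)" "node N (Suc i) \<le> 3"
    using node_mono[of i "Suc i" N] node_bounds[OF N, of "Suc i"] ij by auto
  show ?thesis
    unfolding quadrant_mass_difference(2)[OF m N ij(2)]
    using signed_measure_Times_split(1)[OF m le, of "{node N j<..node N (Suc j)}"]
    by (simp add: cell_def)
qed

lemma quadrant_mass_boundary:
  assumes f: "f \<in> M_DD0" and m: "m \<in> signed_measures_on unit_square" "D12 f = distr_of_measure m"
    and N: "0 < N" and ij: "i \<le> Suc N" "j \<le> Suc N" and bd: "i = 0 \<or> i = Suc N \<or> j = 0 \<or> j = Suc N"
  shows "quadrant_mass m (node N i) (node N j) = 0"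
proof (cases "i = 0 \<or> j = 0")
  case True
  have "node N 0 < 0" using N by (simp add: node_def)
  with True have "node N i < 0 \<or> node N j < 0" by auto
  moreover have "node N i \<le> 3" "node N j \<le> 3"
    using node_bounds(2)[OF N ij(1)] node_bounds(2)[OF N ij(2)] by auto
  ultimately show ?thesis
    unfolding quadrant_mass_def using m
    by (intro quadrant_zero[OF f _ m(2)]) (auto simp: signed_measures_on_def)
next
  case False
  have "node N (Suc N) = 1" using N by (simp add: node_def)
  then have "({node N i<..3} \<times> {node N j<..3}) \<inter> unit_square = {}"
    using False bd by (auto simp: unit_square_def)
  moreover have "{node N i<..3} \<times> {node N j<..3} \<in> sets borel" by (intro borel_Times) auto
  ultimately show ?thesis using m by (auto simp: quadrant_mass_def signed_measures_on_def)
qed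

text \<open>
  Meant for lines \<open>\<gamma> a\<close> at position \<open>a\<close> parallel to one axis: length measures on the sides of the cells that
  lie on these lines, weighted by \<open>c\<close>.
\<close>

definition line_measure :: "(nat \<Rightarrow> nat \<Rightarrow> real) \<Rightarrow> (real \<Rightarrow> real \<Rightarrow> plane) \<Rightarrow> nat \<Rightarrow> set_function" where
  "line_measure c \<gamma> N A = (\<Sum>(i, j)\<in>{..N} \<times> {..N}.
     c i j * measure (curve_measure (\<gamma> (node N (Suc i))) (node N j) (node N (Suc j))) A)"

lemma line_measure_signed:
  assumes "\<And>a. continuous_on UNIV (\<gamma> a)"
  shows "line_measure c \<gamma> N \<in> signed_measures"
  unfolding line_measure_def[abs_def] case_prod_unfold
  by (rule weighted_sum_signed_measure) (auto intro!: finite_borel_curve_measure assms)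

lemma signed_integral_line_measure:
  assumes "\<And>a. continuous_on UNIV (\<gamma> a)" "\<phi> \<in> test_functions UNIV"
  shows "signed_integral (line_measure c \<gamma> N) \<phi>
       = (\<Sum>i\<le>N. \<Sum>j\<le>N. c i j * integral {node N j..node N (Suc j)} (\<lambda>t. \<phi> (\<gamma> (node N (Suc i)) t)))"
  unfolding line_measure_def[abs_def] case_prod_unfold
  by (subst signed_integral_curves)
     (auto simp: sum.cartesian_product case_prod_unfold
       intro!: assms(1) test_continuous[OF assms(2)] bounded_borel_test[OF assms(2)])

lemma total_variation_line_measure_le:
  assumes "\<And>a. continuous_on UNIV (\<gamma> a)"
  shows "total_variation (line_measure c \<gamma> N) \<le> ennreal (\<Sum>(i, j)\<in>{..N} \<times> {..N}. \<bar>c i j\<bar> / N)"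
proof -
  have "total_variation (line_measure c \<gamma> N) \<le> ennreal (\<Sum>k\<in>{..N} \<times> {..N}. \<bar>c (fst k) (snd k)\<bar> *
      measure (curve_measure (\<gamma> (node N (Suc (fst k)))) (node N (snd k)) (node N (Suc (snd k)))) UNIV)"
    unfolding line_measure_def[abs_def] case_prod_unfold
    by (rule total_variation_weighted_sum_le) (auto intro!: finite_borel_curve_measure assms)
  then show ?thesis
    by (simp add: measure_curve_measure_UNIV assms node_mono case_prod_unfold) (simp add: node_Suc)
qed

text \<open>
  The first derivatives of the step function sit on the lines across which it jumps, the derivative in \<open>x\<close> on
  vertical and the derivative in \<open>y\<close> on horizontal lines.
\<close>

definition vertical_measure :: "set_function \<Rightarrow> nat \<Rightarrow> set_function" where
  "vertical_measure m N =
     line_measure (\<lambda>i j. - m ({node N i<..node N (Suc i)} \<times> {node N j<..3})) (\<lambda>a t. (a, t)) N"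

definition horizontal_measure :: "set_function \<Rightarrow> nat \<Rightarrow> set_function" where
  "horizontal_measure m N =
     line_measure (\<lambda>i j. - m ({node N j<..3} \<times> {node N i<..node N (Suc i)})) (\<lambda>a t. (t, a)) N"

lemma continuous_lines:
  "continuous_on UNIV (\<lambda>t. (a, t) :: plane)" "continuous_on UNIV (\<lambda>t. (t, a) :: plane)"
  by (intro continuous_intros)+

lemma jump_measures_signed: "vertical_measure m N \<in> signed_measures" "horizontal_measure m N \<in> signed_measures"
  unfolding vertical_measure_def horizontal_measure_def by (intro line_measure_signed continuous_lines)+

text \<open>
  Integrating a derivative over a cell gives differences of \<open>\<phi>\<close>; summation by parts moves them to the
  quadrant masses. There are no boundary terms because these masses vanish at the ends.
\<close>

lemma D1_step_approx:
  assumes f: "f \<in> M_DD0" and m: "m \<in> signed_measures_on unit_square" "D12 f = distr_of_measure m"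
    and N: "0 < N"
  shows "D1 (step_approx m N) = distr_of_measure (vertical_measure m N)"
proof
  fix \<phi>
  have ms: "m \<in> signed_measures" using m by (simp add: signed_measures_on_def)
  show "D1 (step_approx m N) \<phi> = distr_of_measure (vertical_measure m N) \<phi>"
  proof (cases "\<phi> \<in> test_functions UNIV")
    case True
    define G where "G i j = quadrant_mass m (node N i) (node N j)" for i j
    define V where "V i j = integral {node N j..node N (Suc j)} (\<lambda>y. \<phi> (node N i, y))" for i j
    have "D1 (step_approx m N) \<phi> = - (\<Sum>i\<le>N. \<Sum>j\<le>N. G i j * (V (Suc i) j - V i j))"
      using True test_functions_partial(1)[OF True]
      by (simp add: D1_def step_approx_def G_def V_def box_integral_partial1[OF test_smooth[OF True]] node_mono)
    also have "\<dots> = (\<Sum>j\<le>N. - (\<Sum>i\<le>N. G i j * (V (Suc i) j - V i j)))"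
      by (subst sum.swap) (simp add: sum_negf)
    also have "\<dots> = (\<Sum>j\<le>N. \<Sum>i\<le>N. (G (Suc i) j - G i j) * V (Suc i) j)"
    proof (rule sum.cong[OF refl])
      fix j assume "j \<in> {..N}"
      then have "G 0 j = 0" "G (Suc N) j = 0"
        unfolding G_def by (auto intro!: quadrant_mass_boundary[OF f m N])
      from summation_by_parts[of "\<lambda>i. G i j" N "\<lambda>i. V i j", OF this]
      show "- (\<Sum>i\<le>N. G i j * (V (Suc i) j - V i j)) = (\<Sum>i\<le>N. (G (Suc i) j - G i j) * V (Suc i) j)"
        by simp
    qed
    also have "\<dots> = (\<Sum>i\<le>N. \<Sum>j\<le>N. - m ({node N i<..node N (Suc i)} \<times> {node N j<..3}) * V (Suc i) j)"
      by (subst sum.swap) (simp add: G_def quadrant_mass_difference(1)[OF ms N])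
    also have "\<dots> = signed_integral (vertical_measure m N) \<phi>"
      by (simp add: vertical_measure_def signed_integral_line_measure[OF continuous_lines(1) True] V_def sum_negf)
    finally show ?thesis using True by (simp add: distr_of_measure_def)
  qed (simp add: D1_def distr_of_measure_def)
qed

lemma D2_step_approx:
  assumes f: "f \<in> M_DD0" and m: "m \<in> signed_measures_on unit_square" "D12 f = distr_of_measure m"
    and N: "0 < N"
  shows "D2 (step_approx m N) = distr_of_measure (horizontal_measure m N)"
proof
  fix \<phi>
  have ms: "m \<in> signed_measures" using m by (simp add: signed_measures_on_def)
  show "D2 (step_approx m N) \<phi> = distr_of_measure (horizontal_measure m N) \<phi>"
  proof (cases "\<phi> \<in> test_functions UNIV")
    case True
    define G where "G i j = quadrant_mass m (node N i) (node N j)" for i j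
    define V where "V i j = integral {node N i..node N (Suc i)} (\<lambda>x. \<phi> (x, node N j))" for i j
    have "D2 (step_approx m N) \<phi> = (\<Sum>i\<le>N. - (\<Sum>j\<le>N. G i j * (V i (Suc j) - V i j)))"
      using True test_functions_partial(2)[OF True]
      by (simp add: D2_def step_approx_def G_def V_def sum_negf box_integral_partial2[OF test_smooth[OF True]] node_mono)
    also have "\<dots> = (\<Sum>i\<le>N. \<Sum>j\<le>N. (G i (Suc j) - G i j) * V i (Suc j))"
    proof (rule sum.cong[OF refl])
      fix i assume "i \<in> {..N}"
      then have "G i 0 = 0" "G i (Suc N) = 0"
        unfolding G_def by (auto intro!: quadrant_mass_boundary[OF f m N])
      from summation_by_parts[of "\<lambda>j. G i j" N "\<lambda>j. V i j", OF this]
      show "- (\<Sum>j\<le>N. G i j * (V i (Suc j) - V i j)) = (\<Sum>j\<le>N. (G i (Suc j) - G i j) * V i (Suc j))"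
        by simp
    qed
    also have "\<dots> = (\<Sum>j\<le>N. \<Sum>i\<le>N. - m ({node N i<..3} \<times> {node N j<..node N (Suc j)}) * V i (Suc j))"
      by (subst sum.swap) (simp add: G_def quadrant_mass_difference(2)[OF ms N])
    also have "\<dots> = signed_integral (horizontal_measure m N) \<phi>"
      by (simp add: horizontal_measure_def signed_integral_line_measure[OF continuous_lines(2) True] V_def sum_negf)
    finally show ?thesis using True by (simp add: distr_of_measure_def)
  qed (simp add: D2_def distr_of_measure_def)
qed

lemma D12_step_approx:
  assumes f: "f \<in> M_DD0" and m: "m \<in> signed_measures_on unit_square" "D12 f = distr_of_measure m"
    and N: "0 < N"
  shows "D12 (step_approx m N) = distr_of_measure (grid_measure m N)"
proof
  fix \<phi>
  have ms: "m \<in> signed_measures" using m by (simp add: signed_measures_on_def)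
  show "D12 (step_approx m N) \<phi> = distr_of_measure (grid_measure m N) \<phi>"
  proof (cases "\<phi> \<in> test_functions UNIV")
    case True
    define G where "G i j = quadrant_mass m (node N i) (node N j)" for i j
    define H where "H i j = \<phi> (node N i, node N j)" for i j
    have G0: "G i 0 = 0" "G i (Suc N) = 0" "G 0 i = 0" "G (Suc N) i = 0" if "i \<le> Suc N" for i
      using that unfolding G_def by (auto intro!: quadrant_mass_boundary[OF f m N])
    note p = test_functions_partial(1)[OF True]
    have "D12 (step_approx m N) \<phi> = (\<Sum>i\<le>N. \<Sum>j\<le>N. G i j * ((H (Suc i) (Suc j) - H i (Suc j)) - (H (Suc i) j - H i j)))"
      using True p test_functions_partial(2)[OF p]
      by (simp add: D12_def D1_def D2_def step_approx_def G_def H_def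
          box_integral_partial12[OF test_smooth[OF True]] node_mono)
    also have "\<dots> = (\<Sum>i\<le>N. \<Sum>j\<le>N. - (G i (Suc j) - G i j) * (H (Suc i) (Suc j) - H i (Suc j)))"
    proof (rule sum.cong[OF refl])
      fix i assume "i \<in> {..N}"
      with summation_by_parts[of "\<lambda>j. G i j" N "\<lambda>j. H (Suc i) j - H i j"] G0[of i]
      show "(\<Sum>j\<le>N. G i j * ((H (Suc i) (Suc j) - H i (Suc j)) - (H (Suc i) j - H i j)))
          = (\<Sum>j\<le>N. - (G i (Suc j) - G i j) * (H (Suc i) (Suc j) - H i (Suc j)))"
        by (simp only: mult_minus_left sum_negf) simp
    qed
    also have "\<dots> = (\<Sum>j\<le>N. - (\<Sum>i\<le>N. (G i (Suc j) - G i j) * (H (Suc i) (Suc j) - H i (Suc j))))"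
      by (subst sum.swap) (simp only: mult_minus_left sum_negf)
    also have "\<dots> = (\<Sum>j\<le>N. \<Sum>i\<le>N. m (cell N i j) * H (Suc i) (Suc j))"
    proof (rule sum.cong[OF refl])
      fix j assume j: "j \<in> {..N}"
      then have "G 0 (Suc j) - G 0 j = 0" "G (Suc N) (Suc j) - G (Suc N) j = 0" using G0 by auto
      from summation_by_parts[of "\<lambda>i. G i (Suc j) - G i j" N "\<lambda>i. H i (Suc j)", OF this]
      have "- (\<Sum>i\<le>N. (G i (Suc j) - G i j) * (H (Suc i) (Suc j) - H i (Suc j)))
          = (\<Sum>i\<le>N. (G (Suc i) (Suc j) - G (Suc i) j - (G i (Suc j) - G i j)) * H (Suc i) (Suc j))" by simp
      also have "\<dots> = (\<Sum>i\<le>N. m (cell N i j) * H (Suc i) (Suc j))"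
        using j unfolding G_def by (intro sum.cong refl) (simp add: quadrant_mass_cell[OF ms N])
      finally show "- (\<Sum>i\<le>N. (G i (Suc j) - G i j) * (H (Suc i) (Suc j) - H i (Suc j)))
          = (\<Sum>i\<le>N. m (cell N i j) * H (Suc i) (Suc j))" .
    qed
    also have "\<dots> = signed_integral (grid_measure m N) \<phi>"
      by (subst sum.swap)
         (simp add: signed_integral_grid_measure[OF test_continuous[OF True] bounded_borel_test[OF True]]
           H_def sum.cartesian_product)
    finally show ?thesis using True by (simp add: distr_of_measure_def)
  qed (simp add: D12_def D1_def distr_of_measure_def)
qed

text \<open>
  The values of the step function are limits of values of \<open>f\<close> on nonnegative test functions, hence
  nonnegative; on the cells that leave the unit square they are zero.
\<close>

lemma step_approx_in_grid_space:
  assumes f: "f \<in> M_DD0_pos" and m: "m \<in> signed_measures_on unit_square" "D12 f = distr_of_measure m"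
  shows "step_approx m (2 ^ n) \<in> M_DD0_pos_grid n"
proof -
  let ?N = "2 ^ n :: nat"
  have N: "0 < ?N" by simp
  have f0: "f \<in> M_DD0" using f by (simp add: M_DD0_pos_def)
  have ms: "m \<in> signed_measures" using m by (simp add: signed_measures_on_def)
  note D12 = D12_step_approx[OF f0 m N]
  have "grid_measure m ?N \<in> signed_measures_on unit_square"
    using grid_measure_on_grid[of m n] dyadic_grid_subset[of n] by (fastforce simp: signed_measures_on_def)
  moreover have "step_approx m ?N \<phi> = 0" if \<phi>: "\<phi> \<in> test_functions (- unit_square)" for \<phi>
  proof -
    have "quadrant_mass m (node ?N i) (node ?N j) *
        box_integral (node ?N i) (node ?N (Suc i)) (node ?N j) (node ?N (Suc j)) \<phi> = 0"
      if ij: "i \<le> ?N" "j \<le> ?N" for i j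
    proof (cases "i = 0 \<or> j = 0")
      case True
      then show ?thesis using quadrant_mass_boundary[OF f0 m N, of i j] ij by auto
    next
      case False
      have "0 \<le> node ?N i" "0 \<le> node ?N j" "node ?N (Suc i) \<le> 1" "node ?N (Suc j) \<le> 1"
        using False ij node_bounds(2)[OF N, of "Suc i"] node_bounds(2)[OF N, of "Suc j"]
        by (auto simp: node_def)
      then have "\<phi> (x, y) = 0" if "x \<in> {node ?N i..node ?N (Suc i)}" "y \<in> {node ?N j..node ?N (Suc j)}" for x y
        using that \<phi> by (intro eq_0_outside_tsupport) (auto simp: test_functions_def unit_square_def)
      then have "box_integral (node ?N i) (node ?N (Suc i)) (node ?N j) (node ?N (Suc j)) \<phi> = 0"
        by (rule box_integral_eq_0)
      then show ?thesis by simp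
    qed
    then show ?thesis by (auto simp: step_approx_def intro!: sum.neutral)
  qed
  moreover have "0 \<le> step_approx m ?N \<phi>" if \<phi>: "\<phi> \<in> test_functions UNIV" "\<forall>p. 0 \<le> \<phi> p" for \<phi>
  proof -
    have "0 \<le> quadrant_mass m (node ?N i) (node ?N j)" if "i \<le> ?N" "j \<le> ?N" for i j
      unfolding quadrant_mass_def
      using node_bounds(2)[OF N, of i] node_bounds(2)[OF N, of j] that
      by (intro quadrant_nonneg[OF f ms m(2)]) auto
    moreover have "0 \<le> box_integral a b c d \<phi>" for a b c d
      using \<phi> by (intro box_integral_nonneg test_continuous) auto
    ultimately show ?thesis
      using \<phi> unfolding step_approx_def by (auto intro!: sum_nonneg mult_nonneg_nonneg)
  qed
  ultimately show ?thesis
    using step_approx_distribution[of m ?N] D12 grid_measure_on_grid[of m n]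
    by (auto simp: M_DD0_pos_grid_def M_DD0_pos_def M_DD0_def)
qed

text \<open>
  The norm of the mixed derivative does not increase, because moving masses can only cancel. The norms of
  the first derivatives may increase, but by no more than a multiple of the mesh width.
\<close>

lemma norm_M_step_approx_le:
  assumes f: "f \<in> M_DD0" and m: "m \<in> signed_measures_on unit_square" "D12 f = distr_of_measure m"
    and N: "0 < N"
  shows "norm_M (D12 (step_approx m N)) \<le> norm_M (D12 f)"
    and "norm_M (D1 (step_approx m N)) \<le> norm_M (D1 f) + ennreal (variation_measure m UNIV / N)"
    and "norm_M (D2 (step_approx m N)) \<le> norm_M (D2 f) + ennreal (variation_measure (swapped m) UNIV / N)"
proof -
  have ms: "m \<in> signed_measures" using m by (simp add: signed_measures_on_def)
  show "norm_M (D12 (step_approx m N)) \<le> norm_M (D12 f)"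
    unfolding D12_step_approx[OF f m N] m(2) norm_M_distr_of_measure[OF ms]
      norm_M_distr_of_measure[OF grid_measure_signed] by (rule total_variation_grid_measure_le[OF ms])
  show "norm_M (D1 (step_approx m N)) \<le> norm_M (D1 f) + ennreal (variation_measure m UNIV / N)"
    unfolding D1_step_approx[OF f m N] norm_M_distr_of_measure[OF jump_measures_signed(1)]
    unfolding vertical_measure_def
    using strip_sum_le_D1[OF f m N]
    by (intro order_trans[OF total_variation_line_measure_le[OF continuous_lines(1)]]) simp
  show "norm_M (D2 (step_approx m N)) \<le> norm_M (D2 f) + ennreal (variation_measure (swapped m) UNIV / N)"
    unfolding D2_step_approx[OF f m N] norm_M_distr_of_measure[OF jump_measures_signed(2)]
    unfolding horizontal_measure_def
    using strip_sum_le_D2[OF f m N]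
    by (intro order_trans[OF total_variation_line_measure_le[OF continuous_lines(2)]]) simp
qed

section \<open>Weak-star convergence of the discretisation\<close>

lemma signed_integral_step_function:
  assumes m: "m \<in> signed_measures" and I: "finite I" "\<And>k. k \<in> I \<Longrightarrow> A k \<in> sets borel"
  shows "bounded_borel (\<lambda>p. \<Sum>k\<in>I. c k * indicator (A k) p)"
    and "signed_integral m (\<lambda>p. \<Sum>k\<in>I. c k * indicator (A k) p) = (\<Sum>k\<in>I. c k * m (A k))"
proof -
  have "bounded_borel (\<lambda>p. \<Sum>k\<in>I. c k * indicator (A k) p) \<and>
      signed_integral m (\<lambda>p. \<Sum>k\<in>I. c k * indicator (A k) p) = (\<Sum>k\<in>I. c k * m (A k))"
    using I
  proof (induction I rule: finite_induct)
    case empty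
    show ?case by (simp add: signed_integral_def bounded_borelI[where B=0])
  next
    case (insert x F)
    have b: "bounded_borel (indicator (A x))" using insert by (intro bounded_borel_indicator) auto
    have s: "bounded_borel (\<lambda>p. \<Sum>k\<in>F. c k * indicator (A k) p)"
      "signed_integral m (\<lambda>p. \<Sum>k\<in>F. c k * indicator (A k) p) = (\<Sum>k\<in>F. c k * m (A k))"
      using insert by auto
    have "signed_integral m (\<lambda>p. c x * indicator (A x) p + 1 * (\<Sum>k\<in>F. c k * indicator (A k) p))
        = c x * m (A x) + 1 * (\<Sum>k\<in>F. c k * m (A k))"
      using insert(4)[of x] s(2)
      by (subst signed_integral_lincomb[OF m b s(1)]) (simp add: signed_integral_indicator[OF m])
    then show ?case
      using bounded_borel_add[OF bounded_borel_cmult[OF b] s(1)]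
      unfolding sum.insert[OF insert(1,2)] by (simp only: mult_1_left)
  qed
  then show "bounded_borel (\<lambda>p. \<Sum>k\<in>I. c k * indicator (A k) p)"
    "signed_integral m (\<lambda>p. \<Sum>k\<in>I. c k * indicator (A k) p) = (\<Sum>k\<in>I. c k * m (A k))" by auto
qed

lemma cell_step_function_value:
  assumes "p \<in> cell N i j" "i \<le> N" "j \<le> N"
  shows "(\<Sum>k\<in>{..N} \<times> {..N}. c k * indicator (case k of (i, j) \<Rightarrow> cell N i j) p) = (c (i, j) :: real)"
proof -
  have "indicator (case k of (i, j) \<Rightarrow> cell N i j) p = (if k = (i, j) then 1 else 0 :: real)" for k
    using assms(1) node_disjoint by (cases k; cases p) (fastforce simp: cell_def indicator_def)
  then have "(\<Sum>k\<in>{..N} \<times> {..N}. c k * indicator (case k of (i, j) \<Rightarrow> cell N i j) p)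
      = (\<Sum>k\<in>{..N} \<times> {..N}. if k = (i, j) then c k else 0)"
    by (intro sum.cong refl) simp
  then show ?thesis using assms by simp
qed

text \<open>
  Cells are closed on the right and the first one begins to the left of \<open>0\<close>, so rounding up finds a cell for
  every point, including \<open>0\<close>.
\<close>

lemma unit_interval_node:
  assumes N: "0 < N" and x: "x \<in> {0..1}"
  obtains i where "i \<le> N" "x \<in> {node N i<..node N (Suc i)}" "node N (Suc i) = \<lceil>real N * x\<rceil> / N"
proof
  let ?i = "nat \<lceil>real N * x\<rceil>"
  have "0 \<le> real N * x" using x by simp
  then have nn: "0 \<le> \<lceil>real N * x\<rceil>" by linarith
  then have e: "real ?i = real_of_int \<lceil>real N * x\<rceil>" by simp
  have "\<lceil>real N * x\<rceil> \<le> int N" using x mult_left_mono[of x 1 "real N"] by (simp add: ceiling_le_iff)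
  then show "?i \<le> N" by (simp only: nat_le_iff)
  show "node N (Suc ?i) = \<lceil>real N * x\<rceil> / N" using e by (simp add: node_def)
  have "real ?i - 1 < real N * x" "real N * x \<le> real ?i" unfolding e by linarith+
  then show "x \<in> {node N ?i<..node N (Suc ?i)}" using N by (simp add: node_def field_simps)
qed

lemma ceiling_dyadic_tendsto: "(\<lambda>n. real_of_int \<lceil>real (2 ^ n) * x\<rceil> / real (2 ^ n)) \<longlonglongrightarrow> x"
proof (rule LIM_zero_cancel, rule Lim_null_comparison)
  have "norm (real_of_int \<lceil>real (2 ^ n) * x\<rceil> / real (2 ^ n) - x) \<le> (1 / 2) ^ n" for n
  proof -
    have "\<bar>real_of_int \<lceil>real (2 ^ n) * x\<rceil> - real (2 ^ n) * x\<bar> \<le> 1" by linarith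
    moreover have "real_of_int \<lceil>real (2 ^ n) * x\<rceil> / real (2 ^ n) - x
        = (real_of_int \<lceil>real (2 ^ n) * x\<rceil> - real (2 ^ n) * x) / 2 ^ n" by (simp add: field_simps)
    ultimately show ?thesis
      by (simp add: abs_divide power_one_over divide_right_mono del: of_nat_power)
  qed
  then show "\<forall>\<^sub>F n in sequentially. norm (real_of_int \<lceil>real (2 ^ n) * x\<rceil> / real (2 ^ n) - x) \<le> (1 / 2) ^ n"
    by simp
  show "(\<lambda>n. (1 / 2 :: real) ^ n) \<longlonglongrightarrow> 0" by (rule LIMSEQ_realpow_zero) auto
qed

lemma bounded_borel_C0:
  assumes "\<phi> \<in> C0" shows "bounded_borel \<phi>"
proof -
  have cont: "continuous_on UNIV \<phi>" and lim: "(\<phi> \<longlongrightarrow> 0) at_infinity" using assms by (auto simp: C0_def)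
  have "\<forall>\<^sub>F p in at_infinity. \<bar>\<phi> p\<bar> < 1" using tendstoD[OF lim, of 1] by simp
  then obtain R where R: "\<And>p. R \<le> norm p \<Longrightarrow> \<bar>\<phi> p\<bar> < 1" by (auto simp: eventually_at_infinity)
  have "bounded (\<phi> ` cball 0 R)"
    by (intro compact_imp_bounded compact_continuous_image continuous_on_subset[OF cont]) auto
  then obtain B where "\<forall>p\<in>cball 0 R. \<bar>\<phi> p\<bar> \<le> B" by (auto simp: bounded_iff)
  then have B: "\<bar>\<phi> p\<bar> \<le> B" if "norm p \<le> R" for p using that by simp
  have "\<bar>\<phi> p\<bar> \<le> max B 1" for p using R[of p] B[of p] by (cases "norm p \<le> R") auto
  then show ?thesis by (rule bounded_borelI[OF borel_measurable_continuous_onI[OF cont]])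
qed

text \<open>
  On the unit square, integration against the grid measure amounts to rounding both coordinates up to the
  grid before applying \<open>\<phi>\<close>.
\<close>

lemma grid_measure_tendsto:
  assumes m: "m \<in> signed_measures_on unit_square" and \<phi>: "\<phi> \<in> C0"
  shows "(\<lambda>n. signed_integral (grid_measure m (2 ^ n)) \<phi>) \<longlonglongrightarrow> signed_integral m \<phi>"
proof -
  have ms: "m \<in> signed_measures" using m by (simp add: signed_measures_on_def)
  have cont: "continuous_on UNIV \<phi>" using \<phi> by (simp add: C0_def)
  obtain B where B: "\<And>p. \<bar>\<phi> p\<bar> \<le> B" using bounded_borel_C0[OF \<phi>] by (auto simp: bounded_borel_def)
  define c where "c N k = \<phi> (node N (Suc (fst k)), node N (Suc (snd k)))" for N k
  define u where "u n p = (\<Sum>k\<in>{..2 ^ n :: nat} \<times> {..2 ^ n :: nat}. c (2 ^ n) k *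
      indicator (case k of (i, j) \<Rightarrow> cell (2 ^ n) i j) p)" for n p
  have "signed_integral (grid_measure m (2 ^ n)) \<phi> = signed_integral m (u n)" for n
    unfolding u_def[abs_def]
    by (subst signed_integral_step_function(2)[OF ms])
       (auto simp: cell_borel c_def signed_integral_grid_measure[OF cont bounded_borel_C0[OF \<phi>]]
         case_prod_unfold mult.commute intro!: sum.cong)
  moreover have "(\<lambda>n. signed_integral m (u n)) \<longlonglongrightarrow> signed_integral m \<phi>"
  proof (rule signed_integral_tendsto[OF m])
    show "unit_square \<in> sets borel" unfolding unit_square_def by (intro borel_Times) auto
    have "bounded_borel (u n)" for n
      unfolding u_def[abs_def] by (rule signed_integral_step_function(1)[OF ms]) (auto simp: cell_borel)
    then show "u n \<in> borel_measurable borel" for n by (simp add: bounded_borel_def)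
    show "\<phi> \<in> borel_measurable borel" by (rule borel_measurable_continuous_onI[OF cont])
    show "\<bar>u n p\<bar> \<le> B" for n p
    proof (cases "\<exists>i j. i \<le> 2 ^ n \<and> j \<le> 2 ^ n \<and> p \<in> cell (2 ^ n) i j")
      case True
      then obtain i j where "i \<le> 2 ^ n" "j \<le> 2 ^ n" "p \<in> cell (2 ^ n) i j" by blast
      then have "u n p = c (2 ^ n) (i, j)" unfolding u_def by (intro cell_step_function_value)
      then show ?thesis by (simp add: c_def B)
    next
      case False
      then have "u n p = 0" unfolding u_def by (intro sum.neutral) auto
      then show ?thesis using B[of p] by simp
    qed
    fix p :: plane assume "p \<in> unit_square"
    then obtain x y where p: "p = (x, y)" "x \<in> {0..1}" "y \<in> {0..1}" by (auto simp: unit_square_def)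
    have "u n p = \<phi> (\<lceil>real (2 ^ n) * x\<rceil> / real (2 ^ n), \<lceil>real (2 ^ n) * y\<rceil> / real (2 ^ n))" for n
    proof -
      have N: "0 < (2 ^ n :: nat)" by simp
      obtain i where i: "i \<le> 2 ^ n" "x \<in> {node (2 ^ n) i<..node (2 ^ n) (Suc i)}"
          "node (2 ^ n) (Suc i) = \<lceil>real (2 ^ n) * x\<rceil> / real (2 ^ n)"
        using unit_interval_node[OF N p(2)] by blast
      obtain j where j: "j \<le> 2 ^ n" "y \<in> {node (2 ^ n) j<..node (2 ^ n) (Suc j)}"
          "node (2 ^ n) (Suc j) = \<lceil>real (2 ^ n) * y\<rceil> / real (2 ^ n)"
        using unit_interval_node[OF N p(3)] by blast
      have "p \<in> cell (2 ^ n) i j" using i j p by (simp add: cell_def)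
      then have "u n p = c (2 ^ n) (i, j)"
        unfolding u_def using i(1) j(1) by (intro cell_step_function_value)
      then show ?thesis by (simp add: c_def i(3) j(3))
    qed
    moreover have "(\<lambda>n. (real_of_int \<lceil>real (2 ^ n) * x\<rceil> / real (2 ^ n), real_of_int \<lceil>real (2 ^ n) * y\<rceil> / real (2 ^ n)))
        \<longlonglongrightarrow> (x, y)"
      by (intro tendsto_Pair ceiling_dyadic_tendsto)
    then have "(\<lambda>n. \<phi> (real_of_int \<lceil>real (2 ^ n) * x\<rceil> / real (2 ^ n), real_of_int \<lceil>real (2 ^ n) * y\<rceil> / real (2 ^ n)))
        \<longlonglongrightarrow> \<phi> (x, y)"
      by (rule continuous_on_tendsto_compose[OF cont]) auto
    ultimately show "(\<lambda>n. u n p) \<longlonglongrightarrow> \<phi> p" by (simp only: p(1))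
  qed
  ultimately show ?thesis by simp
qed

text \<open>
  A sequence converges in a generated topology as soon as it is eventually in every generating set that
  contains the limit.
\<close>

lemma weak_star_limitinI:
  assumes f: "f \<in> M_DD0" and g: "\<And>n. g n \<in> M_DD0"
    and lim: "\<And>\<phi>. \<phi> \<in> C0 \<Longrightarrow> (\<lambda>n. signed_integral (measure_of_distr (D12 (g n))) \<phi>)
      \<longlonglongrightarrow> signed_integral (measure_of_distr (D12 f)) \<phi>"
  shows "limitin weak_star g f sequentially"
proof -
  let ?S = "{{f \<in> M_DD0. signed_integral (measure_of_distr (D12 f)) \<phi> \<in> U} | \<phi> U. \<phi> \<in> C0 \<and> open U}"
  have ev: "\<forall>\<^sub>F n in sequentially. g n \<in> U" if "generate_topology_on ?S U" "f \<in> U" for U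
    using that
  proof (induction rule: generate_topology_on.induct)
    case (Int a b)
    then show ?case by (auto intro: eventually_conj)
  next
    case (UN K)
    then obtain k where "k \<in> K" "\<forall>\<^sub>F n in sequentially. g n \<in> k" by blast
    then show ?case by (auto elim: eventually_mono)
  next
    case (Basis s)
    then obtain \<phi> U where s: "s = {f \<in> M_DD0. signed_integral (measure_of_distr (D12 f)) \<phi> \<in> U}"
      and \<phi>: "\<phi> \<in> C0" "open U" by blast
    have "\<forall>\<^sub>F n in sequentially. signed_integral (measure_of_distr (D12 (g n))) \<phi> \<in> U"
      using Basis s by (intro topological_tendstoD[OF lim[OF \<phi>(1)] \<phi>(2)]) auto
    then show ?case using g s by simp
  qed simp
  have "(\<lambda>_. 0) \<in> C0" by (simp add: C0_def)
  then have "f \<in> \<Union> ?S" using f by (fastforce intro!: exI[of _ UNIV])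
  with ev show ?thesis
    unfolding limitin_def weak_star_def by (simp add: openin_topology_generated_by_iff)
qed

section \<open>Convexity of the problem\<close>

text \<open>Needed for midpoints: only at elements of the cone does a minimiser give a lower bound.\<close>

lemma M_DD0_pos_cone:
  assumes f: "f \<in> M_DD0_pos" and g: "g \<in> M_DD0_pos" and ab: "0 \<le> a" "0 \<le> b"
  shows "(\<lambda>\<phi>. a * f \<phi> + b * g \<phi>) \<in> M_DD0_pos"
proof -
  obtain m1 where m1: "m1 \<in> signed_measures_on unit_square" "D12 f = distr_of_measure m1"
    using f by (auto simp: M_DD0_pos_def M_DD0_def)
  obtain m2 where m2: "m2 \<in> signed_measures_on unit_square" "D12 g = distr_of_measure m2"
    using g by (auto simp: M_DD0_pos_def M_DD0_def)
  have "(\<lambda>A. a * m1 A + b * m2 A) \<in> signed_measures_on unit_square"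
    using m1 m2 signed_measures_lincomb by (auto simp: signed_measures_on_def)
  moreover have "D12 (\<lambda>\<phi>. a * f \<phi> + b * g \<phi>) = distr_of_measure (\<lambda>A. a * m1 A + b * m2 A)"
    using m1 m2 by (simp add: derivative_lincomb distr_of_measure_lincomb signed_measures_on_def)
  ultimately show ?thesis
    using f g ab distributions_lincomb[of f g a b] by (auto simp: M_DD0_pos_def M_DD0_def)
qed

lemma norm_M_convex:
  assumes ab: "0 < a" "0 < b"
  shows "norm_M (\<lambda>\<phi>. a * u \<phi> + b * v \<phi>) \<le> ennreal a * norm_M u + ennreal b * norm_M v"
proof (cases "u \<in> distr_of_measure ` signed_measures \<and> v \<in> distr_of_measure ` signed_measures")
  case True
  then obtain m1 m2 where m: "m1 \<in> signed_measures" "m2 \<in> signed_measures"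
    and uv: "u = distr_of_measure m1" "v = distr_of_measure m2" by blast
  show ?thesis
    using total_variation_lincomb_le[of a m1 b m2] ab
    by (simp add: uv distr_of_measure_lincomb[OF m, symmetric] norm_M_distr_of_measure m signed_measures_lincomb)
next
  case False
  then have top: "ennreal a * norm_M u + ennreal b * norm_M v = top"
    using ab by (auto simp: norm_M_def ennreal_mult_eq_top_iff)
  show ?thesis unfolding top by simp
qed

lemma norm_theta_convex:
  assumes ab: "0 < a" "0 < b"
  shows "norm_theta \<theta> (\<lambda>\<phi>. a * f \<phi> + b * g \<phi>) \<le> ennreal a * norm_theta \<theta> f + ennreal b * norm_theta \<theta> g"
proof -
  have "norm_theta \<theta> (\<lambda>\<phi>. a * f \<phi> + b * g \<phi>)
      \<le> ennreal \<theta> * (ennreal a * norm_M (D12 f) + ennreal b * norm_M (D12 g)) + ennreal (1 - \<theta>) *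
        ((ennreal a * norm_M (D2 f) + ennreal b * norm_M (D2 g)) + (ennreal a * norm_M (D1 f) + ennreal b * norm_M (D1 g)))"
    unfolding norm_theta_def norm_grad_def derivative_lincomb
    by (intro add_mono mult_left_mono norm_M_convex ab) auto
  also have "\<dots> = ennreal a * norm_theta \<theta> f + ennreal b * norm_theta \<theta> g"
    unfolding norm_theta_def norm_grad_def by (simp add: distrib_left ac_simps)
  finally show ?thesis .
qed

section \<open>Minimising sequences\<close>

text \<open>
  Every element of the cone is approximated from within the grid cones, in the weak-star topology and without
  increasing the norm in the limit. This is the recovery sequence in the sense of Gamma convergence.
\<close>

lemma step_approx_consistent:
  fixes \<nu> :: "functional \<Rightarrow> real ^ 'm"
  assumes f: "f \<in> M_DD0_pos" and \<nu>: "continuous_map (subtopology weak_star M_DD0_pos) euclidean \<nu>"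
  obtains g e where "\<And>n. g n \<in> M_DD0_pos_grid n" "(\<lambda>n. \<nu> (g n)) \<longlonglongrightarrow> \<nu> f"
    "\<And>n. norm_theta \<theta> (g n) \<le> norm_theta \<theta> f + ennreal (e n)" "e \<longlonglongrightarrow> 0"
proof -
  have f0: "f \<in> M_DD0" using f by (simp add: M_DD0_pos_def)
  obtain m where m: "m \<in> signed_measures_on unit_square" "D12 f = distr_of_measure m"
    using f0 by (auto simp: M_DD0_def)
  have ms: "m \<in> signed_measures" using m by (simp add: signed_measures_on_def)
  define g where "g n = step_approx m (2 ^ n)" for n
  define V where "V = variation_measure m UNIV"
  define V' where "V' = variation_measure (swapped m) UNIV"
  have V: "0 \<le> V" "0 \<le> V'" by (simp_all add: V_def V'_def variation_measure_def)
  define e where "e n = max 0 (1 - \<theta>) * (V' / 2 ^ n + V / 2 ^ n)" for n :: nat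
  have grid: "g n \<in> M_DD0_pos_grid n" for n
    unfolding g_def by (rule step_approx_in_grid_space[OF f m])
  then have pos: "g n \<in> M_DD0_pos" for n by (simp add: M_DD0_pos_grid_def)
  have "limitin weak_star g f sequentially"
  proof (rule weak_star_limitinI[OF f0])
    show "g n \<in> M_DD0" for n using pos by (simp add: M_DD0_pos_def)
    fix \<phi> assume "\<phi> \<in> C0"
    then show "(\<lambda>n. signed_integral (measure_of_distr (D12 (g n))) \<phi>)
        \<longlonglongrightarrow> signed_integral (measure_of_distr (D12 f)) \<phi>"
      using grid_measure_tendsto[OF m(1)]
      by (simp add: g_def D12_step_approx[OF f0 m] m(2) measure_of_distr_of_measure ms grid_measure_signed)
  qed
  then have "limitin (subtopology weak_star M_DD0_pos) g f sequentially"
    using f pos by (simp add: limitin_subtopology)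
  from continuous_map_limit[OF \<nu> this] have lim: "(\<lambda>n. \<nu> (g n)) \<longlonglongrightarrow> \<nu> f" by (simp add: o_def)
  have "norm_theta \<theta> (g n) \<le> norm_theta \<theta> f + ennreal (e n)" for n
  proof -
    have "norm_theta \<theta> (g n) \<le> ennreal \<theta> * norm_M (D12 f) + ennreal (1 - \<theta>) *
        ((norm_M (D2 f) + ennreal (V' / 2 ^ n)) + (norm_M (D1 f) + ennreal (V / 2 ^ n)))"
      unfolding norm_theta_def norm_grad_def g_def V_def V'_def
      using norm_M_step_approx_le[OF f0 m, of "2 ^ n"] by (intro add_mono mult_left_mono) auto
    also have "\<dots> = norm_theta \<theta> f + ennreal (1 - \<theta>) * (ennreal (V' / 2 ^ n) + ennreal (V / 2 ^ n))"
      unfolding norm_theta_def norm_grad_def by (simp add: distrib_left ac_simps)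
    also have "ennreal (1 - \<theta>) * (ennreal (V' / 2 ^ n) + ennreal (V / 2 ^ n)) = ennreal (e n)"
    proof -
      have "ennreal (1 - \<theta>) = ennreal (max 0 (1 - \<theta>))" by (simp add: max_def ennreal_neg)
      then show ?thesis using V by (simp add: e_def ennreal_mult ennreal_plus)
    qed
    finally show ?thesis .
  qed
  moreover have "e \<longlonglongrightarrow> 0"
  proof -
    have "(\<lambda>n. v / 2 ^ n) \<longlonglongrightarrow> 0" for v :: real
      by (rule LIMSEQ_divide_realpow_zero) simp
    from tendsto_mult_right_zero[OF tendsto_add_zero[OF this this]] show ?thesis
      unfolding e_def[abs_def] .
  qed
  ultimately show thesis using that grid lim by blast
qed

lemma ennreal_halves: "ennreal (1 / 2) * x + ennreal (1 / 2) * x = x"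
proof -
  have "ennreal (1 / 2) + ennreal (1 / 2) = ennreal (1 / 2 + 1 / 2)" by (rule ennreal_plus[symmetric]) auto
  then show ?thesis by (simp only: distrib_right[symmetric]) simp
qed

text \<open>
  \<open>F\<close> is the data term and \<open>r\<close> lists the values of the penalty. If \<open>z\<close> did not converge, coercivity would provide a
  subsequence that converges to some \<open>l\<close> different from \<open>z'\<close>. The objective at
  the midpoint of \<open>z n\<close> and \<open>z'\<close> is at least the minimum, while the averages of the two objective values tend
  to the minimum. Subtracting, the remaining terms \<open>r\<close> cancel, and in the limit \<open>F\<close> at the midpoint of \<open>l\<close> and
  \<open>z'\<close> is at least the average of \<open>F l\<close> and \<open>F z'\<close>, against strict convexity.
\<close>

lemma strictly_convex_minimising_sequence:
  fixes F :: "'a::euclidean_space \<Rightarrow> ennreal" and z :: "nat \<Rightarrow> 'a"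
  assumes coercive: "coercive F" and cont: "continuous_on UNIV F" and convex: "strictly_convex F"
    and fin: "F z' + r' < \<infinity>"
    and lim: "(\<lambda>n. F (z n) + r n) \<longlonglongrightarrow> F z' + r'"
    and mid: "\<And>n. F z' + r' \<le> F ((1 / 2) *\<^sub>R z n + (1 / 2) *\<^sub>R z') + (ennreal (1 / 2) * r n + ennreal (1 / 2) * r')"
  shows "z \<longlonglongrightarrow> z'"
proof (rule ccontr)
  assume "\<not> z \<longlonglongrightarrow> z'"
  let ?J = "F z' + r'"
  let ?h = "ennreal (1 / 2)"
  obtain \<epsilon> where \<epsilon>: "0 < \<epsilon>" "\<And>N. \<exists>n\<ge>N. \<epsilon> \<le> dist (z n) z'"
    using \<open>\<not> z \<longlonglongrightarrow> z'\<close> by (auto simp: lim_sequentially not_less)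
  have less: "?J < ?J + 1"
    using fin ennreal_add_left_cancel_less[of ?J 0 1] by (simp add: less_top[symmetric])
  have "\<forall>\<^sub>F x in at_infinity. ?J + 1 < F x"
    using coercive fin unfolding coercive_def
    by (intro order_tendstoD) (auto simp: less_top[symmetric])
  then obtain R where R: "\<And>x. R \<le> norm x \<Longrightarrow> ?J + 1 < F x" by (auto simp: eventually_at_infinity)
  have "\<forall>\<^sub>F n in sequentially. F (z n) + r n < ?J + 1" using lim less by (rule order_tendstoD)
  then obtain N where N: "\<And>n. N \<le> n \<Longrightarrow> F (z n) + r n < ?J + 1" by (auto simp: eventually_sequentially)
  have bd: "z n \<in> cball 0 R" if "N \<le> n" for n
  proof (rule ccontr)
    assume "z n \<notin> cball 0 R"
    then have "?J + 1 < F (z n)" by (intro R) simp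
    also have "F (z n) \<le> F (z n) + r n" by simp
    finally show False using N[OF that] by simp
  qed
  have "infinite {n. N \<le> n \<and> \<epsilon> \<le> dist (z n) z'}"
    unfolding infinite_nat_iff_unbounded_le
  proof
    fix k
    obtain n where "max k N \<le> n" "\<epsilon> \<le> dist (z n) z'" using \<epsilon>(2) by blast
    then show "\<exists>n\<ge>k. n \<in> {n. N \<le> n \<and> \<epsilon> \<le> dist (z n) z'}" by auto
  qed
  from infinite_enumerate[OF this]
  obtain s :: "nat \<Rightarrow> nat" where s: "strict_mono s" and "\<forall>k. s k \<in> {n. N \<le> n \<and> \<epsilon> \<le> dist (z n) z'}" by blast
  then have Ns: "N \<le> s k" "\<epsilon> \<le> dist (z (s k)) z'" for k by auto
  have "\<exists>l\<in>cball 0 R. \<exists>t. strict_mono t \<and> ((\<lambda>k. z (s k)) \<circ> t) \<longlonglongrightarrow> l"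
    by (rule compact_cball[of 0 R, unfolded compact_def, rule_format]) (rule bd[OF Ns(1)])
  then obtain l and t :: "nat \<Rightarrow> nat" where t: "strict_mono t" "((\<lambda>k. z (s k)) \<circ> t) \<longlonglongrightarrow> l"
    by blast
  define q where "q = s \<circ> t"
  have q: "strict_mono q" unfolding q_def using s t by (intro strict_mono_o)
  have zl: "(\<lambda>k. z (q k)) \<longlonglongrightarrow> l" using t(2) by (simp add: q_def o_def)
  have "\<epsilon> \<le> dist l z'"
    by (rule LIMSEQ_le_const[OF tendsto_dist[OF zl tendsto_const]]) (auto simp: q_def Ns(2))
  then have "l \<noteq> z'" using \<epsilon>(1) by auto
  have J: "(\<lambda>k. F (z (q k)) + r (q k)) \<longlonglongrightarrow> ?J"
    using LIMSEQ_subseq_LIMSEQ[OF lim q] by (simp add: o_def)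
  have Fl: "(\<lambda>k. F (z (q k))) \<longlonglongrightarrow> F l"
    by (rule continuous_on_tendsto_compose[OF cont zl]) auto
  let ?w = "\<lambda>x. (1 / 2) *\<^sub>R x + (1 / 2) *\<^sub>R z'"
  have "(\<lambda>k. ?w (z (q k))) \<longlonglongrightarrow> ?w l" by (intro tendsto_intros zl)
  then have Fw: "(\<lambda>k. F (?w (z (q k)))) \<longlonglongrightarrow> F (?w l)"
    by (rule continuous_on_tendsto_compose[OF cont]) auto
  have h: "(\<lambda>k. ?h * x k) \<longlonglongrightarrow> ?h * y" if "x \<longlonglongrightarrow> y" for x y
    by (rule ennreal_tendsto_cmult[OF ennreal_less_top that])
  have "?J + (?h * F (z (q k)) + ?h * F z') \<le> F (?w (z (q k))) + (?h * (F (z (q k)) + r (q k)) + ?h * ?J)" for k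
    using add_right_mono[OF mid[of "q k"], of "?h * F (z (q k)) + ?h * F z'"]
    by (simp add: distrib_left ac_simps)
  then have "?J + (?h * F l + ?h * F z') \<le> F (?w l) + (?h * ?J + ?h * ?J)"
    by (intro LIMSEQ_le[OF tendsto_add[OF tendsto_const tendsto_add[OF h[OF Fl] tendsto_const]]
          tendsto_add[OF Fw tendsto_add[OF h[OF J] tendsto_const]]]) auto
  then have "?J + (?h * F l + ?h * F z') \<le> ?J + F (?w l)" by (simp only: ennreal_halves add.commute)
  then have "?h * F l + ?h * F z' \<le> F (?w l)"
    using fin by (auto simp: ennreal_add_left_cancel_le less_top)
  moreover have "F l \<le> ?J"
    by (rule LIMSEQ_le[OF Fl J]) auto
  then have "F l < \<infinity>" using fin by (rule order.strict_trans1)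
  moreover have "F z' < \<infinity>" using fin by (simp add: less_top[symmetric])
  ultimately have "F (?w l) < ?h * F l + ?h * F z'"
    using convex[unfolded strictly_convex_def, rule_format, of l z' "1 / 2"] \<open>l \<noteq> z'\<close> by simp
  then show False using \<open>?h * F l + ?h * F z' \<le> F (?w l)\<close> by simp
qed

theorem theorem4:
  fixes y :: "real ^ 'm"
    and E :: "real ^ 'm \<Rightarrow> real ^ 'm \<Rightarrow> ennreal"
    and \<nu> :: "functional \<Rightarrow> real ^ 'm"
    and \<theta> lam :: real
    and fs :: "nat \<Rightarrow> functional" and fstar :: functional
  assumes "\<forall>z. proper (E z)"
    and "\<forall>z. coercive (E z)"
    and "\<forall>z. continuous_on UNIV (E z)"
    and "\<forall>z. strictly_convex (E z)"
    and "linear_on_cone \<nu>"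
    and "continuous_map (subtopology weak_star M_DD0_pos) euclidean \<nu>"
    and "0 < \<theta>" and "\<theta> \<le> 1" and "0 < lam"
    and "\<forall>n\<ge>1. fs n \<in> argmin_set (M_DD0_pos_grid n) (objective E y \<nu> lam \<theta>)"
    and "fstar \<in> argmin_set M_DD0_pos (objective E y \<nu> lam \<theta>)"
  shows "((\<lambda>n. objective E y \<nu> lam \<theta> (fs n)) \<longlonglongrightarrow> objective E y \<nu> lam \<theta> fstar) \<and>
         ((\<lambda>n. \<nu> (fs n)) \<longlonglongrightarrow> \<nu> fstar)"
proof
  let ?J = "objective E y \<nu> lam \<theta>"
  have cont: "continuous_on UNIV (E y)" using assms(3) by blast
  have star: "fstar \<in> M_DD0_pos" "?J fstar < \<infinity>" "\<And>f. f \<in> M_DD0_pos \<Longrightarrow> ?J fstar \<le> ?J f"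
    using assms(11) by (auto simp: argmin_set_def)
  have fs: "fs n \<in> M_DD0_pos" "\<And>f. f \<in> M_DD0_pos_grid n \<Longrightarrow> ?J (fs n) \<le> ?J f" if "1 \<le> n" for n
    using assms(10) that by (auto simp: argmin_set_def M_DD0_pos_grid_def)
  obtain g e where g: "\<And>n. g n \<in> M_DD0_pos_grid n" "(\<lambda>n. \<nu> (g n)) \<longlonglongrightarrow> \<nu> fstar"
    "\<And>n. norm_theta \<theta> (g n) \<le> norm_theta \<theta> fstar + ennreal (e n)" "e \<longlonglongrightarrow> 0"
    using step_approx_consistent[OF star(1) assms(6), of \<theta>] by blast
  show lim: "(\<lambda>n. ?J (fs n)) \<longlonglongrightarrow> ?J fstar"
  proof (rule tendsto_sandwich)
    show "\<forall>\<^sub>F n in sequentially. ?J fstar \<le> ?J (fs n)"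
      using eventually_ge_at_top[of 1] by eventually_elim (intro star(3) fs(1))
    \<comment> \<open>The bound of the objective along the recovery sequence.\<close>
    let ?U = "\<lambda>n. E y (\<nu> (g n)) + ennreal lam * (norm_theta \<theta> fstar + ennreal (e n))"
    show "\<forall>\<^sub>F n in sequentially. ?J (fs n) \<le> ?U n"
      using eventually_ge_at_top[of 1]
    proof eventually_elim
      case (elim n)
      have "?J (fs n) \<le> ?J (g n)" by (rule fs(2)[OF elim g(1)])
      also have "\<dots> \<le> ?U n"
        unfolding objective_def using g(3) by (intro add_left_mono mult_left_mono) auto
      finally show ?case .
    qed
    have "(\<lambda>n. E y (\<nu> (g n))) \<longlonglongrightarrow> E y (\<nu> fstar)"
      by (rule continuous_on_tendsto_compose[OF cont g(2)]) auto
    moreover have "(\<lambda>n. norm_theta \<theta> fstar + ennreal (e n)) \<longlonglongrightarrow> norm_theta \<theta> fstar + ennreal 0"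
      by (intro tendsto_add tendsto_const tendsto_ennrealI g(4))
    then have "(\<lambda>n. ennreal lam * (norm_theta \<theta> fstar + ennreal (e n))) \<longlonglongrightarrow> ennreal lam * (norm_theta \<theta> fstar + ennreal 0)"
      by (intro ennreal_tendsto_cmult) auto
    ultimately have "?U \<longlonglongrightarrow> E y (\<nu> fstar) + ennreal lam * (norm_theta \<theta> fstar + ennreal 0)"
      by (rule tendsto_add)
    then show "?U \<longlonglongrightarrow> ?J fstar" by (simp add: objective_def)
  qed auto
  \<comment> \<open>Nothing is known about \<open>fs 0\<close>, hence the shift.\<close>
  have "(\<lambda>n. \<nu> (fs (Suc n))) \<longlonglongrightarrow> \<nu> fstar"
  proof (rule strictly_convex_minimising_sequence[where F = "E y" and r' = "ennreal lam * norm_theta \<theta> fstar"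
        and r = "\<lambda>n. ennreal lam * norm_theta \<theta> (fs (Suc n))"])
    show "(\<lambda>n. E y (\<nu> (fs (Suc n))) + ennreal lam * norm_theta \<theta> (fs (Suc n)))
        \<longlonglongrightarrow> E y (\<nu> fstar) + ennreal lam * norm_theta \<theta> fstar"
      using LIMSEQ_Suc[OF lim] by (simp add: objective_def)
    fix n
    let ?h = "\<lambda>\<phi>. 1 / 2 * fs (Suc n) \<phi> + 1 / 2 * fstar \<phi>"
    have pos: "fs (Suc n) \<in> M_DD0_pos" by (rule fs(1)) simp
    have "\<nu> ?h = (1 / 2) *\<^sub>R \<nu> (fs (Suc n)) + (1 / 2) *\<^sub>R \<nu> fstar"
      using assms(5)[unfolded linear_on_cone_def, rule_format, OF pos star(1), of "1 / 2" "1 / 2"] by simp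
    then have "?J fstar \<le> E y ((1 / 2) *\<^sub>R \<nu> (fs (Suc n)) + (1 / 2) *\<^sub>R \<nu> fstar) + ennreal lam * norm_theta \<theta> ?h"
      using star(3)[OF M_DD0_pos_cone[OF pos star(1), of "1 / 2" "1 / 2"]] by (simp add: objective_def)
    also have "\<dots> \<le> E y ((1 / 2) *\<^sub>R \<nu> (fs (Suc n)) + (1 / 2) *\<^sub>R \<nu> fstar) + ennreal lam *
        (ennreal (1 / 2) * norm_theta \<theta> (fs (Suc n)) + ennreal (1 / 2) * norm_theta \<theta> fstar)"
      by (intro add_left_mono mult_left_mono norm_theta_convex) auto
    finally show "E y (\<nu> fstar) + ennreal lam * norm_theta \<theta> fstar
        \<le> E y ((1 / 2) *\<^sub>R \<nu> (fs (Suc n)) + (1 / 2) *\<^sub>R \<nu> fstar) +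
          (ennreal (1 / 2) * (ennreal lam * norm_theta \<theta> (fs (Suc n))) + ennreal (1 / 2) * (ennreal lam * norm_theta \<theta> fstar))"
      by (simp add: objective_def distrib_left ac_simps)
  qed (use assms star(2) in \<open>auto simp: objective_def\<close>)
  then show "(\<lambda>n. \<nu> (fs n)) \<longlonglongrightarrow> \<nu> fstar" by (rule LIMSEQ_imp_Suc)
qed

end
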